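(* Let $n$ be a positive integer and let $W\subseteq R_{(1,n)}$ be a basepoint free subspace of dimension three. If $\mathbb P(W)\cap\Sigma_{1,n}$ is finite and contains three noncollinear points, then the bigraded Betti numbers of $I_W$ are those given by a minimal bigraded free resolution of the form $$0\leftarrow I_W\leftarrow R(-1,-n)^3\leftarrow\begin{array}{c}R(-1,-3n)\\ \oplus\\ R(-2,-2n)^3\\ \oplus\\ R(-3,-n-\mu)\\ \oplus\\ R(-3,-2n+\mu)\end{array}\leftarrow\begin{array}{c}R(-2,-3n)^2\\ \oplus\\ R(-3,-2n)^3\end{array}\leftarrow R(-3,-3n)\leftarrow0$$ for some integer $\mu$ with $0<\mu\le\lfloor n/2\rfloor$.
   Context: $\mathbb K$ is a field, and $R=\mathbb K[s,t;u,v]$ is $\mathbb Z^2$-graded with $\deg s=\deg t=(1,0)$, $\deg u=\deg v=(0,1)$. For $W=\operatorname{Span}\{f_0,f_1,f_2\}$, $I_W=\langle f_0,f_1,f_2\rangle$; $W$ is basepoint free if $\sqrt{I_W}=\langle s,t\rangle\cap\langle u,v\rangle$. $\Sigma_{1,n}\subset\mathbb P(R_{(1,n)})=\mathbb P^{2n+1}$ is the Segre variety of factorizable polynomials, i.e. the image of $\mathbb P(R_{(1,0)})\times\mathbb P(R_{(0,n)})=\mathbb P^1\times\mathbb P^n$ under multiplication $(l,g)\mapsto lg$. The bigraded Betti numbers of $I_W$ record how many copies of each $R(-\mathbf a)$, $\mathbf a\in\mathbb Z^2$, appear in each step of the minimal bigraded free resolution. *)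

theory Defs
  imports
    "HOL-Library.Poly_Mapping"
    "HOL-Library.Product_Plus"
    "HOL-Algebra.Algebraic_Closure_Type"
    "Jordan_Normal_Form.Matrix_Kernel"
begin

section \<open>The bigraded ring \<open>R = K[s,t;u,v]\<close>\<close>

datatype indet = Xs | Xt | Xu | Xv

type_synonym monom = "indet \<Rightarrow>\<^sub>0 nat"

type_synonym 'k bipoly = "monom \<Rightarrow>\<^sub>0 'k"

definition var :: "indet \<Rightarrow> 'k::field bipoly" where
  "var x = Poly_Mapping.single (Poly_Mapping.single x 1) 1"

definition bideg :: "monom \<Rightarrow> int \<times> int" where
  "bideg m = (int (Poly_Mapping.lookup m Xs + Poly_Mapping.lookup m Xt),
     int (Poly_Mapping.lookup m Xu + Poly_Mapping.lookup m Xv))"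

definition bihom :: "int \<times> int \<Rightarrow> 'k::field bipoly set" where
  "bihom a = {p. \<forall>m \<in> Poly_Mapping.keys p. bideg m = a}"

definition scale :: "'k::field \<Rightarrow> 'k bipoly \<Rightarrow> 'k bipoly" where
  "scale c p = Poly_Mapping.single 0 c * p"

global_interpretation bipoly: Vector_Spaces.vector_space "scale :: 'k::field \<Rightarrow> 'k bipoly \<Rightarrow> 'k bipoly"
  by unfold_locales
    (simp_all add: scale_def algebra_simps single_add mult_single flip: mult.assoc)

section \<open>Ideals and basepoint freeness\<close>

text \<open>The ring as a module over itself: its submodules are the ideals, and its span
  operator is the ideal generated by a set.\<close>

global_interpretation bipoly_ideal: Modules.module "(*) :: 'k::field bipoly \<Rightarrow> 'k bipoly \<Rightarrow> 'k bipoly"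
  by unfold_locales (simp_all add: algebra_simps)

abbreviation ideal_gen :: "'k::field bipoly set \<Rightarrow> 'k bipoly set" where
  "ideal_gen \<equiv> bipoly_ideal.span"

definition radical :: "'k::field bipoly set \<Rightarrow> 'k bipoly set" where
  "radical I = {p. \<exists>k. p ^ k \<in> I}"

definition basepoint_free :: "'k::field bipoly set \<Rightarrow> bool" where
  "basepoint_free W \<longleftrightarrow>
     radical (ideal_gen W) = ideal_gen {var Xs, var Xt} \<inter> ideal_gen {var Xu, var Xv}"

section \<open>Projective points and the Segre variety\<close>

text \<open>A point of the projective space of \<open>V\<close> is a line through the origin in \<open>V\<close>.\<close>

definition proj_points :: "'k::field bipoly set \<Rightarrow> 'k bipoly set set" where
  "proj_points V = {bipoly.span {p} | p. p \<in> V \<and> p \<noteq> 0}"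

definition segre :: "nat \<Rightarrow> 'k::field bipoly set set" where
  "segre n = {bipoly.span {l * g} | l g.
     l \<in> bihom (1, 0) \<and> l \<noteq> 0 \<and> g \<in> bihom (0, int n) \<and> g \<noteq> 0}"

text \<open>A projective line is the set of points of a two-dimensional subspace.\<close>

definition proj_collinear :: "'k::field bipoly set set \<Rightarrow> bool" where
  "proj_collinear P \<longleftrightarrow>
     (\<exists>V. bipoly.subspace V \<and> bipoly.dim V = 2 \<and> P \<subseteq> proj_points V)"

text \<open>The intersection of \<open>\<PP>(W)\<close> with the Segre variety is an intersection of varieties over
  \<open>K\<close>, and its points are taken over the algebraic closure.  Over a finite field the set of
  rational points alone is always finite, even when the intersection is a conic.\<close>

definition extend_scalars :: "'k::field bipoly set \<Rightarrow> 'k alg_closure bipoly set" where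
  "extend_scalars W = bipoly.span (Poly_Mapping.map to_ac ` W)"

definition segre_section :: "nat \<Rightarrow> 'k::field bipoly set \<Rightarrow> 'k alg_closure bipoly set set" where
  "segre_section n W = proj_points (extend_scalars W) \<inter> segre n"

section \<open>Minimal bigraded free resolutions and Betti numbers\<close>

text \<open>A list \<open>as\<close> of bidegrees stands for the free module \<open>\<Oplus>\<^sub>j R(-as\<^sub>j)\<close>, whose \<open>j\<close>-th generator
  sits in degree \<open>as\<^sub>j\<close>.  A degree-preserving map from \<open>as\<close> to \<open>bs\<close> is a matrix whose \<open>(i,j)\<close>
  entry is homogeneous of degree \<open>as\<^sub>j - bs\<^sub>i\<close>.\<close>

definition graded_map :: "(int \<times> int) list \<Rightarrow> (int \<times> int) list \<Rightarrow> 'k::field bipoly mat \<Rightarrow> bool" where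
  "graded_map as bs M \<longleftrightarrow> M \<in> carrier_mat (length bs) (length as) \<and>
     (\<forall>i < length bs. \<forall>j < length as. M $$ (i, j) \<in> bihom (as ! j - bs ! i))"

definition mat_image :: "'k::field bipoly mat \<Rightarrow> 'k bipoly vec set" where
  "mat_image M = (\<lambda>x. M *\<^sub>v x) ` carrier_vec (dim_col M)"

text \<open>The map \<open>d 0\<close> is the augmentation \<open>F 0 \<rightarrow> I \<subseteq> R\<close>, and \<open>d (i + 1)\<close> maps
  \<open>F (i + 1)\<close> to \<open>F i\<close>.  A finite resolution has \<open>F i = []\<close> for large \<open>i\<close>.\<close>

definition bigraded_free_resolution ::
  "'k::field bipoly set \<Rightarrow> (nat \<Rightarrow> (int \<times> int) list) \<Rightarrow> (nat \<Rightarrow> 'k bipoly mat) \<Rightarrow> bool" where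
  "bigraded_free_resolution I F d \<longleftrightarrow>
     graded_map (F 0) [(0, 0)] (d 0) \<and>
     mat_image (d 0) = {v \<in> carrier_vec 1. v $ 0 \<in> I} \<and>
     (\<forall>i. graded_map (F (Suc i)) (F i) (d (Suc i)) \<and>
          mat_image (d (Suc i)) = mat_kernel (d i))"

definition minimal_bigraded_free_resolution ::
  "'k::field bipoly set \<Rightarrow> (nat \<Rightarrow> (int \<times> int) list) \<Rightarrow> (nat \<Rightarrow> 'k bipoly mat) \<Rightarrow> bool" where
  "minimal_bigraded_free_resolution I F d \<longleftrightarrow>
     bigraded_free_resolution I F d \<and>
     (\<forall>i. elements_mat (d (Suc i)) \<subseteq> ideal_gen {var Xs, var Xt, var Xu, var Xv})"

text \<open>\<open>\<beta> i a\<close> is the number of copies of \<open>R(-a)\<close> in step \<open>i\<close>; the minimal resolution is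
  unique up to isomorphism, so at most one \<open>\<beta>\<close> qualifies.\<close>

definition has_bigraded_betti_numbers ::
  "'k::field bipoly set \<Rightarrow> (nat \<Rightarrow> int \<times> int \<Rightarrow> nat) \<Rightarrow> bool" where
  "has_bigraded_betti_numbers I \<beta> \<longleftrightarrow>
     (\<exists>F d. minimal_bigraded_free_resolution I F d \<and> (\<forall>i a. \<beta> i a = count_list (F i) a))"

definition betti_of_shifts :: "(int \<times> int) list list \<Rightarrow> nat \<Rightarrow> int \<times> int \<Rightarrow> nat" where
  "betti_of_shifts Fs i a = (if i < length Fs then count_list (Fs ! i) a else 0)"

end

theory Submission
  imports Defs
begin

text \<open>
  Over the algebraic closure the three noncollinear points make the extension of \<open>W\<close> the span of
  three products \<open>l\<^sub>i g\<^sub>i\<close> of a linear form in \<open>s, t\<close> and a form of degree \<open>n\<close> in \<open>u, v\<close>.  If two of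
  the \<open>l\<^sub>i\<close> were proportional, the section would contain a line, and if the \<open>g\<^sub>i\<close> were linearly
  dependent, it would contain a conic.  So finiteness forces the \<open>l\<^sub>i\<close> to be pairwise
  nonproportional, and after rescaling \<open>l\<^sub>0 + l\<^sub>1 + l\<^sub>2 = 0\<close>, and the \<open>g\<^sub>i\<close> to be independent
  (\<open>three_points_normal_form\<close>).  Basepoint freeness makes the \<open>g\<^sub>i\<close> pairwise coprime.

  The individual points need not be rational over \<open>K\<close>, but the span \<open>U\<close> of the \<open>g\<^sub>i\<close> is: it is
  spanned by the coefficients of \<open>s\<close> and \<open>t\<close> in the elements of \<open>W\<close>.  With a basis \<open>q\<close> of \<open>U\<close> over
  \<open>K\<close>, the row of generators of \<open>W\<close> is \<open>f = q M = s a + t b\<close>, where \<open>M = s X + t Y\<close> is a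
  \<open>3 \<times> 3\<close> matrix over \<open>K\<close>, \<open>a = q X\<close> and \<open>b = q Y\<close>; over the closure
  \<open>M = P diag(l\<^sub>0, l\<^sub>1, l\<^sub>2) Q\<close> with \<open>P, Q\<close> constant and invertible (\<open>section_coordinates\<close>).

  The integer \<open>\<mu>\<close> comes from \<open>K[u,v]\<close>: by Hilbert and Burch \<open>q = N\<^sub>1 \<times> N\<^sub>2\<close> is a cross product of two
  syzygies of \<open>q\<close>, of degrees \<open>\<mu> \<le> n - \<mu>\<close>, and \<open>\<mu> > 0\<close> because \<open>q\<close> is linearly independent
  (\<open>hilbert_burch\<close>).  The resolution can then be written down, with \<open>adj\<close> the adjugate:
  \<open>d\<^sub>0 = f\<close>,
  \<open>d\<^sub>1 (\<xi>, y, z\<^sub>1, z\<^sub>2) = \<xi> (a \<times> b) + f \<times> y + adj(M) (z\<^sub>1 N\<^sub>1 + z\<^sub>2 N\<^sub>2)\<close>,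
  \<open>d\<^sub>2 (\<alpha>, \<beta>, \<gamma>) = (s \<alpha> + t \<beta>, \<beta> a - \<alpha> b + \<gamma> M, N\<^sub>2 \<cdot> \<gamma>, - N\<^sub>1 \<cdot> \<gamma>)\<close>,
  \<open>d\<^sub>3 w = (t w, - s w, w q)\<close>.
  That this is a complex rests on \<open>f \<times> a = - t (a \<times> b)\<close>, \<open>f \<times> b = s (a \<times> b)\<close> and
  \<open>(q M) \<times> (\<gamma> M) = adj(M) (q \<times> \<gamma>)\<close>.  The syzygies \<open>a \<times> b\<close>, \<open>f \<times> e\<^sub>i\<close> and \<open>adj(M) N\<^sub>i\<close> give the
  shifts \<open>(1, 3n)\<close>, \<open>(2, 2n)\<close>, \<open>(3, n + \<mu>)\<close> and \<open>(3, 2n - \<mu>)\<close>, and consecutive free modules share no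
  shift, so the resolution is minimal.

  Exactness at the end of the complex is elementary over \<open>K\<close>.  At the generators and at the first
  syzygies it is proved over the closure, where \<open>M\<close> becomes diagonal and one can reduce modulo each
  \<open>l\<^sub>i\<close> (\<open>exact_at_generators\<close>, \<open>exact_at_syzygies\<close>).  It descends to \<open>K\<close> because a \<open>K\<close>-linear
  retraction of the closure onto \<open>K\<close>, applied to coefficients, turns a solution of a linear system
  with coefficients in \<open>K[s,t,u,v]\<close> into a solution over \<open>K\<close> (\<open>section_exactness\<close>).
\<close>

section \<open>Homomorphisms out of the polynomial ring\<close>

text \<open>A linear order on the variables makes the monomials an ordered monoid, and comparing leading
  monomials then shows that the polynomial ring is an integral domain.\<close>

instantiation indet :: linorder
begin

definition less_eq_indet :: "indet \<Rightarrow> indet \<Rightarrow> bool" where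
  "less_eq_indet x y \<longleftrightarrow> case_indet (0::nat) 1 2 3 x \<le> case_indet 0 1 2 3 y"

definition less_indet :: "indet \<Rightarrow> indet \<Rightarrow> bool" where
  "less_indet x y \<longleftrightarrow> case_indet (0::nat) 1 2 3 x < case_indet 0 1 2 3 y"

instance
  by standard (auto simp: less_eq_indet_def less_indet_def split: indet.splits)

end

abbreviation single :: "'a \<Rightarrow> 'b::zero \<Rightarrow> 'a \<Rightarrow>\<^sub>0 'b" where
  "single \<equiv> Poly_Mapping.single"

abbreviation lookup :: "('a \<Rightarrow>\<^sub>0 'b::zero) \<Rightarrow> 'a \<Rightarrow> 'b" where
  "lookup \<equiv> Poly_Mapping.lookup"

abbreviation cst :: "'k::field \<Rightarrow> 'k bipoly" where
  "cst c \<equiv> single 0 c"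

lemma cst_mult: "cst (a * b) = cst a * cst b"
  by (simp add: mult_single)

lemma scale_eq: "scale c p = cst c * p"
  by (simp add: scale_def)

lemma bipoly_add_induct [case_names single add]:
  fixes p :: "'k::field bipoly"
  assumes single: "\<And>m c. P (single m c)"
    and add: "\<And>p q. P p \<Longrightarrow> P q \<Longrightarrow> P (p + q)"
  shows "P p"
proof (induction p rule: update_induct)
  case const
  show ?case using single[of 0 0] by simp
next
  case (update p m c)
  have "Poly_Mapping.update m c p = p + single m c"
    using update(1) by (intro poly_mapping_eqI)
      (auto simp: lookup_update lookup_add lookup_single not_in_keys_iff_lookup_eq_zero when_def)
  then show ?case using add[OF update(3) single] by simp
qed

lemma single_var_power:
  "single (single x k) (1::'k::field) = var x ^ k"
proof (induction k)
  case (Suc k)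
  have "single (single x (Suc k)) (1::'k)
      = single (single x 1) 1 * single (single x k) 1"
    by (simp add: mult_single flip: single_add)
  then show ?case using Suc by (simp add: var_def)
qed simp

lemma monom_split:
  fixes m :: monom
  shows "m = single Xs (lookup m Xs) + single Xt (lookup m Xt)
    + single Xu (lookup m Xu) + single Xv (lookup m Xv)"
proof (rule poly_mapping_eqI)
  fix k :: indet
  show "lookup m k = lookup (single Xs (lookup m Xs) + single Xt (lookup m Xt)
    + single Xu (lookup m Xu) + single Xv (lookup m Xv)) k"
    by (cases k) (auto simp: lookup_add lookup_single when_def)
qed

definition meval :: "(indet \<Rightarrow> 'b::comm_ring_1) \<Rightarrow> monom \<Rightarrow> 'b" where
  "meval \<theta> m = \<theta> Xs ^ lookup m Xs * \<theta> Xt ^ lookup m Xt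
     * \<theta> Xu ^ lookup m Xu * \<theta> Xv ^ lookup m Xv"

lemma meval_add: "meval \<theta> (m + m') = meval \<theta> m * meval \<theta> m'"
  by (simp add: meval_def lookup_add power_add algebra_simps)

lemma meval_0 [simp]: "meval \<theta> 0 = 1"
  by (simp add: meval_def)

lemma single_eq_meval: "single m (c::'k::field) = cst c * meval var m"
proof -
  have "cst c * meval var m = single
     (single Xs (lookup m Xs) + single Xt (lookup m Xt)
    + single Xu (lookup m Xu) + single Xv (lookup m Xv)) c"
    by (simp add: meval_def mult_single flip: single_var_power)
  then show ?thesis using monom_split[of m] by simp
qed

lemma bipoly_induct [case_names cst var add mult]:
  fixes p :: "'k::field bipoly"
  assumes cst: "\<And>c. P (cst c)" and var: "\<And>x. P (var x)"
    and add: "\<And>p q. P p \<Longrightarrow> P q \<Longrightarrow> P (p + q)"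
    and mult: "\<And>p q. P p \<Longrightarrow> P q \<Longrightarrow> P (p * q)"
  shows "P p"
proof (induction p rule: bipoly_add_induct)
  case (single m c)
  have pw: "P (var x ^ k)" for x k
    using cst[of 1] by (induction k) (auto intro: var mult)
  show ?case unfolding single_eq_meval[of m c] meval_def
    by (intro mult cst pw)
qed (rule add)

text \<open>Homomorphisms are taken as functions on types, so that substitutions, coefficient extensions
  and reductions modulo linear forms are all covered by one set of rewrite rules.\<close>

definition ring_map :: "('a::comm_ring_1 \<Rightarrow> 'b::comm_ring_1) \<Rightarrow> bool" where
  "ring_map h \<longleftrightarrow> h 1 = 1 \<and> (\<forall>x y. h (x + y) = h x + h y) \<and> (\<forall>x y. h (x * y) = h x * h y)"

lemma ring_map_simps:
  assumes "ring_map h"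
  shows "h 0 = 0" "h 1 = 1" "h (x + y) = h x + h y" "h (x * y) = h x * h y"
    "h (- x) = - h x" "h (x - y) = h x - h y" "h (x ^ k) = h x ^ k"
proof -
  have a: "\<And>x y. h (x + y) = h x + h y" and m: "\<And>x y. h (x * y) = h x * h y" and o: "h 1 = 1"
    using assms by (auto simp: ring_map_def)
  show z: "h 0 = 0" using a[of 0 0] by simp
  have n: "h (- x) = - h x" for x using a[of x "- x"] z by (simp add: eq_neg_iff_add_eq_0 add.commute)
  show "h 1 = 1" "h (x + y) = h x + h y" "h (x * y) = h x * h y" "h (- x) = - h x" by fact+
  show "h (x - y) = h x - h y" using a[of x "- y"] n by simp
  show "h (x ^ k) = h x ^ k" by (induction k) (simp_all add: o m)
qed

lemma ring_map_id: "ring_map (\<lambda>x. x)"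
  by (simp add: ring_map_def)

lemma ring_map_cst: "ring_map (cst :: 'k::field \<Rightarrow> _)"
  by (simp add: ring_map_def single_add cst_mult)

lemma ring_map_eqI:
  fixes p :: "'k::field bipoly"
  assumes "ring_map g" "ring_map h" "\<And>c. g (cst c) = h (cst c)" "\<And>x. g (var x) = h (var x)"
  shows "g p = h p"
  by (induction p rule: bipoly_induct) (simp_all add: assms(3,4) ring_map_simps[OF assms(1)] ring_map_simps[OF assms(2)])

text \<open>The homomorphism that acts by \<open>\<phi>\<close> on coefficients and sends each variable \<open>x\<close> to \<open>\<theta> x\<close>.\<close>

definition peval :: "('k::field \<Rightarrow> 'b::comm_ring_1) \<Rightarrow> (indet \<Rightarrow> 'b) \<Rightarrow> 'k bipoly \<Rightarrow> 'b" where
  "peval \<phi> \<theta> p = (\<Sum>m\<in>Poly_Mapping.keys p. \<phi> (lookup p m) * meval \<theta> m)"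

lemma peval_superset:
  assumes "\<phi> 0 = 0" "finite A" "Poly_Mapping.keys p \<subseteq> A"
  shows "peval \<phi> \<theta> p = (\<Sum>m\<in>A. \<phi> (lookup p m) * meval \<theta> m)"
  unfolding peval_def using assms
  by (intro sum.mono_neutral_left) (auto simp: in_keys_iff)

lemma peval_single: "\<phi> 0 = 0 \<Longrightarrow> peval \<phi> \<theta> (single m c) = \<phi> c * meval \<theta> m"
  by (subst peval_superset[of _ "{m}"]) (auto simp: keys_single split: if_splits)

lemma ring_map_peval:
  assumes "ring_map \<phi>"
  shows "ring_map (peval \<phi> \<theta>)"
proof -
  have z: "\<phi> 0 = 0" by (simp add: ring_map_simps[OF assms])
  have add: "peval \<phi> \<theta> (p + q) = peval \<phi> \<theta> p + peval \<phi> \<theta> q" for p q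
  proof -
    let ?A = "Poly_Mapping.keys p \<union> Poly_Mapping.keys q"
    have "Poly_Mapping.keys (p + q) \<subseteq> ?A" by (rule Poly_Mapping.keys_add)
    then show ?thesis
      by (simp add: peval_superset[of \<phi> ?A] z lookup_add ring_map_simps[OF assms]
          algebra_simps sum.distrib)
  qed
  have mult: "peval \<phi> \<theta> (p * q) = peval \<phi> \<theta> p * peval \<phi> \<theta> q" for p q
  proof (induction p rule: bipoly_add_induct)
    case (single m c)
    show ?case
    proof (induction q rule: bipoly_add_induct)
      case (single m' c')
      show ?case by (simp add: mult_single peval_single z meval_add ring_map_simps[OF assms])
    qed (simp add: add algebra_simps)
  qed (simp add: add algebra_simps)
  have "peval \<phi> \<theta> 1 = 1"
    using peval_single[of \<phi> \<theta> 0 1] z by (simp add: ring_map_simps[OF assms])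
  with add mult show ?thesis by (simp add: ring_map_def)
qed

lemma peval_cst:
  assumes "ring_map \<phi>"
  shows "peval \<phi> \<theta> (cst c) = \<phi> c"
  by (simp add: peval_single ring_map_simps[OF assms])

lemma peval_var:
  assumes "ring_map \<phi>"
  shows "peval \<phi> \<theta> (var x) = \<theta> x"
  by (cases x) (simp_all add: var_def peval_single ring_map_simps[OF assms] meval_def lookup_single)

abbreviation subst :: "(indet \<Rightarrow> 'k::field bipoly) \<Rightarrow> 'k bipoly \<Rightarrow> 'k bipoly" where
  "subst \<equiv> peval cst"

lemmas ring_map_subst = ring_map_peval[OF ring_map_cst]
lemmas subst_simps = ring_map_simps[OF ring_map_subst] peval_cst[OF ring_map_cst] peval_var[OF ring_map_cst]

section \<open>Extension of scalars and its retraction\<close>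

text \<open>Base change to the algebraic closure.\<close>

abbreviation bc :: "'k::field bipoly \<Rightarrow> 'k alg_closure bipoly" where
  "bc \<equiv> Poly_Mapping.map to_ac"

lemma lookup_bc: "lookup (bc p) m = to_ac (lookup p m)"
  by (simp add: Poly_Mapping.map.rep_eq when_def)

lemma bc_single: "bc (single m c) = single m (to_ac c)"
  by (simp add: map_single)

lemma bc_add: "bc (p + q) = bc p + bc q"
  by (rule poly_mapping_eqI) (simp add: lookup_bc lookup_add)

lemma ring_map_bc: "ring_map (bc :: 'k::field bipoly \<Rightarrow> _)"
proof -
  have "bc (p * q) = bc p * bc q" for p q :: "'k bipoly"
  proof (induction p rule: bipoly_add_induct)
    case (single m c)
    show ?case
    proof (induction q rule: bipoly_add_induct)
      case (single m' c')
      show ?case by (simp add: mult_single bc_single)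
    qed (simp add: bc_add algebra_simps)
  qed (simp add: bc_add algebra_simps)
  moreover have "bc (1::'k bipoly) = 1"
    using bc_single[of 0 "1::'k"] by simp
  ultimately show ?thesis by (simp add: ring_map_def bc_add)
qed

lemma bc_var: "bc (var x) = var x"
  by (simp add: var_def bc_single)

lemmas bc_simps = ring_map_simps[OF ring_map_bc] bc_var bc_single

lemma bc_eq_iff [simp]: "bc p = bc q \<longleftrightarrow> p = q"
  by (auto simp: poly_mapping_eq_iff fun_eq_iff lookup_bc)

text \<open>The ground field is a subspace of the algebraic closure, so it has a complement; projecting along
  it gives the retraction.\<close>

lemma coefficient_retraction:
  obtains \<pi> :: "'k::field alg_closure \<Rightarrow> 'k" where
    "\<pi> 1 = 1" "\<And>x y. \<pi> (x + y) = \<pi> x + \<pi> y" "\<And>c x. \<pi> (to_ac c * x) = c * \<pi> x"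
proof -
  interpret V: vector_space "\<lambda>(c::'k) x. to_ac c * x"
    by unfold_locales (simp_all add: algebra_simps)
  interpret K: vector_space "(*) :: 'k \<Rightarrow> 'k \<Rightarrow> 'k"
    by unfold_locales (simp_all add: algebra_simps)
  interpret VP: vector_space_pair "\<lambda>(c::'k) x. to_ac c * x" "(*) :: 'k \<Rightarrow> 'k \<Rightarrow> 'k" ..
  have "V.independent {1}"
    by (simp add: V.dependent_single)
  then obtain g where g: "Vector_Spaces.linear (\<lambda>(c::'k) x. to_ac c * x) (*) g" "\<forall>x\<in>{1}. g x = 1"
    using VP.linear_independent_extend[of "{1}" "\<lambda>_. 1"] by auto
  interpret G: Vector_Spaces.linear "\<lambda>(c::'k) x. to_ac c * x" "(*)" g by fact
  show thesis
    by (rule that[of g]) (use g(2) in \<open>simp_all add: G.add G.scale\<close>)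
qed

text \<open>This is what makes exactness descend: a linear system with coefficients in the small ring that
  is solvable over the big ring is solvable over the small ring, because \<open>\<rho>\<close> is linear over the
  small ring and fixes the right hand side.\<close>

lemma polynomial_retraction:
  obtains \<rho> :: "'k::field alg_closure bipoly \<Rightarrow> 'k bipoly" where
    "\<And>p. \<rho> (bc p) = p" "\<And>p q. \<rho> (p + q) = \<rho> p + \<rho> q" "\<And>p r. \<rho> (p * bc r) = \<rho> p * r"
proof -
  obtain \<pi> :: "'k alg_closure \<Rightarrow> 'k" where
    \<pi>: "\<pi> 1 = 1" "\<And>x y. \<pi> (x + y) = \<pi> x + \<pi> y" "\<And>c x. \<pi> (to_ac c * x) = c * \<pi> x"
    using coefficient_retraction by metis
  have \<pi>0: "\<pi> 0 = 0" using \<pi>(3)[of 0 0] by simp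
  let ?\<rho> = "Poly_Mapping.map \<pi>"
  have lk: "lookup (?\<rho> p) m = \<pi> (lookup p m)" for p :: "'k alg_closure bipoly" and m
    by (simp add: Poly_Mapping.map.rep_eq when_def \<pi>0)
  have add: "?\<rho> (p + q) = ?\<rho> p + ?\<rho> q" for p q :: "'k alg_closure bipoly"
    by (rule poly_mapping_eqI) (simp add: lk lookup_add \<pi>)
  have sg: "?\<rho> (single m c) = single m (\<pi> c)" for m :: monom and c
    by (simp add: map_single \<pi>0)
  have "?\<rho> (p * bc r) = ?\<rho> p * r" for p r
  proof (induction p rule: bipoly_add_induct)
    case (single m c)
    show ?case
    proof (induction r rule: bipoly_add_induct)
      case (single m' c')
      have "\<pi> (c * to_ac c') = \<pi> c * c'" using \<pi>(3)[of c' c] by (simp add: mult.commute)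
      then show ?case by (simp add: mult_single bc_single sg)
    qed (simp add: bc_add add algebra_simps)
  qed (simp add: add algebra_simps)
  moreover have "?\<rho> (bc p) = p" for p
    using \<pi>(3)[of _ 1] by (intro poly_mapping_eqI) (simp add: lk lookup_bc \<pi>(1))
  ultimately show thesis using that add by blast
qed

section \<open>Vectors and matrices of size three\<close>

type_synonym 'a tri = "'a \<times> 'a \<times> 'a"

fun dot :: "'a::comm_ring_1 tri \<Rightarrow> 'a tri \<Rightarrow> 'a" where
  "dot (a0, a1, a2) (b0, b1, b2) = a0 * b0 + a1 * b1 + a2 * b2"

fun cross :: "'a::comm_ring_1 tri \<Rightarrow> 'a tri \<Rightarrow> 'a tri" where
  "cross (a0, a1, a2) (b0, b1, b2) = (a1 * b2 - a2 * b1, a2 * b0 - a0 * b2, a0 * b1 - a1 * b0)"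

fun smul :: "'a::comm_ring_1 \<Rightarrow> 'a tri \<Rightarrow> 'a tri" where
  "smul c (a0, a1, a2) = (c * a0, c * a1, c * a2)"

text \<open>A matrix is the triple of its rows: \<open>vm\<close> multiplies a row vector by a matrix, \<open>mv\<close> a matrix by
  a column vector and \<open>mm\<close> two matrices.\<close>

fun vm :: "'a::comm_ring_1 tri \<Rightarrow> 'a tri tri \<Rightarrow> 'a tri" where
  "vm (x0, x1, x2) (r0, r1, r2) = smul x0 r0 + smul x1 r1 + smul x2 r2"

fun mv :: "'a::comm_ring_1 tri tri \<Rightarrow> 'a tri \<Rightarrow> 'a tri" where
  "mv (r0, r1, r2) x = (dot r0 x, dot r1 x, dot r2 x)"

fun mm :: "'a::comm_ring_1 tri tri \<Rightarrow> 'a tri tri \<Rightarrow> 'a tri tri" where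
  "mm (r0, r1, r2) B = (vm r0 B, vm r1 B, vm r2 B)"

text \<open>The rows of the cofactor matrix.  Its transpose is the adjugate, so \<open>vm y (cof A)\<close> is the adjugate
  of \<open>A\<close> applied to the column \<open>y\<close>.\<close>

fun cof :: "'a::comm_ring_1 tri tri \<Rightarrow> 'a tri tri" where
  "cof (r0, r1, r2) = (cross r1 r2, cross r2 r0, cross r0 r1)"

fun mdet :: "'a::comm_ring_1 tri tri \<Rightarrow> 'a" where
  "mdet (r0, r1, r2) = dot r0 (cross r1 r2)"

fun diag :: "'a::comm_ring_1 tri \<Rightarrow> 'a tri tri" where
  "diag (a, b, c) = ((a, 0, 0), (0, b, 0), (0, 0, c))"

fun tmap :: "('a \<Rightarrow> 'b) \<Rightarrow> 'a tri \<Rightarrow> 'b tri" where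
  "tmap h (a, b, c) = (h a, h b, h c)"

lemma tri_zero: "(0::'a::comm_ring_1 tri) = (0, 0, 0)"
  by (simp add: zero_prod_def)

lemma cross_anti: "cross a b = - cross b a"
  by (cases a, cases b) simp

lemma cross_self [simp]: "cross a a = 0"
  by (cases a) (simp add: tri_zero)

lemma dot_cross_self [simp]: "dot a (cross a b) = 0" "dot b (cross a b) = 0"
  by (cases a, cases b, simp add: algebra_simps)+

lemma dot_commute: "dot a b = dot b a"
  by (cases a, cases b) (simp add: algebra_simps)

lemma cross_linear:
  "cross (a + b) c = cross a c + cross b c" "cross c (a + b) = cross c a + cross c b"
  "cross (a - b) c = cross a c - cross b c" "cross c (a - b) = cross c a - cross c b"
  "cross (smul k a) c = smul k (cross a c)" "cross c (smul k a) = smul k (cross c a)"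
  by (cases a, cases b, cases c, simp add: algebra_simps)+

lemma cross_zero [simp]: "cross 0 a = 0" "cross a 0 = 0"
  by (cases a, simp add: tri_zero)+

lemma dot_linear:
  "dot (a + b) c = dot a c + dot b c" "dot c (a + b) = dot c a + dot c b"
  "dot (a - b) c = dot a c - dot b c" "dot c (a - b) = dot c a - dot c b"
  "dot (smul k a) c = k * dot a c" "dot c (smul k a) = k * dot c a"
  by (cases a, cases b, cases c, simp add: algebra_simps)+

lemma dot_zero [simp]: "dot 0 a = 0" "dot a 0 = 0"
  by (cases a, simp add: tri_zero)+

lemma smul_simps:
  "smul k (a + b) = smul k a + smul k b" "smul k (a - b) = smul k a - smul k b"
  "smul (k + k') a = smul k a + smul k' a" "smul (k - k') a = smul k a - smul k' a"
  "smul k (smul k' a) = smul (k * k') a" "smul k (- a) = - smul k a" "smul (- k) a = - smul k a"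
  by (cases a, cases b, simp add: algebra_simps)+

lemma smul_special [simp]: "smul 0 a = 0" "smul 1 a = a" "smul k 0 = 0"
  by (cases a, simp add: tri_zero)+

lemma smul_eq_0_iff [simp]: "smul k a = 0 \<longleftrightarrow> k = 0 \<or> a = 0" for k :: "'a::idom"
  by (cases a) (auto simp: tri_zero)

lemma smul_cancel: "k \<noteq> 0 \<Longrightarrow> smul k a = smul k b \<Longrightarrow> a = b" for k :: "'a::idom"
  by (cases a, cases b) auto

lemma smul_cancel_right: "a \<noteq> 0 \<Longrightarrow> smul k a = smul l a \<Longrightarrow> k = l" for k :: "'a::idom"
  by (cases a) (auto simp: tri_zero)

lemma cross_cross_right: "cross a (cross b c) = smul (dot a c) b - smul (dot a b) c"
  by (cases a, cases b, cases c) (simp add: algebra_simps)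

lemma cross_cross_left: "cross (cross a b) c = smul (dot a c) b - smul (dot b c) a"
  by (cases a, cases b, cases c) (simp add: algebra_simps)

lemma cross_cross_common:
  fixes q :: "'a::comm_ring_1 tri"
  shows "cross (cross q x) (cross q y) = smul (dot q (cross x y)) q"
  by (cases q, cases x, cases y) (simp add: algebra_simps)

lemma cross_combinations:
  fixes x :: "'a::comm_ring_1 tri"
  shows "cross (smul a x + smul b y) (smul a' x + smul b' y) = smul (a * b' - b * a') (cross x y)"
  using cross_anti[of y x] by (simp add: cross_linear smul_simps mult.commute)

lemma mv_zero [simp]: "mv A 0 = 0"
  by (cases A rule: prod_cases3) (simp; simp add: tri_zero)

lemma vm_linear:
  "vm (x + y) A = vm x A + vm y A" "vm (x - y) A = vm x A - vm y A" "vm (smul k x) A = smul k (vm x A)"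
  by (cases x, cases y, cases A rule: prod_cases3, simp add: smul_simps algebra_simps)+

lemma vm_vm: "vm (vm x A) B = vm x (mm A B)"
  by (cases x, cases A rule: prod_cases3) (simp add: vm_linear)

lemma mm_assoc: "mm (mm A B) C = mm A (mm B C)"
  by (cases A rule: prod_cases3) (simp add: vm_vm)

lemma cross_vm: "cross (vm x A) (vm y A) = vm (cross x y) (cof A)"
proof (cases A rule: prod_cases3)
  case (fields r0 r1 r2)
  have "cross r1 r0 = - cross r0 r1" "cross r0 r2 = - cross r2 r0" "cross r2 r1 = - cross r1 r2"
    by (rule cross_anti)+
  then show ?thesis using fields
    by (cases x, cases y) (simp add: cross_linear smul_simps algebra_simps)
qed

lemma cof_mm: "cof (mm A B) = mm (cof A) (cof B)"
  by (cases A rule: prod_cases3) (simp add: cross_vm)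

lemma mv_vm_cof: "mv A (vm y (cof A)) = smul (mdet A) y"
proof (cases A rule: prod_cases3)
  case (fields r0 r1 r2)
  have "dot r1 (cross r2 r0) = dot r0 (cross r1 r2)" "dot r2 (cross r0 r1) = dot r0 (cross r1 r2)"
    by (cases r0, cases r1, cases r2, simp add: algebra_simps)+
  then show ?thesis using fields
    by (cases y) (simp add: dot_linear)
qed

lemma vm_mv_cof: "vm (mv A y) (cof A) = smul (mdet A) y"
  by (cases A rule: prod_cases3, rename_tac r0 r1 r2, case_tac r0, case_tac r1, case_tac r2, cases y)
    (simp add: algebra_simps)

lemma dot_vm: "dot (vm x A) y = dot x (mv A y)"
  by (cases x, cases A rule: prod_cases3) (simp add: dot_linear)

lemma mv_mm: "mv (mm A B) x = mv A (mv B x)"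
  by (cases A rule: prod_cases3) (simp add: dot_vm)

lemma vm_cramer: "vm (mv (cof A) x) A = smul (mdet A) x"
  by (cases A rule: prod_cases3, rename_tac r0 r1 r2, case_tac r0, case_tac r1, case_tac r2, cases x)
    (simp add: algebra_simps)

text \<open>Applying \<open>vm_mv_cof\<close> to \<open>A B\<close>, and to \<open>B\<close> and \<open>A\<close> in turn, multiplies a vector by the two
  sides, which avoids expanding a polynomial of degree six in eighteen variables.\<close>

lemma mdet_mm: "mdet (mm A B) = mdet A * mdet B"
proof -
  have "mdet (mm A B) * x = mdet A * mdet B * x" for x
  proof -
    have "smul (mdet (mm A B)) (x, 0, 0) = vm (mv (mm A B) (x, 0, 0)) (cof (mm A B))"
      by (simp only: vm_mv_cof)
    also have "\<dots> = smul (mdet A * mdet B) (x, 0, 0)"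
      by (simp only: cof_mm flip: vm_vm) (simp only: mv_mm vm_mv_cof vm_linear smul_simps mult.commute)
    finally show ?thesis by simp
  qed
  from this[of 1] show ?thesis by simp
qed

lemma tri_nonzero_unit:
  fixes m :: "'a::field tri"
  assumes "m \<noteq> 0"
  obtains A where "dot A m = 1"
proof (cases m)
  case (fields a b c)
  then consider "a \<noteq> 0" | "b \<noteq> 0" | "c \<noteq> 0" using assms by (auto simp: tri_zero)
  then show thesis
    by cases (use fields that[of "(1/a, 0, 0)"] that[of "(0, 1/b, 0)"] that[of "(0, 0, 1/c)"] in auto)
qed

section \<open>Regular pairs, coprimality and retractions\<close>

text \<open>Powers of \<open>u\<close> and \<open>v\<close> form such pairs, and all the coprimality that is used below follows from
  them.  This replaces unique factorization in the polynomial ring.\<close>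

definition regular_pair :: "'a::idom \<Rightarrow> 'a \<Rightarrow> bool" where
  "regular_pair a b \<longleftrightarrow> a \<noteq> 0 \<and> (\<forall>x y. a * x = b * y \<longrightarrow> a dvd y)"

lemma regular_pairD: "regular_pair a b \<Longrightarrow> a * x = b * y \<Longrightarrow> \<exists>e. y = a * e"
  by (simp add: regular_pair_def dvd_def)

lemma regular_pair_common_divisor:
  fixes h :: "'a::idom"
  assumes "regular_pair U V" "h dvd U" "h dvd V"
  shows "\<exists>e. h * e = 1"
proof -
  obtain a b where ab: "U = h * a" "V = h * b" using assms(2,3) by (meson dvdE)
  have "U * b = V * a" by (simp add: ab)
  then obtain e where "a = U * e" using regular_pairD[OF assms(1)] by blast
  then have "U * (h * e) = U * 1" using ab(1) by (simp add: mult.left_commute)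
  moreover have "U \<noteq> 0" using assms(1) by (simp add: regular_pair_def)
  ultimately show ?thesis by (metis mult_cancel_left)
qed

definition primitive :: "'a::idom tri \<Rightarrow> bool" where
  "primitive q \<longleftrightarrow> (\<forall>x. cross x q = 0 \<longrightarrow> (\<exists>e. x = smul e q))"

text \<open>If \<open>x\<close> is parallel to \<open>q\<close>, then \<open>(A \<cdot> q) x = (A \<cdot> x) q\<close>, so both \<open>U x\<close> and \<open>V x\<close> are
  multiples of \<open>q\<close>, and regularity of the pair allows the cancellation of \<open>U\<close>.\<close>

lemma primitiveI:
  assumes "regular_pair U V" "U = dot A q" "V = dot B q"
  shows "primitive q"
  unfolding primitive_def
proof (intro allI impI)
  fix x assume x: "cross x q = 0"
  have U: "smul U x = smul (dot A x) q" and V: "smul V x = smul (dot B x) q"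
    using cross_cross_right[of A x q] cross_cross_right[of B x q] x assms(2,3) by simp_all
  have nz: "U \<noteq> 0" "q \<noteq> 0" using assms(1,2) by (auto simp: regular_pair_def)
  have "smul (U * dot B x) q = smul U (smul V x)" by (simp add: V smul_simps)
  also have "\<dots> = smul V (smul U x)" by (simp add: smul_simps mult.commute)
  also have "\<dots> = smul (V * dot A x) q" by (simp add: U smul_simps)
  finally have "U * dot B x = V * dot A x" using nz(2) by (rule smul_cancel_right[rotated])
  then obtain e where "dot A x = U * e" using regular_pairD[OF assms(1)] by blast
  then have "smul U x = smul U (smul e q)" using U by (simp add: smul_simps)
  then have "x = smul e q" using nz(1) by (rule smul_cancel[rotated])
  then show "\<exists>e. x = smul e q" ..
qed

lemma cross_factors_injective:
  fixes N1 N2 :: "'a::idom tri"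
  assumes "cross N1 N2 \<noteq> 0" "smul z0 N1 + smul z1 N2 = smul w0 N1 + smul w1 N2"
  shows "z0 = w0" "z1 = w1"
proof -
  have "cross (smul z0 N1 + smul z1 N2) N2 = cross (smul w0 N1 + smul w1 N2) N2"
    and "cross N1 (smul z0 N1 + smul z1 N2) = cross N1 (smul w0 N1 + smul w1 N2)"
    using assms(2) by simp_all
  then have "smul z0 (cross N1 N2) = smul w0 (cross N1 N2)" "smul z1 (cross N1 N2) = smul w1 (cross N1 N2)"
    by (simp_all add: cross_linear)
  then show "z0 = w0" "z1 = w1" using assms(1) smul_cancel_right by blast+
qed

text \<open>For \<open>y\<close> orthogonal to \<open>q\<close> the identity \<open>(A \<times> y) \<times> q = (A \<cdot> q) y\<close> and the expansion of
  \<open>w \<times> (N\<^sub>1 \<times> N\<^sub>2)\<close> show that \<open>U y\<close> and \<open>V y\<close> are combinations of \<open>N\<^sub>1\<close> and \<open>N\<^sub>2\<close>.  The coefficients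
  are unique, so regularity of the pair again allows the cancellation of \<open>U\<close>.\<close>

lemma hilbert_burch_exact:
  assumes "regular_pair U V" "U = dot A q" "V = dot B q" "q = cross N1 N2" "dot q y = 0"
  shows "\<exists>z0 z1. y = smul z0 N1 + smul z1 N2"
proof -
  have *: "smul (dot A q) y = smul (dot (cross A y) N2) N1 + smul (- dot (cross A y) N1) N2" for A
  proof -
    have "smul (dot A q) y = cross (cross A y) q"
      using assms(5) by (simp add: cross_cross_left dot_commute[of y])
    then show ?thesis by (simp add: assms(4) cross_cross_right smul_simps)
  qed
  obtain z0 z1 where U: "smul U y = smul z0 N1 + smul z1 N2" using *[of A] assms(2) by blast
  obtain w0 w1 where V: "smul V y = smul w0 N1 + smul w1 N2" using *[of B] assms(3) by blast
  have nz: "U \<noteq> 0" "cross N1 N2 \<noteq> 0" using assms(1,2,4) by (auto simp: regular_pair_def)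
  have "smul V (smul U y) = smul U (smul V y)" by (simp add: smul_simps mult.commute)
  then have "smul (U * w0) N1 + smul (U * w1) N2 = smul (V * z0) N1 + smul (V * z1) N2"
    unfolding U V by (simp add: smul_simps)
  then have "U * w0 = V * z0" "U * w1 = V * z1"
    using cross_factors_injective[OF nz(2)] by blast+
  then obtain e0 e1 where "z0 = U * e0" "z1 = U * e1"
    using regular_pairD[OF assms(1)] by metis
  then have "smul U y = smul U (smul e0 N1 + smul e1 N2)" by (simp add: U smul_simps)
  then show ?thesis using smul_cancel[OF nz(1)] by blast
qed

definition coprime_pair :: "'a::idom \<Rightarrow> 'a \<Rightarrow> bool" where
  "coprime_pair g h \<longleftrightarrow> (\<forall>x y. x * g = y * h \<longrightarrow> (\<exists>\<alpha>. x = \<alpha> * h \<and> y = \<alpha> * g))"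

lemma coprime_pairI:
  assumes "regular_pair U V" "U = a * g + b * h" "V = c * g + d * h" "h \<noteq> 0"
  shows "coprime_pair g h"
  unfolding coprime_pair_def
proof (intro allI impI)
  fix x y assume xy: "x * g = y * h"
  have U: "U * x = h * (a * y + b * x)"
  proof -
    have "U * x = a * (x * g) + b * h * x" by (simp add: assms(2) algebra_simps)
    then show ?thesis unfolding xy by (simp add: algebra_simps)
  qed
  have V: "V * x = h * (c * y + d * x)"
  proof -
    have "V * x = c * (x * g) + d * h * x" by (simp add: assms(3) algebra_simps)
    then show ?thesis unfolding xy by (simp add: algebra_simps)
  qed
  have "h * (U * (c * y + d * x)) = U * (V * x)" by (simp add: V algebra_simps)
  also have "\<dots> = V * (U * x)" by (simp add: algebra_simps)
  also have "\<dots> = h * (V * (a * y + b * x))" by (simp add: U algebra_simps)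
  finally have "U * (c * y + d * x) = V * (a * y + b * x)" using assms(4) by simp
  then obtain e where e: "a * y + b * x = U * e"
    using regular_pairD[OF assms(1)] by blast
  have "U * x = U * (e * h)" using U e by (simp add: algebra_simps)
  then have x: "x = e * h" using assms(1) by (simp add: regular_pair_def)
  then have "y = e * g" using xy assms(4) by (simp add: algebra_simps)
  with x show "\<exists>\<alpha>. x = \<alpha> * h \<and> y = \<alpha> * g" by blast
qed

lemma coprime_pair_sym: "coprime_pair g h \<Longrightarrow> coprime_pair h g"
  unfolding coprime_pair_def by metis

text \<open>A retraction is a ring endomorphism with the ideal of \<open>l\<close> as its kernel and the identity modulo that
  ideal: a model of the quotient ring inside the ring itself.\<close>

definition retracts :: "'a::idom \<Rightarrow> ('a \<Rightarrow> 'a) \<Rightarrow> bool" where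
  "retracts l \<psi> \<longleftrightarrow> ring_map \<psi> \<and> \<psi> l = 0 \<and> (\<forall>x. l dvd x - \<psi> x)"

lemma retracts_dvd_iff: "retracts l \<psi> \<Longrightarrow> l dvd x \<longleftrightarrow> \<psi> x = 0"
proof
  assume r: "retracts l \<psi>"
  then have h: "ring_map \<psi>" by (simp add: retracts_def)
  show "\<psi> x = 0" if "l dvd x"
    using that r by (auto simp: retracts_def ring_map_simps[OF h])
  show "l dvd x" if "\<psi> x = 0"
    using r that unfolding retracts_def by (metis diff_zero)
qed

lemma retracts_prime:
  assumes "retracts l \<psi>" "l dvd x * y" "\<not> l dvd x"
  shows "l dvd y"
proof -
  have h: "ring_map \<psi>" using assms(1) by (simp add: retracts_def)
  show ?thesis using assms by (simp add: retracts_dvd_iff ring_map_simps[OF h])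
qed

lemma retracts_coprime_pair:
  assumes "retracts l \<psi>" "coprime_pair g h" "\<psi> g = g" "\<psi> h = h" "l dvd x * g - y * h"
  shows "\<exists>\<alpha>. l dvd x - \<alpha> * h \<and> l dvd y - \<alpha> * g"
proof -
  have h: "ring_map \<psi>" using assms(1) by (simp add: retracts_def)
  have "\<psi> x * g = \<psi> y * h"
    using assms by (simp add: retracts_dvd_iff ring_map_simps[OF h])
  then obtain \<alpha> where "\<psi> x = \<alpha> * h" "\<psi> y = \<alpha> * g"
    using assms(2) unfolding coprime_pair_def by blast
  then show ?thesis using assms(1) unfolding retracts_def by metis
qed

lemma regular_pair_power:
  assumes "retracts u \<psi>" "\<not> u dvd v" "u \<noteq> 0"
  shows "regular_pair (u ^ k) (v ^ m)"
proof -
  have h: "ring_map \<psi>" using assms(1) by (simp add: retracts_def)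
  have "\<psi> v \<noteq> 0" using assms by (simp add: retracts_dvd_iff)
  then have nv: "\<not> u dvd v ^ m" using assms(1) by (simp add: retracts_dvd_iff ring_map_simps[OF h])
  have "u ^ k dvd y" if "u ^ k dvd v ^ m * y" for y
    using that
  proof (induction k arbitrary: y)
    case (Suc k)
    have "u dvd v ^ m * y" using Suc(2) by (metis dvd_mult_left power_Suc)
    then obtain z where z: "y = u * z" using retracts_prime[OF assms(1) _ nv] by blast
    have "u * u ^ k dvd u * (v ^ m * z)" using Suc(2) by (simp add: z mult.left_commute[of _ u])
    then have "u ^ k dvd v ^ m * z" using assms(3) by (simp only: dvd_mult_cancel_left) simp
    then have "u ^ k dvd z" by (rule Suc(1))
    then show ?case using z by (simp add: mult_dvd_mono)
  qed simp
  then have "u ^ k dvd y" if "u ^ k * x = v ^ m * y" for x y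
    using that by (metis dvd_triv_left)
  then show ?thesis using assms(3) by (auto simp: regular_pair_def)
qed

section \<open>Syzygies of three split generators\<close>

text \<open>Three generators \<open>l\<^sub>i g\<^sub>i\<close> with \<open>l\<^sub>0 + l\<^sub>1 + l\<^sub>2 = 0\<close>.  The maps \<open>\<psi>\<^sub>i\<close> reduce modulo \<open>l\<^sub>i\<close> and \<open>\<chi>\<close>
  reduces modulo the ideal of all three forms; the \<open>g\<^sub>i\<close> are unchanged by these reductions because
  they do not involve \<open>s\<close> and \<open>t\<close>.\<close>

locale pencil =
  fixes l0 l1 l2 g0 g1 g2 :: "'a::idom" and \<psi>0 \<psi>1 \<psi>2 \<chi> :: "'a \<Rightarrow> 'a"
  assumes lsum: "l2 = - l0 - l1"
    and retr: "retracts l0 \<psi>0" "retracts l1 \<psi>1" "retracts l2 \<psi>2"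
    and fixes0: "\<psi>0 g1 = g1" "\<psi>0 g2 = g2"
    and fixes1: "\<psi>1 g2 = g2" "\<psi>1 g0 = g0"
    and fixes2: "\<psi>2 g0 = g0" "\<psi>2 g1 = g1"
    and fixes\<chi>: "\<chi> g0 = g0" "\<chi> g1 = g1" "\<chi> g2 = g2"
    and \<chi>_hom: "ring_map \<chi>"
    and \<chi>_l: "\<chi> l0 = 0" "\<chi> l1 = 0"
    and \<chi>_diff: "\<And>x. \<exists>A B. x - \<chi> x = A * l0 + B * l1"
    and ndvd: "\<not> l0 dvd l1" "\<not> l1 dvd l0" "\<not> l2 dvd l0"
    and l_nz: "l0 \<noteq> 0" "l1 \<noteq> 0" "l2 \<noteq> 0"
    and cop: "coprime_pair g1 g2" "coprime_pair g2 g0" "coprime_pair g0 g1"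
    and g_nz: "g0 \<noteq> 0" "g1 \<noteq> 0" "g2 \<noteq> 0"
begin

lemmas \<chi>_simps = ring_map_simps[OF \<chi>_hom] fixes\<chi> \<chi>_l

lemma \<chi>_l2: "\<chi> l2 = 0"
  by (simp add: lsum \<chi>_simps)

lemma ndvd': "\<not> l0 dvd l2" "\<not> l1 dvd l2" "\<not> l2 dvd l1"
proof -
  show "\<not> l0 dvd l2"
  proof
    assume "l0 dvd l2"
    then have "l0 dvd - l2 - l0" by simp
    then show False using ndvd(1) by (simp add: lsum)
  qed
  show "\<not> l1 dvd l2"
  proof
    assume "l1 dvd l2"
    then have "l1 dvd - l2 - l1" by simp
    then show False using ndvd(2) by (simp add: lsum)
  qed
  show "\<not> l2 dvd l1"
  proof
    assume "l2 dvd l1"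
    then have "l2 dvd - l2 - l1" by simp
    then show False using ndvd(3) by (simp add: lsum)
  qed
qed

lemma ndvd_g: "\<not> l0 dvd g1" "\<not> l0 dvd g2" "\<not> l1 dvd g2" "\<not> l1 dvd g0" "\<not> l2 dvd g0" "\<not> l2 dvd g1"
  using retr fixes0 fixes1 fixes2 g_nz by (simp_all add: retracts_dvd_iff)

lemma dvd_product2:
  assumes "l dvd x" "m dvd x" "retracts l \<psi>" "\<not> l dvd m"
  shows "\<exists>n. x = m * l * n"
proof -
  obtain y where y: "x = m * y" using assms(2) by blast
  then have "l dvd y" using retracts_prime[OF assms(3)] assms(1,4) by blast
  then obtain n where "y = l * n" by blast
  then show ?thesis using y by (auto simp: mult.assoc)
qed

text \<open>Modulo \<open>l\<^sub>0\<close> the relation becomes \<open>g\<^sub>1 x\<^sub>1 = g\<^sub>2 x\<^sub>2\<close>, so \<open>(x\<^sub>1, x\<^sub>2)\<close> is congruent to a multiple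
  \<open>\<alpha> (g\<^sub>2, g\<^sub>1)\<close>, and likewise with multipliers \<open>\<beta>\<close> and \<open>\<gamma>\<close> modulo \<open>l\<^sub>1\<close> and \<open>l\<^sub>2\<close>.  Modulo all the
  \<open>l\<^sub>i\<close> the three multipliers have the form \<open>\<delta> g\<^sub>i\<close>, which is removed by a multiple of
  \<open>(g\<^sub>1 g\<^sub>2, g\<^sub>0 g\<^sub>2, g\<^sub>0 g\<^sub>1)\<close>.  What is left of the multipliers is removed by Koszul syzygies; the
  remainder has its \<open>i\<close>-th entry divisible by the two forms \<open>l\<^sub>j\<close> with \<open>j \<noteq> i\<close>.\<close>

lemma diagonal_syzygies:
  assumes "l0 * g0 * x0 + l1 * g1 * x1 + l2 * g2 * x2 = 0"
  shows "\<exists>\<delta> y n. (x0, x1, x2) = smul \<delta> (g1 * g2, g0 * g2, g0 * g1)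
      + cross (l0 * g0, l1 * g1, l2 * g2) y + vm n (cof (diag (l0, l1, l2)))
    \<and> dot (g0, g1, g2) n = 0"
proof -
  have "l0 dvd l1 * (x1 * g1 - x2 * g2)"
  proof
    have "l1 * (x1 * g1 - x2 * g2) = (l0 * g0 * x0 + l1 * g1 * x1 + l2 * g2 * x2) + l0 * (x2 * g2 - g0 * x0)"
      by (simp add: lsum algebra_simps)
    then show "l1 * (x1 * g1 - x2 * g2) = l0 * (x2 * g2 - g0 * x0)" using assms by simp
  qed
  then have "l0 dvd x1 * g1 - x2 * g2" using retracts_prime[OF retr(1)] ndvd by blast
  then obtain \<alpha> where \<alpha>: "l0 dvd x1 - \<alpha> * g2" "l0 dvd x2 - \<alpha> * g1"
    using retracts_coprime_pair[OF retr(1) cop(1) fixes0] by blast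
  have "l1 dvd l0 * (x2 * g2 - x0 * g0)"
  proof
    have "l0 * (x2 * g2 - x0 * g0) = - (l0 * g0 * x0 + l1 * g1 * x1 + l2 * g2 * x2) + l1 * (g1 * x1 - x2 * g2)"
      by (simp add: lsum algebra_simps)
    then show "l0 * (x2 * g2 - x0 * g0) = l1 * (g1 * x1 - x2 * g2)" using assms by simp
  qed
  then have "l1 dvd x2 * g2 - x0 * g0" using retracts_prime[OF retr(2)] ndvd by blast
  then obtain \<beta> where \<beta>: "l1 dvd x2 - \<beta> * g0" "l1 dvd x0 - \<beta> * g2"
    using retracts_coprime_pair[OF retr(2) cop(2) fixes1] by blast
  have "l2 dvd l0 * (x0 * g0 - x1 * g1)"
  proof
    have "l0 * (x0 * g0 - x1 * g1) = (l0 * g0 * x0 + l1 * g1 * x1 + l2 * g2 * x2) + l2 * (g1 * x1 - x2 * g2)"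
      by (simp add: lsum algebra_simps)
    then show "l0 * (x0 * g0 - x1 * g1) = l2 * (g1 * x1 - x2 * g2)" using assms by simp
  qed
  then have "l2 dvd x0 * g0 - x1 * g1" using retracts_prime[OF retr(3)] ndvd by blast
  then obtain \<gamma> where \<gamma>: "l2 dvd x0 - \<gamma> * g1" "l2 dvd x1 - \<gamma> * g0"
    using retracts_coprime_pair[OF retr(3) cop(3) fixes2] by blast
  obtain k1 k2 where k: "x1 - \<alpha> * g2 = l0 * k1" "x2 - \<alpha> * g1 = l0 * k2" using \<alpha> by (meson dvdE)
  obtain m2 m0 where m: "x2 - \<beta> * g0 = l1 * m2" "x0 - \<beta> * g2 = l1 * m0" using \<beta> by (meson dvdE)
  obtain j0 j1 where j: "x0 - \<gamma> * g1 = l2 * j0" "x1 - \<gamma> * g0 = l2 * j1" using \<gamma> by (meson dvdE)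
  \<comment> \<open>Two of the multipliers describe the same \<open>x\<^sub>i\<close>, so they are related modulo all the \<open>l\<^sub>j\<close>.\<close>
  have c2: "\<chi> \<alpha> * g1 = \<chi> x2" using arg_cong[OF k(2), of \<chi>] by (simp add: \<chi>_simps)
  have c2': "\<chi> \<beta> * g0 = \<chi> x2" using arg_cong[OF m(1), of \<chi>] by (simp add: \<chi>_simps)
  have c0: "\<chi> \<beta> * g2 = \<chi> x0" using arg_cong[OF m(2), of \<chi>] by (simp add: \<chi>_simps)
  have c0': "\<chi> \<gamma> * g1 = \<chi> x0" using arg_cong[OF j(1), of \<chi>] by (simp add: \<chi>_simps \<chi>_l2)
  obtain \<delta> where \<delta>: "\<chi> \<alpha> = \<delta> * g0" "\<chi> \<beta> = \<delta> * g1"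
    using c2 c2' cop(3) coprime_pair_sym unfolding coprime_pair_def by metis
  have \<delta>': "\<chi> \<gamma> = \<delta> * g2"
  proof -
    have "\<chi> \<gamma> * g1 = \<delta> * g2 * g1" using c0 c0' \<delta> by (simp add: algebra_simps)
    then show ?thesis using g_nz by simp
  qed
  obtain A B where AB: "\<alpha> = \<delta> * g0 + A * l0 + B * l1"
    using \<chi>_diff[of \<alpha>] \<delta> by (metis add.assoc add.commute diff_add_cancel)
  obtain A' B' where AB': "\<beta> = \<delta> * g1 + A' * l0 + B' * l1"
    using \<chi>_diff[of \<beta>] \<delta> by (metis add.assoc add.commute diff_add_cancel)
  obtain A'' B'' where AB'': "\<gamma> = \<delta> * g2 + A'' * l0 + B'' * l1"
    using \<chi>_diff[of \<gamma>] \<delta>' by (metis add.assoc add.commute diff_add_cancel)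
  \<comment> \<open>Koszul coefficients that clear \<open>B l\<^sub>1\<close> modulo \<open>l\<^sub>0\<close>, \<open>A' l\<^sub>0\<close> modulo \<open>l\<^sub>1\<close> and \<open>C l\<^sub>0\<close> modulo \<open>l\<^sub>2\<close>.\<close>
  define C where "C = A'' - B''"
  define r0 where "r0 = x0 - \<delta> * g1 * g2 - A' * (- l2 * g2) + C * (l1 * g1)"
  define r1 where "r1 = x1 - \<delta> * g0 * g2 + B * (l2 * g2) + C * (- l0 * g0)"
  define r2 where "r2 = x2 - \<delta> * g0 * g1 + B * (- l1 * g1) - A' * (l0 * g0)"
  have x: "x0 = \<beta> * g2 + l1 * m0" "x0 = \<gamma> * g1 + l2 * j0"
    "x1 = \<alpha> * g2 + l0 * k1" "x1 = \<gamma> * g0 + l2 * j1"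
    "x2 = \<alpha> * g1 + l0 * k2" "x2 = \<beta> * g0 + l1 * m2"
    using k m j by (auto simp: algebra_simps)
  have "r0 = l1 * (m0 + B' * g2 - A' * g2 + C * g1)"
    unfolding r0_def x(1) AB' lsum by (simp add: algebra_simps)
  then have r01: "l1 dvd r0" by simp
  have "r0 = l2 * (j0 + A' * g2 - A'' * g1)"
    unfolding r0_def x(2) AB'' lsum C_def by (simp add: algebra_simps)
  then have r02: "l2 dvd r0" by simp
  have "r1 = l0 * (k1 + A * g2 - B * g2 - C * g0)"
    unfolding r1_def x(3) AB lsum by (simp add: algebra_simps)
  then have r10: "l0 dvd r1" by simp
  have "r1 = l2 * (j1 + B * g2 - B'' * g0)"
    unfolding r1_def x(4) AB'' lsum C_def by (simp add: algebra_simps)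
  then have r12: "l2 dvd r1" by simp
  have "r2 = l0 * (k2 + A * g1 - A' * g0)"
    unfolding r2_def x(5) AB by (simp add: algebra_simps)
  then have r20: "l0 dvd r2" by simp
  have "r2 = l1 * (m2 + B' * g0 - B * g1)"
    unfolding r2_def x(6) AB' by (simp add: algebra_simps)
  then have r21: "l1 dvd r2" by simp
  obtain n0 where n0: "r0 = l1 * l2 * n0" using dvd_product2[OF r02 r01 retr(3)] ndvd' by blast
  obtain n1 where n1: "r1 = l2 * l0 * n1" using dvd_product2[OF r10 r12 retr(1)] ndvd' by blast
  obtain n2 where n2: "r2 = l0 * l1 * n2" using dvd_product2[OF r21 r20 retr(2)] ndvd by blast
  have "l0 * g0 * r0 + l1 * g1 * r1 + l2 * g2 * r2
     = (l0 * g0 * x0 + l1 * g1 * x1 + l2 * g2 * x2)"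
    unfolding r0_def r1_def r2_def lsum by (simp add: algebra_simps)
  then have "l0 * l1 * l2 * (g0 * n0 + g1 * n1 + g2 * n2) = 0"
    unfolding assms n0 n1 n2 by (simp add: algebra_simps)
  then have "dot (g0, g1, g2) (n0, n1, n2) = 0" using l_nz by simp
  moreover have "(x0, x1, x2) = smul \<delta> (g1 * g2, g0 * g2, g0 * g1)
      + cross (l0 * g0, l1 * g1, l2 * g2) (- B, A', - C) + vm (n0, n1, n2) (cof (diag (l0, l1, l2)))"
  proof -
    have "vm (n0, n1, n2) (cof (diag (l0, l1, l2))) = (r0, r1, r2)"
      by (simp add: n0 n1 n2 algebra_simps)
    then show ?thesis by (simp add: r0_def r1_def r2_def algebra_simps)
  qed
  ultimately show ?thesis by blast
qed

text \<open>Reading each entry modulo one \<open>l\<^sub>i\<close> at a time shows that \<open>l\<^sub>i\<close> divides the \<open>i\<close>-th entry of \<open>y\<close>.\<close>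

lemma diagonal_second_syzygies:
  assumes "cross (l0 * g0, l1 * g1, l2 * g2) y + vm n (cof (diag (l0, l1, l2))) = 0"
  shows "\<exists>k. y = vm k (diag (l0, l1, l2))"
proof (cases y, cases n)
  fix y0 y1 y2 n0 n1 n2 assume yn: "y = (y0, y1, y2)" "n = (n0, n1, n2)"
  have e: "l1 * g1 * y2 - l2 * g2 * y1 + n0 * (l1 * l2) = 0"
    "l2 * g2 * y0 - l0 * g0 * y2 + n1 * (l2 * l0) = 0"
    using assms by (simp_all add: yn tri_zero)
  have "l1 dvd (l2 * g2) * y1"
  proof
    show "l2 * g2 * y1 = l1 * (g1 * y2 + n0 * l2)" using e(1) by (simp add: algebra_simps)
  qed
  then have 1: "l1 dvd y1" using retracts_prime[OF retr(2)] ndvd' ndvd_g by blast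
  have "l2 dvd (l1 * g1) * y2"
  proof
    show "l1 * g1 * y2 = l2 * (g2 * y1 - n0 * l1)" using e(1) by (simp add: algebra_simps)
  qed
  then have 2: "l2 dvd y2" using retracts_prime[OF retr(3)] ndvd' ndvd_g by blast
  have "l0 dvd (l2 * g2) * y0"
  proof
    show "l2 * g2 * y0 = l0 * (g0 * y2 - n1 * l2)" using e(2) by (simp add: algebra_simps)
  qed
  then have 0: "l0 dvd y0" using retracts_prime[OF retr(1)] ndvd' ndvd_g by blast
  obtain k0 k1 k2 where "y0 = k0 * l0" "y1 = k1 * l1" "y2 = k2 * l2"
    using 0 1 2 by (metis dvdE mult.commute)
  then have "y = vm (k0, k1, k2) (diag (l0, l1, l2))" by (simp add: yn)
  then show ?thesis ..
qed

end

text \<open>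
  The same situation after changes of basis \<open>P\<close> and \<open>Q\<close> with unit determinants: the generators are \<open>q P L Q\<close> with
  \<open>L = diag(l\<^sub>0, l\<^sub>1, l\<^sub>2)\<close>.  The pair \<open>U, V\<close> is there for the powers of \<open>u\<close> and \<open>v\<close> that lie in the ideal
  of \<open>q\<close>, and \<open>c\<close> is there for \<open>a \<times> b\<close>, whose diagonal form is a unit multiple of
  \<open>(g\<^sub>1 g\<^sub>2, g\<^sub>0 g\<^sub>2, g\<^sub>0 g\<^sub>1)\<close>.
\<close>

locale split_pencil = pencil l0 l1 l2 g0 g1 g2 \<psi>0 \<psi>1 \<psi>2 \<chi>
  for l0 l1 l2 g0 g1 g2 :: "'a::idom" and \<psi>0 \<psi>1 \<psi>2 \<chi> :: "'a \<Rightarrow> 'a" +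
  fixes P Q :: "'a tri tri" and q N1 N2 A B c a b :: "'a tri" and U V dP dQ \<kappa> \<kappa>' s t e0 e1 e2 e3 :: 'a
  assumes reg: "regular_pair U V" "U = dot A q" "V = dot B q"
    and q: "q = cross N1 N2"
    and gP: "(g0, g1, g2) = vm q P"
    and dP: "dP * mdet P = 1" and dQ: "dQ * mdet Q = 1"
    and c: "c = vm (smul \<kappa> (g1 * g2, g0 * g2, g0 * g1)) (cof Q)"
    and \<kappa>: "\<kappa>' * \<kappa> = 1"
    and fa: "cross (vm q (mm P (mm (diag (l0, l1, l2)) Q))) a = - smul t c"
    and fb: "cross (vm q (mm P (mm (diag (l0, l1, l2)) Q))) b = smul s c"
    and ls: "l0 = e0 * s + e1 * t" "l1 = e2 * s + e3 * t"
begin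

declare diag.simps [simp del] mm.simps [simp del] cof.simps [simp del]

abbreviation "L \<equiv> diag (l0, l1, l2)"
abbreviation "M \<equiv> mm P (mm L Q)"
abbreviation "f \<equiv> vm q M"

lemma det_nz: "mdet Q \<noteq> 0" "mdet M \<noteq> 0"
proof -
  have "mdet L = l0 * l1 * l2" by (simp add: diag.simps)
  moreover have "mdet P \<noteq> 0" "mdet Q \<noteq> 0" using dP dQ by auto
  ultimately show "mdet Q \<noteq> 0" "mdet M \<noteq> 0" using l_nz by (simp_all add: mdet_mm)
qed

lemma f_eq: "f = vm (l0 * g0, l1 * g1, l2 * g2) Q"
proof -
  have "f = vm (vm (g0, g1, g2) L) Q" by (simp add: gP vm_vm mm_assoc)
  then show ?thesis by (simp add: diag.simps mult.commute)
qed

lemma vm_Q_surj: "\<exists>y. x = vm y Q"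
proof
  show "x = vm (smul dQ (mv (cof Q) x)) Q" by (simp add: vm_linear vm_cramer smul_simps dQ)
qed

lemma vm_P_surj: "\<exists>y. x = vm y P"
proof
  show "x = vm (smul dP (mv (cof P) x)) P" by (simp add: vm_linear vm_cramer smul_simps dP)
qed

lemma cof_Q_inj: "vm y (cof Q) = 0 \<Longrightarrow> y = 0"
  using mv_vm_cof[of Q y] det_nz by simp

lemma cof_M: "vm y (cof M) = vm (vm (vm y (cof P)) (cof L)) (cof Q)"
  by (simp add: cof_mm vm_vm mm_assoc)

lemma cof_M_inj: "vm y (cof M) = 0 \<Longrightarrow> y = 0"
  using mv_vm_cof[of M y] det_nz by simp

text \<open>The vector \<open>Q x\<close> is a syzygy in the diagonal situation.  Its three constituents from
  \<open>diagonal_syzygies\<close> correspond to the three kinds of syzygies here: in the last one \<open>P n\<close> is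
  orthogonal to \<open>q\<close>, hence a combination of \<open>N\<^sub>1\<close> and \<open>N\<^sub>2\<close>.\<close>

theorem exact_at_generators:
  assumes "dot f x = 0"
  shows "\<exists>\<xi> y z0 z1. x = smul \<xi> c + cross f y + smul z0 (vm N1 (cof M)) + smul z1 (vm N2 (cof M))"
proof -
  obtain x0 x1 x2 where mx: "mv Q x = (x0, x1, x2)" by (cases "mv Q x")
  have "dot (l0 * g0, l1 * g1, l2 * g2) (mv Q x) = 0"
    using assms unfolding f_eq dot_vm .
  then obtain \<delta> y n where
    *: "mv Q x = smul \<delta> (g1 * g2, g0 * g2, g0 * g1) + cross (l0 * g0, l1 * g1, l2 * g2) y + vm n (cof L)"
    and n: "dot (g0, g1, g2) n = 0"
    using diagonal_syzygies[of x0 x1 x2] unfolding mx by auto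
  have "dot q (mv P n) = 0" using n unfolding gP dot_vm .
  then obtain z0 z1 where z: "mv P n = smul z0 N1 + smul z1 N2"
    using hilbert_burch_exact[OF reg q] by blast
  have n': "n = vm (smul dP (mv P n)) (cof P)"
    by (simp add: vm_linear vm_mv_cof smul_simps dP)
  have A: "vm (vm n (cof L)) (cof Q) = smul (dP * z0) (vm N1 (cof M)) + smul (dP * z1) (vm N2 (cof M))"
    by (subst n', simp only: cof_M[symmetric] z vm_linear smul_simps)
  have C: "vm (smul \<delta> (g1 * g2, g0 * g2, g0 * g1)) (cof Q) = smul (\<delta> * \<kappa>') c"
    unfolding c by (simp only: vm_linear smul_simps mult.assoc \<kappa> mult_1_right)
  have F: "vm (cross (l0 * g0, l1 * g1, l2 * g2) y) (cof Q) = cross f (vm y Q)"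
    by (simp only: f_eq cross_vm)
  have "smul (mdet Q) x = vm (mv Q x) (cof Q)" by (simp add: vm_mv_cof)
  also have "\<dots> = smul (\<delta> * \<kappa>') c + cross f (vm y Q)
     + (smul (dP * z0) (vm N1 (cof M)) + smul (dP * z1) (vm N2 (cof M)))"
    unfolding * by (simp only: vm_linear(1) A C F)
  finally have "smul dQ (smul (mdet Q) x) = smul dQ (smul (\<delta> * \<kappa>') c + cross f (vm y Q)
     + (smul (dP * z0) (vm N1 (cof M)) + smul (dP * z1) (vm N2 (cof M))))" by simp
  then have "x = smul (dQ * (\<delta> * \<kappa>')) c + cross f (smul dQ (vm y Q))
     + smul (dQ * (dP * z0)) (vm N1 (cof M)) + smul (dQ * (dP * z1)) (vm N2 (cof M))"
    by (simp only: smul_simps dQ smul_special cross_linear add.assoc)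
  then show ?thesis by blast
qed

text \<open>Reduction modulo \<open>s\<close> and \<open>t\<close> leaves only the multiple of \<open>c\<close>, so \<open>\<xi>\<close> lies in the ideal of \<open>s\<close> and \<open>t\<close>
  and can be cleared with \<open>f \<times> a = - t c\<close> and \<open>f \<times> b = s c\<close>.  By \<open>diagonal_second_syzygies\<close> the
  remaining \<open>y\<close> is \<open>\<gamma> M\<close>.  Then \<open>f \<times> (\<gamma> M)\<close> is the adjugate of \<open>M\<close> applied to \<open>q \<times> \<gamma>\<close>, and injectivity
  of the adjugate and of \<open>(N\<^sub>1, N\<^sub>2)\<close> determines \<open>z\<^sub>0\<close> and \<open>z\<^sub>1\<close>.\<close>

theorem exact_at_syzygies:
  assumes "smul \<xi> c + cross f y + smul z0 (vm N1 (cof M)) + smul z1 (vm N2 (cof M)) = 0"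
  shows "\<exists>\<alpha> \<beta> \<gamma>. \<xi> = s * \<alpha> + t * \<beta> \<and> y = smul \<beta> a - smul \<alpha> b + vm \<gamma> M
    \<and> z0 = dot N2 \<gamma> \<and> z1 = - dot N1 \<gamma>"
proof -
  let ?n = "vm (smul z0 N1 + smul z1 N2) (cof P)"
  let ?F = "(l0 * g0, l1 * g1, l2 * g2)"
  have n: "smul z0 (vm N1 (cof M)) + smul z1 (vm N2 (cof M)) = vm (vm ?n (cof L)) (cof Q)"
    by (simp only: cof_M vm_linear)
  obtain y' where y': "y = vm y' Q" using vm_Q_surj by blast
  have "vm (smul (\<xi> * \<kappa>) (g1 * g2, g0 * g2, g0 * g1) + cross ?F y' + vm ?n (cof L)) (cof Q) = 0"
    using assms unfolding add.assoc n unfolding y' f_eq cross_vm c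
    by (simp only: vm_linear smul_simps add.assoc)
  then have *: "smul (\<xi> * \<kappa>) (g1 * g2, g0 * g2, g0 * g1) + cross ?F y' + vm ?n (cof L) = 0"
    by (rule cof_Q_inj)
  obtain y0 y1 y2 n0 n1 n2 where yn: "y' = (y0, y1, y2)" "?n = (n0, n1, n2)"
    by (cases y', cases ?n)
  have "\<xi> * \<kappa> * (g1 * g2) + (l1 * g1 * y2 - l2 * g2 * y1) + n0 * (l1 * l2) = 0"
    using * unfolding yn by (simp add: tri_zero cof.simps diag.simps)
  then have "\<chi> (\<xi> * \<kappa> * (g1 * g2) + (l1 * g1 * y2 - l2 * g2 * y1) + n0 * (l1 * l2)) = 0"
    by (simp add: \<chi>_simps)
  then have "\<chi> \<xi> * \<chi> \<kappa> = 0" using g_nz by (simp add: \<chi>_simps \<chi>_l2)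
  moreover have "\<chi> \<kappa>' * \<chi> \<kappa> = 1" using arg_cong[OF \<kappa>, of \<chi>] by (simp add: \<chi>_simps)
  ultimately have "\<chi> \<xi> = 0" by auto
  then obtain A' B' where "\<xi> = A' * l0 + B' * l1" using \<chi>_diff[of \<xi>] by auto
  then have \<xi>: "\<xi> = s * (A' * e0 + B' * e2) + t * (A' * e1 + B' * e3)"
    by (simp add: ls algebra_simps)
  define \<alpha> where "\<alpha> = A' * e0 + B' * e2"
  define \<beta> where "\<beta> = A' * e1 + B' * e3"
  define w where "w = y + smul \<alpha> b - smul \<beta> a"
  have fw: "cross f w = smul \<xi> c + cross f y"
    unfolding w_def cross_linear fa fb \<xi> \<alpha>_def[symmetric] \<beta>_def[symmetric]
    by (simp only: smul_simps mult.commute) simp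
  have w0: "cross f w + smul z0 (vm N1 (cof M)) + smul z1 (vm N2 (cof M)) = 0"
    unfolding fw using assms .
  obtain w' where w': "w = vm w' Q" using vm_Q_surj by blast
  have "vm (cross ?F w' + vm ?n (cof L)) (cof Q) = 0"
    using w0 unfolding add.assoc n unfolding w' f_eq cross_vm by (simp only: vm_linear)
  then have "cross ?F w' + vm ?n (cof L) = 0" by (rule cof_Q_inj)
  then obtain k where k: "w' = vm k L" using diagonal_second_syzygies by blast
  obtain \<gamma> where \<gamma>: "k = vm \<gamma> P" using vm_P_surj by blast
  have w\<gamma>: "w = vm \<gamma> M" unfolding w' k \<gamma> vm_vm mm_assoc ..
  have fw': "cross f w = vm (smul (dot N1 \<gamma>) N2 - smul (dot N2 \<gamma>) N1) (cof M)"
    unfolding w\<gamma> cross_vm unfolding q cross_cross_left ..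
  have "vm (smul (z0 - dot N2 \<gamma>) N1 + smul (z1 + dot N1 \<gamma>) N2) (cof M)
    = vm (smul (dot N1 \<gamma>) N2 - smul (dot N2 \<gamma>) N1) (cof M)
      + smul z0 (vm N1 (cof M)) + smul z1 (vm N2 (cof M))"
    by (simp add: vm_linear smul_simps algebra_simps)
  then have "vm (smul (z0 - dot N2 \<gamma>) N1 + smul (z1 + dot N1 \<gamma>) N2) (cof M) = 0"
    using w0 unfolding fw' by simp
  then have "smul (z0 - dot N2 \<gamma>) N1 + smul (z1 + dot N1 \<gamma>) N2 = smul 0 N1 + smul 0 N2"
    using cof_M_inj by simp
  moreover have "cross N1 N2 \<noteq> 0" using reg q by (auto simp: regular_pair_def)
  ultimately have "z0 - dot N2 \<gamma> = 0" "z1 + dot N1 \<gamma> = 0"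
    using cross_factors_injective by blast+
  then have "z0 = dot N2 \<gamma>" "z1 = - dot N1 \<gamma>" by (simp_all add: eq_neg_iff_add_eq_0)
  moreover have "y = smul \<beta> a - smul \<alpha> b + vm \<gamma> M"
    using w_def unfolding w\<gamma> by (simp add: algebra_simps)
  ultimately show ?thesis using \<xi> unfolding \<alpha>_def \<beta>_def by blast
qed

end

section \<open>Bihomogeneous polynomials\<close>

lemma bideg_add: "bideg (m + m') = bideg m + bideg m'"
  by (simp add: bideg_def lookup_add)

lemma bihom_0 [simp]: "0 \<in> bihom a"
  by (simp add: bihom_def)

lemma bihom_add: "p \<in> bihom a \<Longrightarrow> q \<in> bihom a \<Longrightarrow> p + q \<in> bihom a"
  using Poly_Mapping.keys_add[of p q] by (auto simp: bihom_def)

lemma bihom_uminus: "p \<in> bihom a \<Longrightarrow> - p \<in> bihom a"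
  by (auto simp: bihom_def in_keys_iff)

lemma bihom_diff: "p \<in> bihom a \<Longrightarrow> q \<in> bihom a \<Longrightarrow> p - q \<in> bihom a"
  using bihom_add[of p a "- q"] bihom_uminus[of q a] by simp

lemma bihom_mult: "p \<in> bihom a \<Longrightarrow> q \<in> bihom b \<Longrightarrow> p * q \<in> bihom (a + b)"
  using Poly_Mapping.keys_mult[of p q] by (fastforce simp: bihom_def bideg_add)

lemma bihom_single: "bideg m = a \<Longrightarrow> single m c \<in> bihom a"
  by (simp add: bihom_def keys_single)

lemma bihom_cst: "cst c \<in> bihom (0, 0)"
  by (simp add: bihom_single bideg_def)

lemma bihom_var:
  "var Xs \<in> bihom (1, 0)" "var Xt \<in> bihom (1, 0)" "var Xu \<in> bihom (0, 1)" "var Xv \<in> bihom (0, 1)"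
  by (simp_all add: var_def bihom_single bideg_def lookup_single)

lemma bihom_cst_mult: "p \<in> bihom a \<Longrightarrow> cst c * p \<in> bihom a"
  using bihom_mult[OF bihom_cst, of p a c] by (cases a) simp

lemma bihom_power_u: "var Xu ^ k \<in> bihom (0, int k)"
proof (induction k)
  case 0
  show ?case using bihom_cst[of 1] by simp
next
  case (Suc k)
  show ?case using bihom_mult[OF bihom_var(3) Suc] by (simp add: add.commute)
qed

lemma sum_singles:
  "(\<Sum>m\<in>Poly_Mapping.keys p. single m (lookup p m)) = p"
  by (rule poly_mapping_eqI)
    (auto simp: lookup_sum lookup_single when_def sum.delta not_in_keys_iff_lookup_eq_zero)

lemma bihom_sum: "(\<And>i. i \<in> A \<Longrightarrow> f i \<in> bihom a) \<Longrightarrow> sum f A \<in> bihom a"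
  by (induction A rule: infinite_finite_induct) (auto intro: bihom_add)

text \<open>A bihomogeneous polynomial is the sum of its terms, each of the same bidegree.\<close>

lemma bihom_induct [consumes 1, case_names zero add single]:
  assumes p: "p \<in> bihom a" and zero: "P 0"
    and add: "\<And>p q. P p \<Longrightarrow> P q \<Longrightarrow> P (p + q)"
    and single: "\<And>m c. bideg m = a \<Longrightarrow> P (single m c)"
  shows "P p"
proof -
  have "P (\<Sum>m\<in>A. single m (lookup p m))" if "finite A" "A \<subseteq> Poly_Mapping.keys p" for A
    using that
  proof (induction A rule: finite_induct)
    case (insert m A)
    then have "bideg m = a" using p by (auto simp: bihom_def)
    then show ?case using insert add single by simp
  qed (simp add: zero)
  moreover have "(\<Sum>m\<in>Poly_Mapping.keys p. single m (lookup p m)) = p"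
    by (rule sum_singles)
  ultimately show ?thesis by (metis finite_keys subset_refl)
qed

lemma bc_bihom: "p \<in> bihom a \<Longrightarrow> bc p \<in> bihom a"
  by (auto simp: bihom_def in_keys_iff lookup_bc)

lemma single_split_var:
  assumes "lookup m x > 0"
  shows "single m c = var x * single (m - single x 1) c"
    "m = single x 1 + (m - single x 1)"
proof -
  show *: "m = single x 1 + (m - single x 1)"
    using assms by (intro poly_mapping_eqI) (auto simp: lookup_add lookup_minus lookup_single when_def)
  show "single m c = var x * single (m - single x 1) c"
    by (subst *) (simp add: var_def mult_single)
qed

lemma bideg_minus_single:
  assumes "lookup m x > 0"
  shows "bideg (m - single x 1) = bideg m - bideg (single x 1)"
  using arg_cong[OF single_split_var(2)[OF assms], of bideg] by (simp only: bideg_add) simp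

lemma bideg_single:
  "bideg (single Xs 1) = (1, 0)" "bideg (single Xt 1) = (1, 0)"
  "bideg (single Xu 1) = (0, 1)" "bideg (single Xv 1) = (0, 1)"
  by (simp_all add: bideg_def lookup_single)

lemma bihom_00: "p \<in> bihom (0, 0) \<Longrightarrow> \<exists>c. p = cst c"
proof (induction rule: bihom_induct)
  case zero
  then show ?case by (metis single_zero)
next
  case (add p q)
  then show ?case by (metis single_add)
next
  case (single m c)
  then have "lookup m x = 0" for x by (cases x) (auto simp: bideg_def)
  then have "m = 0" by (intro poly_mapping_eqI) simp
  then show ?case by blast
qed

lemma bihom_neg: "p \<in> bihom (i, j) \<Longrightarrow> j < 0 \<Longrightarrow> p = 0"
  by (induction rule: bihom_induct) (auto simp: bideg_def)

lemma bihom_1: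
  "p \<in> bihom (1, j) \<Longrightarrow> \<exists>a b. a \<in> bihom (0, j) \<and> b \<in> bihom (0, j) \<and> p = var Xs * a + var Xt * b"
proof (induction rule: bihom_induct)
  case zero
  show ?case by (rule exI[of _ 0], rule exI[of _ 0]) simp
next
  case (add p q)
  then obtain a b c d where "a \<in> bihom (0, j)" "b \<in> bihom (0, j)" "p = var Xs * a + var Xt * b"
    "c \<in> bihom (0, j)" "d \<in> bihom (0, j)" "q = var Xs * c + var Xt * d" by blast
  then show ?case
    by (intro exI[of _ "a + c"] exI[of _ "b + d"]) (simp add: bihom_add algebra_simps)
next
  case (single m c)
  then consider "lookup m Xs > 0" | "lookup m Xt > 0"
    by (fastforce simp: bideg_def)
  then show ?case
  proof cases
    case 1
    have "bideg (m - single Xs 1) = (0, j)"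
      using single by (simp only: bideg_minus_single[OF 1] bideg_single) simp
    then show ?thesis using single_split_var(1)[OF 1, of c]
      by (intro exI[of _ "single (m - single Xs 1) c"] exI[of _ 0])
        (simp add: bihom_single)
  next
    case 2
    have "bideg (m - single Xt 1) = (0, j)"
      using single by (simp only: bideg_minus_single[OF 2] bideg_single) simp
    then show ?thesis using single_split_var(1)[OF 2, of c]
      by (intro exI[of _ 0] exI[of _ "single (m - single Xt 1) c"])
        (simp add: bihom_single)
  qed
qed

text \<open>On forms of degree \<open>d\<close> in \<open>u, v\<close>, evaluation at \<open>(u, v) = (1, 0)\<close> picks the coefficient of \<open>u\<^sup>d\<close>.\<close>

definition lead :: "'k::field bipoly \<Rightarrow> 'k" where
  "lead = peval (\<lambda>c. c) (\<lambda>x. if x = Xu then 1 else 0)"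

lemma ring_map_lead: "ring_map lead"
  unfolding lead_def by (rule ring_map_peval[OF ring_map_id])

lemma lead_values: "lead (cst c) = c" "lead (var x) = (if x = Xu then 1 else 0)"
  by (simp_all add: lead_def peval_cst[OF ring_map_id] peval_var[OF ring_map_id])

lemmas lead_simps = ring_map_simps[OF ring_map_lead] lead_values

text \<open>The degree \<open>d - 1\<close> is taken in the integers, so that for \<open>d = 0\<close> the cofactor of \<open>v\<close> is forced to
  vanish.\<close>

lemma lead_decomposition:
  assumes "p \<in> bihom (0, int d)"
  shows "\<exists>p'. p' \<in> bihom (0, int d - 1) \<and> p = var Xu ^ d * cst (lead p) + var Xv * p'"
proof -
  have "\<exists>c p'. p' \<in> bihom (0, int d - 1) \<and> p = var Xu ^ d * cst c + var Xv * p'"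
    using assms
  proof (induction rule: bihom_induct)
    case zero
    show ?case by (rule exI[of _ 0], rule exI[of _ 0]) simp
  next
    case (add p q)
    then obtain c p' c' q' where "p' \<in> bihom (0, int d - 1)" "p = var Xu ^ d * cst c + var Xv * p'"
      "q' \<in> bihom (0, int d - 1)" "q = var Xu ^ d * cst c' + var Xv * q'" by blast
    then show ?case
      by (intro exI[of _ "c + c'"] exI[of _ "p' + q'"]) (simp add: bihom_add single_add algebra_simps)
  next
    case (single m c)
    show ?case
    proof (cases "lookup m Xv = 0")
      case True
      then have "lookup m x = lookup (single Xu d) x" for x
        using single by (cases x) (auto simp: bideg_def lookup_single)
      then have "m = single Xu d" by (intro poly_mapping_eqI)
      then have "single m c = var Xu ^ d * cst c"
        by (simp add: mult_single flip: single_var_power)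
      then show ?thesis by (intro exI[of _ c] exI[of _ 0]) simp
    next
      case False
      then have f: "lookup m Xv > 0" by simp
      have "bideg (m - single Xv 1) = (0, int d - 1)"
        using single by (simp only: bideg_minus_single[OF f] bideg_single) simp
      then have "single (m - single Xv 1) c \<in> bihom (0, int d - 1)"
        by (rule bihom_single)
      moreover have "single m c
          = var Xu ^ d * cst 0 + var Xv * single (m - single Xv 1) c"
        by (subst single_split_var(1)[OF f]) simp
      ultimately show ?thesis by (intro exI conjI)
    qed
  qed
  then obtain c p' where p: "p' \<in> bihom (0, int d - 1)" "p = var Xu ^ d * cst c + var Xv * p'" by blast
  have "lead p = lead (var Xu ^ d * cst c + var Xv * p')" using p(2) by (rule arg_cong)
  also have "\<dots> = c" by (simp add: lead_simps)
  finally have "lead p = c" .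
  then show ?thesis using p by (intro exI[of _ p'] conjI) (simp_all only:)
qed

section \<open>Reduction modulo linear forms\<close>

lemma subst_var: "subst var p = p"
  by (rule ring_map_eqI[of "subst var" "\<lambda>p. p"]) (simp_all add: ring_map_subst ring_map_id subst_simps)

lemma subst_fixes:
  assumes "p \<in> bihom (0, d)" "\<theta> Xu = var Xu" "\<theta> Xv = var Xv"
  shows "subst \<theta> p = p"
proof -
  have "meval \<theta> m = meval var m" if "m \<in> Poly_Mapping.keys p" for m
  proof -
    have "bideg m = (0, d)" using assms(1) that by (simp add: bihom_def)
    then have "lookup m Xs = 0" "lookup m Xt = 0" by (simp_all add: bideg_def)
    then show ?thesis by (simp add: meval_def assms(2,3))
  qed
  then have "subst \<theta> p = subst var p"
    unfolding peval_def by simp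
  then show ?thesis by (simp add: subst_var)
qed

lemma combine_multiples:
  fixes A B :: "'a::comm_ring_1"
  shows "(A * l + B * m) * q + r * (A' * l + B' * m) = (A * q + r * A') * l + (B * q + r * B') * m"
  by (simp add: algebra_simps)

text \<open>Polynomials preserve congruences modulo the ideal of \<open>l\<close> and \<open>m\<close>.\<close>

lemma subst_congruent:
  fixes l m :: "'k::field bipoly"
  assumes "\<And>x. \<exists>A B. var x - \<theta> x = A * l + B * m"
  shows "\<exists>A B. p - subst \<theta> p = A * l + B * m"
proof (induction p rule: bipoly_induct)
  case (cst c)
  show ?case by (rule exI[of _ 0], rule exI[of _ 0]) (simp add: subst_simps)
next
  case (var x)
  show ?case using assms by (simp add: subst_simps)
next
  case (add p q)
  then obtain A B A' B' where *: "p - subst \<theta> p = A * l + B * m" "q - subst \<theta> q = A' * l + B' * m" by blast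
  have "p + q - subst \<theta> (p + q) = (p - subst \<theta> p) + (q - subst \<theta> q)"
    by (simp add: subst_simps algebra_simps)
  also have "\<dots> = (A + A') * l + (B + B') * m"
    unfolding * by (simp add: algebra_simps)
  finally show ?case by (intro exI)
next
  case (mult p q)
  then obtain A B A' B' where *: "p - subst \<theta> p = A * l + B * m" "q - subst \<theta> q = A' * l + B' * m" by blast
  have "p * q - subst \<theta> (p * q) = (p - subst \<theta> p) * q + subst \<theta> p * (q - subst \<theta> q)"
    by (simp add: subst_simps algebra_simps)
  then have e: "p * q - subst \<theta> (p * q) = (A * l + B * m) * q + subst \<theta> p * (A' * l + B' * m)"
    by (simp only: *)
  show ?case
    by (rule exI[of _ "A * q + subst \<theta> p * A'"], rule exI[of _ "B * q + subst \<theta> p * B'"],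
        rule trans[OF e combine_multiples])
qed

lemma subst_retracts:
  assumes "\<And>x. l dvd var x - \<theta> x" "subst \<theta> l = 0"
  shows "retracts l (subst \<theta>)"
proof -
  have "\<exists>A B. var x - \<theta> x = A * l + B * 0" for x
    using assms(1)[of x] by (auto simp: mult.commute elim!: dvdE)
  then have "\<exists>A B. p - subst \<theta> p = A * l + B * 0" for p
    by (rule subst_congruent)
  then have "l dvd p - subst \<theta> p" for p by (metis add.right_neutral dvd_triv_right mult_zero_right)
  then show ?thesis using assms(2) by (simp add: retracts_def ring_map_subst)
qed

definition lin_form :: "'k::field \<Rightarrow> 'k \<Rightarrow> 'k bipoly" where
  "lin_form \<alpha> \<beta> = cst \<alpha> * var Xs + cst \<beta> * var Xt"

lemma bihom_10: "l \<in> bihom (1, 0) \<Longrightarrow> \<exists>\<alpha> \<beta>. l = lin_form \<alpha> \<beta>"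
  unfolding lin_form_def using bihom_1[of l 0] bihom_00 by (metis mult.commute)

lemma normalize_linear:
  fixes i a :: "'a::comm_ring_1"
  assumes "i * a = 1" "b' = - (i * b)"
  shows "x - b' * y = (a * x + b * y) * i"
proof -
  have "(a * x + b * y) * i = (i * a) * x + (i * b) * y" by (simp add: algebra_simps)
  then show ?thesis by (simp add: assms)
qed

text \<open>Solve \<open>\<alpha> s + \<beta> t = 0\<close> for a variable with nonzero coefficient and substitute.\<close>

lemma lin_form_retraction:
  assumes "\<alpha> \<noteq> 0 \<or> \<beta> \<noteq> 0"
  obtains \<theta> where "retracts (lin_form \<alpha> \<beta>) (subst \<theta>)" "\<theta> Xu = var Xu" "\<theta> Xv = var Xv"
proof (cases "\<alpha> = 0")
  case False
  let ?\<theta> = "\<lambda>x. if x = Xs then cst (- \<beta> / \<alpha>) * var Xt else var x"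
  have "var Xs - ?\<theta> Xs = lin_form \<alpha> \<beta> * cst (1 / \<alpha>)"
  proof -
    have *: "cst (1 / \<alpha>) * cst \<alpha> = 1" "cst (- \<beta> / \<alpha>) = - (cst (1 / \<alpha>) * cst \<beta>)"
      using False by (simp_all add: single_uminus flip: cst_mult)
    from normalize_linear[OF *, of "var Xs" "var Xt"] show ?thesis
      by (simp only: lin_form_def if_True simp_thms)
  qed
  moreover have "subst ?\<theta> (lin_form \<alpha> \<beta>) = 0"
  proof -
    have "cst \<alpha> * cst (- \<beta> / \<alpha>) = - cst \<beta>"
      using False by (simp add: single_uminus flip: cst_mult)
    then show ?thesis by (simp add: lin_form_def subst_simps flip: mult.assoc)
  qed
  ultimately have "retracts (lin_form \<alpha> \<beta>) (subst ?\<theta>)"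
    by (intro subst_retracts) auto
  then show thesis by (rule that) simp_all
next
  case True
  then have b: "\<beta> \<noteq> 0" using assms by simp
  let ?\<theta> = "\<lambda>x. if x = Xt then 0 else var x"
  have "var Xt - ?\<theta> Xt = lin_form \<alpha> \<beta> * cst (1 / \<beta>)"
  proof -
    have "cst (1 / \<beta>) * cst \<beta> = 1"
      using b by (simp flip: cst_mult)
    then show ?thesis using True by (simp add: lin_form_def mult.commute[of _ "cst (1 / \<beta>)"] flip: mult.assoc)
  qed
  moreover have "subst ?\<theta> (lin_form \<alpha> \<beta>) = 0"
    using True by (simp add: lin_form_def subst_simps)
  ultimately have "retracts (lin_form \<alpha> \<beta>) (subst ?\<theta>)"
    by (intro subst_retracts) auto
  then show thesis by (rule that) simp_all
qed

lemma var_retracts: "retracts (var x) (subst (var(x := 0)))"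
  by (rule subst_retracts) (auto simp: subst_simps)

lemma var_nonzero [simp]: "var x \<noteq> (0::'k::field bipoly)"
  unfolding var_def by (metis lookup_single_eq lookup_zero zero_neq_one)

lemma regular_pair_uv: "regular_pair (var Xu ^ k) (var Xv ^ m :: 'k::field bipoly)"
  by (rule regular_pair_power[OF var_retracts])
    (simp_all add: retracts_dvd_iff[OF var_retracts] subst_simps)

lemma st_kernel:
  assumes "var Xs * x + var Xt * y = (0::'k::field bipoly)"
  shows "\<exists>w. x = var Xt * w \<and> y = - (var Xs * w)"
proof -
  have "var Xt dvd var Xs * x"
    using assms by (metis add_eq_0_iff dvd_minus_iff dvd_triv_left)
  moreover have "\<not> var Xt dvd (var Xs :: 'k bipoly)"
    by (simp add: retracts_dvd_iff[OF var_retracts] subst_simps)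
  ultimately obtain w where w: "x = var Xt * w" using retracts_prime[OF var_retracts] by blast
  then have "var Xt * (var Xs * w + y) = 0" using assms by (simp only: algebra_simps)
  then show ?thesis using w by (auto simp: eq_neg_iff_add_eq_0 add.commute)
qed

section \<open>The Hilbert--Burch theorem for three binary forms\<close>

fun thom :: "int \<times> int \<Rightarrow> 'k::field bipoly tri \<Rightarrow> bool" where
  "thom a (x, y, z) \<longleftrightarrow> x \<in> bihom a \<and> y \<in> bihom a \<and> z \<in> bihom a"

lemma thom_diff: "thom a x \<Longrightarrow> thom a y \<Longrightarrow> thom a (x - y)"
  by (cases x, cases y) (simp add: bihom_diff)

lemma thom_add: "thom a x \<Longrightarrow> thom a y \<Longrightarrow> thom a (x + y)"
  by (cases x, cases y) (simp add: bihom_add)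

lemma thom_smul: "p \<in> bihom a \<Longrightarrow> thom b x \<Longrightarrow> thom (a + b) (smul p x)"
  by (cases x) (simp add: bihom_mult)

lemma thom_cross: "thom a x \<Longrightarrow> thom b y \<Longrightarrow> thom (a + b) (cross x y)"
  by (cases x, cases y) (simp add: bihom_mult bihom_diff)

lemma dot_bihom: "thom a x \<Longrightarrow> thom b y \<Longrightarrow> dot x y \<in> bihom (a + b)"
  by (cases x, cases y) (simp add: bihom_mult bihom_add)

lemma tmap_hom:
  assumes "ring_map h"
  shows "tmap h (cross a b) = cross (tmap h a) (tmap h b)" "h (dot a b) = dot (tmap h a) (tmap h b)"
    "tmap h (smul k a) = smul (h k) (tmap h a)" "tmap h (a + b) = tmap h a + tmap h b"
    "tmap h (a - b) = tmap h a - tmap h b" "tmap h 0 = 0"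
  by (cases a, cases b, simp add: ring_map_simps[OF assms] tri_zero)+

lemma tmap_vm:
  assumes "ring_map h"
  shows "tmap h (vm a M) = vm (tmap h a) (tmap (tmap h) M)"
  by (cases a, cases M rule: prod_cases3) (simp add: tmap_hom[OF assms])

lemma tmap_cof:
  assumes "ring_map h"
  shows "tmap (tmap h) (cof M) = cof (tmap (tmap h) M)"
  by (cases M rule: prod_cases3) (simp add: tmap_hom[OF assms])

lemma lead_decomposition_tri:
  assumes "thom (0, int d) N"
  shows "\<exists>N'. thom (0, int d - 1) N' \<and> N = smul (var Xu ^ d) (tmap cst (tmap lead N)) + smul (var Xv) N'"
proof -
  obtain x y z where N: "N = (x, y, z)" by (cases N)
  obtain x' y' z' where
    "x' \<in> bihom (0, int d - 1)" "x = var Xu ^ d * cst (lead x) + var Xv * x'"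
    "y' \<in> bihom (0, int d - 1)" "y = var Xu ^ d * cst (lead y) + var Xv * y'"
    "z' \<in> bihom (0, int d - 1)" "z = var Xu ^ d * cst (lead z) + var Xv * z'"
    using lead_decomposition assms unfolding N thom.simps by metis
  then show ?thesis
    unfolding N by (intro exI[of _ "(x', y', z')"]) simp
qed

lemma field_primitive:
  fixes m n :: "'a::field tri"
  assumes "m \<noteq> 0" "cross m n = 0"
  shows "\<exists>k. n = smul k m"
proof -
  obtain A where A: "dot A m = 1" by (rule tri_nonzero_unit[OF assms(1)])
  have "n = smul (dot A n) m" using cross_cross_right[of A m n] assms A by simp
  then show ?thesis ..
qed

definition component :: "int \<times> int \<Rightarrow> 'k::field bipoly \<Rightarrow> 'k bipoly" where
  "component a p = (\<Sum>m\<in>{m \<in> Poly_Mapping.keys p. bideg m = a}. single m (lookup p m))"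

lemma component_bihom: "component a p \<in> bihom a"
  unfolding component_def
  by (rule bihom_sum) (auto intro: bihom_single)

text \<open>The components of \<open>h\<close> of other bidegrees contribute terms to \<open>h q\<close> only outside the bidegree of
  \<open>h q\<close>, so they are killed by \<open>q\<close>.\<close>

lemma homogeneous_quotient:
  assumes "h * q \<in> bihom (a + b)" "q \<in> bihom b"
  shows "component a h * q = h * q"
proof -
  let ?r = "\<Sum>m\<in>{m \<in> Poly_Mapping.keys h. bideg m \<noteq> a}. single m (lookup h m)"
  have "h = (\<Sum>m\<in>Poly_Mapping.keys h. single m (lookup h m))"
    by (simp add: sum_singles)
  also have "\<dots> = component a h + ?r"
    unfolding component_def by (subst sum.union_disjoint[symmetric]) (auto intro: sum.cong)
  finally have h: "h = component a h + ?r" .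
  have kr: "bideg m \<noteq> a" if "m \<in> Poly_Mapping.keys ?r" for m
    using that keys_sum by (fastforce simp: keys_single split: if_splits)
  have "?r * q = h * q - component a h * q"
    by (subst (2) h) (simp only: ring_distribs, simp)
  also have "\<dots> \<in> bihom (a + b)"
    by (rule bihom_diff[OF assms(1) bihom_mult[OF component_bihom assms(2)]])
  finally have hom: "?r * q \<in> bihom (a + b)" .
  have "m \<notin> Poly_Mapping.keys (?r * q)" for m
  proof
    assume m: "m \<in> Poly_Mapping.keys (?r * q)"
    then obtain m1 m2 where mm: "m = m1 + m2" "m1 \<in> Poly_Mapping.keys ?r" "m2 \<in> Poly_Mapping.keys q"
      using Poly_Mapping.keys_mult[of ?r q] by blast
    have "bideg m = a + b" using hom m by (simp only: bihom_def mem_Collect_eq)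
    moreover have "bideg m2 = b" using assms(2) mm(3) by (simp add: bihom_def)
    ultimately have "bideg m1 = a" using mm(1) by (simp add: bideg_add)
    then show False using kr[OF mm(2)] by simp
  qed
  then have "Poly_Mapping.keys (?r * q) = {}" by blast
  then have "?r * q = 0" by simp
  then show ?thesis by (subst (2) h) (simp only: ring_distribs, simp)
qed


lemma tmap_cst_lead: "thom (0, 0) N \<Longrightarrow> N = tmap cst (tmap lead N)"
proof -
  assume N: "thom (0, 0) N"
  have *: "p = cst (lead p)" if "p \<in> bihom (0, 0)" for p :: "'a bipoly"
    using bihom_00[OF that] by (auto simp: lead_values)
  show ?thesis using N * by (cases N) auto
qed

lemma thom_cst: "thom (0, 0) (tmap cst k)"
  by (cases k) (simp add: bihom_cst)

lemma thom_neg: "thom (0, d) N \<Longrightarrow> d < 0 \<Longrightarrow> N = 0"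
  by (cases N) (auto simp: tri_zero dest: bihom_neg)

lemma dvd_dot: "(\<And>k. h dvd dot q (tmap cst k)) \<Longrightarrow> h dvd dot A q" for q :: "'k::field bipoly tri"
proof -
  assume h: "\<And>k. h dvd dot q (tmap cst k)"
  obtain q0 q1 q2 where q: "q = (q0, q1, q2)" by (cases q)
  have "h dvd q0" using h[of "(1, 0, 0)"] by (simp add: q)
  moreover have "h dvd q1" using h[of "(0, 1, 0)"] by (simp add: q)
  moreover have "h dvd q2" using h[of "(0, 0, 1)"] by (simp add: q)
  ultimately show ?thesis by (cases A) (simp add: q)
qed

text \<open>Three independent forms of degree \<open>n\<close> in \<open>u, v\<close> without common zero, the latter expressed by powers
  of \<open>u\<close> and \<open>v\<close> in their ideal.\<close>

locale binary_triple =
  fixes q A B :: "'k::field bipoly tri" and n k m :: nat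
  assumes q_hom: "thom (0, int n) q"
    and uA: "var Xu ^ k = dot A q" and vB: "var Xv ^ m = dot B q"
    and indep: "\<And>c. dot q (tmap cst c) = 0 \<Longrightarrow> c = 0"
begin

definition syz :: "nat \<Rightarrow> 'k bipoly tri \<Rightarrow> bool" where
  "syz d N \<longleftrightarrow> thom (0, int d) N \<and> dot q N = 0"

abbreviation "ld \<equiv> tmap (lead :: 'k bipoly \<Rightarrow> 'k)"

lemmas ld_hom = tmap_hom[OF ring_map_lead]

lemma q_primitive: "primitive q"
  by (rule primitiveI[OF regular_pair_uv uA vB])

lemma ld_q: "ld q \<noteq> 0"
proof
  assume "ld q = 0"
  then have "lead (dot A q) = 0" by (simp add: ld_hom)
  then show False by (simp add: lead_simps flip: uA)
qed

lemma q_nz: "q \<noteq> 0"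
  using ld_q by (auto simp: ld_hom)

lemma syz_ld: "syz d N \<Longrightarrow> dot (ld q) (ld N) = 0"
  unfolding syz_def using ld_hom(2)[of q N] by (simp add: lead_simps)

text \<open>A syzygy that vanishes at the point \<open>(1, 0)\<close> is divisible by \<open>v\<close>.  Together with subtracting multiples
  of known syzygies this gives induction on the degree.\<close>

lemma syz_shift:
  assumes "syz d N" "ld N = 0"
  shows "N = 0 \<or> (\<exists>N' e. d = Suc e \<and> N = smul (var Xv) N' \<and> syz e N')"
proof -
  obtain N' where N': "thom (0, int d - 1) N'"
    and "N = smul (var Xu ^ d) (tmap cst (ld N)) + smul (var Xv) N'"
    using lead_decomposition_tri assms(1) unfolding syz_def by blast
  then have N: "N = smul (var Xv) N'" using assms(2) by (simp add: tmap_hom[OF ring_map_cst])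
  show ?thesis
  proof (cases d)
    case 0
    then have "N' = 0" using N' thom_neg[of "int d - 1" N'] by simp
    then show ?thesis using N by simp
  next
    case (Suc e)
    have "var Xv * dot q N' = 0" using assms(1) unfolding syz_def N by (simp add: dot_linear)
    then have "dot q N' = 0" by simp
    then have "syz e N'" using N' Suc by (simp add: syz_def)
    then show ?thesis using N Suc by blast
  qed
qed

lemma syz_diff: "syz d x \<Longrightarrow> syz d y \<Longrightarrow> syz d (x - y)"
  by (simp add: syz_def dot_linear thom_diff)

lemma syz_scale:
  assumes "syz d x" "d \<le> e"
  shows "syz e (smul (cst c * var Xu ^ (e - d)) x)"
proof -
  have "cst c * var Xu ^ (e - d) \<in> bihom (0, int (e - d))"
    by (intro bihom_cst_mult bihom_power_u)
  then have "thom ((0, int (e - d)) + (0, int d)) (smul (cst c * var Xu ^ (e - d)) x)"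
    using assms(1) unfolding syz_def by (intro thom_smul) auto
  then show ?thesis using assms by (simp add: syz_def dot_linear of_nat_diff)
qed

lemma ld_scale: "ld (smul (cst c * var Xu ^ i) x) = smul c (ld x)"
  by (simp add: ld_hom lead_simps)

lemma koszul_syz: "syz n (cross q (tmap cst c))"
  using thom_cross[OF q_hom thom_cst[of c]] by (simp add: syz_def)

text \<open>Take a nonzero syzygy \<open>N\<^sub>1\<close> of least degree \<open>\<mu>\<close> and a syzygy \<open>N\<^sub>2\<close> of least degree \<open>\<nu>\<close> among those
  not parallel to \<open>N\<^sub>1\<close>.  Minimality makes their values at \<open>(1, 0)\<close> independent, for otherwise a
  combination would be divisible by \<open>v\<close>.  These values span the plane orthogonal to the value of \<open>q\<close>,
  so every syzygy can be reduced to one divisible by \<open>v\<close>, and \<open>N\<^sub>1, N\<^sub>2\<close> generate all syzygies.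
  Since \<open>q\<close> is primitive, \<open>N\<^sub>1 \<times> N\<^sub>2 = h q\<close>; and \<open>h\<close> divides the entries of \<open>q\<close>, because cross
  products of the Koszul syzygies are multiples of \<open>N\<^sub>1 \<times> N\<^sub>2\<close>.  So \<open>h\<close> is a nonzero constant, and
  comparing degrees gives \<open>\<mu> + \<nu> = n\<close>.\<close>

theorem hilbert_burch:
  "\<exists>\<mu> N1 N2. 0 < \<mu> \<and> 2 * \<mu> \<le> n \<and> thom (0, int \<mu>) N1 \<and> thom (0, int (n - \<mu>)) N2 \<and> cross N1 N2 = q"
proof -
  define \<mu> where "\<mu> = (LEAST d. \<exists>N. N \<noteq> 0 \<and> syz d N)"
  obtain c where c: "cross q (tmap cst c) \<noteq> 0"
  proof -
    obtain q0 q1 q2 where q: "q = (q0, q1, q2)" by (cases q)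
    show thesis
    proof (cases "q1 = 0 \<and> q2 = 0")
      case True
      then have "q0 \<noteq> 0" using q_nz q by (simp add: tri_zero)
      then show ?thesis by (intro that[of "(0, 1, 0)"]) (simp add: q tri_zero)
    next
      case False
      then show ?thesis by (intro that[of "(1, 0, 0)"]) (auto simp: q tri_zero)
    qed
  qed
  then have ex1: "\<exists>d N. N \<noteq> 0 \<and> syz d N" using koszul_syz by blast
  obtain N1 where N1: "N1 \<noteq> 0" "syz \<mu> N1"
    using LeastI_ex[OF ex1] unfolding \<mu>_def by blast
  have below: "N = 0" if "syz d N" "d < \<mu>" for d N
    using not_less_Least[of d "\<lambda>d. \<exists>N. N \<noteq> 0 \<and> syz d N"] that unfolding \<mu>_def by blast
  define \<nu> where "\<nu> = (LEAST d. \<exists>N. cross N1 N \<noteq> 0 \<and> syz d N)"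
  have ex2: "\<exists>d N. cross N1 N \<noteq> 0 \<and> syz d N"
  proof (rule ccontr)
    assume "\<not> ?thesis"
    then have "cross N1 (cross q (tmap cst c)) = 0" for c using koszul_syz by blast
    then have "smul (dot N1 (tmap cst c)) q = 0" for c
      using N1(2) by (simp add: cross_cross_right syz_def dot_commute[of N1 q])
    then have "dot N1 (tmap cst c) = 0" for c using q_nz by simp
    from this[of "(1, 0, 0)"] this[of "(0, 1, 0)"] this[of "(0, 0, 1)"] have "N1 = 0"
      by (cases N1) (simp add: tri_zero)
    then show False using N1(1) by simp
  qed
  obtain N2 where N2: "cross N1 N2 \<noteq> 0" "syz \<nu> N2"
    using LeastI_ex[OF ex2] unfolding \<nu>_def by blast
  have below2: "cross N1 N = 0" if "syz d N" "d < \<nu>" for d N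
    using not_less_Least[of d "\<lambda>d. \<exists>N. cross N1 N \<noteq> 0 \<and> syz d N"] that unfolding \<nu>_def by blast
  have le: "\<mu> \<le> \<nu>"
    using below[OF N2(2)] N2(1) by (cases "\<nu> < \<mu>") auto
  have ld1: "ld N1 \<noteq> 0"
  proof
    assume "ld N1 = 0"
    then obtain N' e where "\<mu> = Suc e" "N1 = smul (var Xv) N'" "syz e N'"
      using syz_shift[OF N1(2)] N1(1) by blast
    then show False using below[of e N'] N1(1) by simp
  qed
  have ld2: "cross (ld N1) (ld N2) \<noteq> 0"
  proof
    assume "cross (ld N1) (ld N2) = 0"
    then obtain k where k: "ld N2 = smul k (ld N1)" using field_primitive ld1 by blast
    let ?N = "N2 - smul (cst k * var Xu ^ (\<nu> - \<mu>)) N1"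
    have nz: "cross N1 ?N \<noteq> 0" using N2(1) by (simp add: cross_linear)
    have "syz \<nu> ?N" by (intro syz_diff N2 syz_scale N1 le)
    moreover have "ld ?N = 0" by (simp add: ld_hom(5) ld_scale k)
    moreover have "?N \<noteq> 0" using nz by (metis cross_zero(2))
    ultimately obtain N' e where N': "\<nu> = Suc e" "?N = smul (var Xv) N'" "syz e N'"
      using syz_shift by blast
    then have "cross N1 N' = 0" using below2[of e N'] by simp
    then show False using nz unfolding N'(2) by (simp add: cross_linear)
  qed
  have span: "\<exists>a b. N = smul a N1 + smul b N2" if "syz d N" for d N
    using that
  proof (induction d arbitrary: N rule: less_induct)
    case (less d)
    have step: "\<exists>a b. N = smul a N1 + smul b N2"
      if T: "syz d (N - (smul x N1 + smul y N2))" "ld (N - (smul x N1 + smul y N2)) = 0" for x y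
    proof -
      have "\<exists>a b. N - (smul x N1 + smul y N2) = smul a N1 + smul b N2"
        using syz_shift[OF T]
      proof
        assume "N - (smul x N1 + smul y N2) = 0"
        then show ?thesis by (intro exI[of _ 0]) simp
      next
        assume "\<exists>N' e. d = Suc e \<and> N - (smul x N1 + smul y N2) = smul (var Xv) N' \<and> syz e N'"
        then obtain N' e where N': "d = Suc e" "N - (smul x N1 + smul y N2) = smul (var Xv) N'" "syz e N'"
          by blast
        obtain a b where "N' = smul a N1 + smul b N2" using less.IH[of e N'] N' by auto
        then show ?thesis unfolding N'(2)
          by (intro exI[of _ "var Xv * a"] exI[of _ "var Xv * b"]) (simp add: smul_simps)
      qed
      then obtain a b where "N - (smul x N1 + smul y N2) = smul a N1 + smul b N2" by blast
      then have "N = smul a N1 + smul b N2 + (smul x N1 + smul y N2)" by (simp only: diff_eq_eq)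
      also have "\<dots> = smul (a + x) N1 + smul (b + y) N2"
        unfolding smul_simps by (simp only: add_ac)
      finally show ?thesis by blast
    qed
    consider "d < \<mu>" | "\<mu> \<le> d" "cross N1 N = 0" | "\<nu> \<le> d"
      using below2 less.prems by (meson not_le)
    then show ?case
    proof cases
      case 1
      then have "N = 0" using below less.prems by blast
      then show ?thesis by (intro exI[of _ 0]) simp
    next
      case 2
      have "cross (ld N1) (ld N) = 0" using arg_cong[OF 2(2), of ld] by (simp add: ld_hom)
      then obtain k where k: "ld N = smul k (ld N1)" using field_primitive ld1 by blast
      let ?x = "cst k * var Xu ^ (d - \<mu>)"
      have "syz d (N - smul ?x N1)" by (intro syz_diff less.prems syz_scale N1 2)
      moreover have "ld (N - smul ?x N1) = 0" by (simp add: ld_hom(5) ld_scale k)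
      ultimately show ?thesis using step[of ?x 0] by simp
    next
      case 3
      let ?m = "cross (ld N1) (ld N2)"
      have "cross (ld q) ?m = 0"
        using syz_ld[OF N1(2)] syz_ld[OF N2(2)] by (simp add: cross_cross_right)
      then obtain j where j: "?m = smul j (ld q)" using field_primitive ld_q by blast
      have nm: "dot (ld N) ?m = 0"
        unfolding j using syz_ld[OF less.prems] by (simp add: dot_linear dot_commute[of "ld N"])
      obtain w where w: "dot w ?m = 1" by (rule tri_nonzero_unit[OF ld2])
      define x where "x = dot (cross w (ld N)) (ld N2)"
      define y where "y = - dot (cross w (ld N)) (ld N1)"
      have "ld N = cross (cross w (ld N)) ?m"
        using cross_cross_left[of w "ld N" ?m] nm w by simp
      also have "\<dots> = smul x (ld N1) + smul y (ld N2)"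
        by (simp add: cross_cross_right x_def y_def smul_simps)
      finally have ldN: "ld N = smul x (ld N1) + smul y (ld N2)" .
      let ?x = "cst x * var Xu ^ (d - \<mu>)" and ?y = "cst y * var Xu ^ (d - \<nu>)"
      have "syz d (N - smul ?x N1 - smul ?y N2)"
        by (intro syz_diff less.prems syz_scale N1 N2 3 order_trans[OF le 3])
      moreover have "ld (N - smul ?x N1 - smul ?y N2) = 0"
        by (simp only: ld_hom(5) ld_scale ldN) simp
      ultimately show ?thesis using step[of ?x ?y] by (simp only: diff_diff_eq)
    qed
  qed
  have "cross (cross N1 N2) q = 0"
    using N1(2) N2(2) by (simp add: cross_cross_left syz_def dot_commute[of _ q])
  then obtain h0 where h0: "cross N1 N2 = smul h0 q" using q_primitive unfolding primitive_def by blast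
  define \<delta> where "\<delta> = int \<mu> + int \<nu> - int n"
  define h where "h = component (0, \<delta>) h0"
  have h: "cross N1 N2 = smul h q"
  proof -
    have "thom (0, int \<mu> + int \<nu>) (smul h0 q)"
      using thom_cross[of "(0, int \<mu>)" N1 "(0, int \<nu>)" N2] N1 N2 unfolding h0[symmetric] syz_def by simp
    then have t: "thom ((0, \<delta>) + (0, int n)) (smul h0 q)" by (simp add: \<delta>_def)
    obtain q0 q1 q2 where q: "q = (q0, q1, q2)" by (cases q)
    have "h * q0 = h0 * q0" "h * q1 = h0 * q1" "h * q2 = h0 * q2"
      using t q_hom homogeneous_quotient[of h0 _ "(0, \<delta>)" "(0, int n)"]
      unfolding q h_def smul.simps thom.simps by blast+
    then show ?thesis unfolding h0 by (simp only: q smul.simps)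
  qed
  have hdvd: "h dvd dot q (tmap cst c)" for c
  proof -
    \<comment> \<open>Every constant vector is a cross product, so that \<open>q \<cdot> c\<close> appears as a coefficient of a cross product of Koszul syzygies.\<close>
    obtain x y where xy: "c = cross x y"
    proof -
      obtain c0 c1 c2 where cc: "c = (c0, c1, c2)" by (cases c)
      show thesis
      proof (cases "c0 = 0")
        case True
        then show thesis using that[of "(1, 0, 0)" "(0, c2, - c1)"] by (simp add: cc)
      next
        case False
        then show thesis using that[of "(- c1 / c0, 1, 0)" "(- c2, 0, c0)"] by (simp add: cc)
      qed
    qed
    let ?x = "cross q (tmap cst x)" and ?y = "cross q (tmap cst y)"
    obtain a b where ab: "?x = smul a N1 + smul b N2" using span[OF koszul_syz] by blast
    obtain a' b' where ab': "?y = smul a' N1 + smul b' N2" using span[OF koszul_syz] by blast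
    have "smul (dot q (tmap cst c)) q = cross ?x ?y"
      unfolding xy tmap_hom[OF ring_map_cst]
      by (rule cross_cross_common[symmetric])
    also have "\<dots> = smul (a * b' - b * a') (cross N1 N2)"
      unfolding ab ab' by (rule cross_combinations)
    also have "\<dots> = smul ((a * b' - b * a') * h) q" unfolding h by (simp add: smul_simps)
    finally have "dot q (tmap cst c) = (a * b' - b * a') * h"
      by (rule smul_cancel_right[OF q_nz])
    then show ?thesis by (simp only: dvd_triv_right)
  qed
  have "h dvd var Xu ^ k" "h dvd var Xv ^ m"
    unfolding uA vB by (rule dvd_dot[OF hdvd])+
  then obtain e where he: "h * e = 1" using regular_pair_common_divisor[OF regular_pair_uv] by blast
  have h_hom: "h \<in> bihom (0, \<delta>)" unfolding h_def by (rule component_bihom)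
  \<comment> \<open>A unit does not vanish at the origin, so the form \<open>h\<close> has degree \<open>0\<close>.\<close>
  have "\<delta> = 0"
  proof (rule ccontr)
    assume "\<delta> \<noteq> 0"
    define z :: "'k bipoly \<Rightarrow> 'k" where "z = peval (\<lambda>c. c) (\<lambda>_. 0)"
    have z: "ring_map z" unfolding z_def by (rule ring_map_peval[OF ring_map_id])
    have "z h = 0" using h_hom
    proof (induction rule: bihom_induct)
      case (single mm c)
      then have "lookup mm Xu \<noteq> 0 \<or> lookup mm Xv \<noteq> 0"
        using \<open>\<delta> \<noteq> 0\<close> by (auto simp: bideg_def)
      then show ?case by (auto simp: z_def peval_single meval_def)
    qed (simp_all add: ring_map_simps[OF z])
    then show False using arg_cong[OF he, of z] by (simp add: ring_map_simps[OF z])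
  qed
  then obtain \<kappa> where \<kappa>: "h = cst \<kappa>" using h_hom bihom_00 by blast
  then have \<kappa>0: "\<kappa> \<noteq> 0" using he by auto
  have \<nu>: "\<nu> = n - \<mu>" "2 * \<mu> \<le> n" using \<open>\<delta> = 0\<close> le unfolding \<delta>_def by linarith+
  \<comment> \<open>A syzygy of degree \<open>0\<close> would be a linear relation between the entries of \<open>q\<close>.\<close>
  have "\<mu> \<noteq> 0"
  proof
    assume "\<mu> = 0"
    then have "N1 = tmap cst (ld N1)" using N1(2) by (intro tmap_cst_lead) (simp add: syz_def)
    then have "ld N1 = 0" using indep[of "ld N1"] N1(2) by (simp add: syz_def)
    then show False using ld1 by simp
  qed
  moreover have "thom (0, int (n - \<mu>)) (smul (cst (1 / \<kappa>)) N2)"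
    using thom_smul[OF bihom_cst, of "(0, int \<nu>)" N2 "1 / \<kappa>"] N2(2) unfolding syz_def \<nu>(1) by simp
  moreover have "cross N1 (smul (cst (1 / \<kappa>)) N2) = q"
  proof -
    have "cst (1 / \<kappa>) * cst \<kappa> = 1" using \<kappa>0 by (simp flip: cst_mult)
    then show ?thesis by (simp only: cross_linear h \<kappa> smul_simps smul_special)
  qed
  ultimately show ?thesis using \<nu>(2) N1(2) unfolding syz_def by blast
qed

end

section \<open>Linear independence and extension of scalars\<close>

definition indep3 :: "'k::field bipoly tri \<Rightarrow> bool" where
  "indep3 w \<longleftrightarrow> (\<forall>k. dot w (tmap cst k) = 0 \<longrightarrow> k = 0)"

lemma indep3D: "indep3 w \<Longrightarrow> dot w (tmap cst k) = 0 \<Longrightarrow> k = 0"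
  by (simp only: indep3_def)

lemma cst_dot_eq: "dot (x, y, z) (tmap cst (a, b, c)) = scale a x + (scale b y + scale c z)"
  by (simp only: dot.simps tmap.simps scale_eq mult.commute add.assoc)

lemma span3: "bipoly.span {x, y, z} = {dot (x, y, z) (tmap cst k) | k. True}"
proof -
  have "p \<in> bipoly.span {x, y, z} \<longleftrightarrow> (\<exists>a b c. p = scale a x + (scale b y + scale c z))" for p
  proof -
    have "p \<in> bipoly.span {x, y, z} \<longleftrightarrow> (\<exists>a b. p - scale a x - scale b y \<in> range (\<lambda>c. scale c z))"
      by (simp only: bipoly.span_breakdown_eq bipoly.span_singleton)
    also have "\<dots> \<longleftrightarrow> (\<exists>a b c. p - scale a x - scale b y = scale c z)" by blast
    also have "\<dots> \<longleftrightarrow> (\<exists>a b c. p = scale a x + (scale b y + scale c z))"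
      by (simp only: diff_eq_eq add.commute add.left_commute)
    finally show ?thesis .
  qed
  then have "p \<in> bipoly.span {x, y, z} \<longleftrightarrow> (\<exists>k. p = dot (x, y, z) (tmap cst k))" for p
    by (simp only: split_paired_Ex cst_dot_eq)
  then show ?thesis by blast
qed

lemma ideal_gen3: "ideal_gen {x, y, z} = {dot (x, y, z) k | k. True}"
proof -
  have "p \<in> ideal_gen {x, y, z} \<longleftrightarrow> (\<exists>a b c. p = a * x + (b * y + c * z))" for p
  proof -
    have "p \<in> ideal_gen {x, y, z} \<longleftrightarrow> (\<exists>a b. p - a * x - b * y \<in> range (\<lambda>c. c * z))"
      by (simp only: bipoly_ideal.span_breakdown_eq bipoly_ideal.span_singleton)
    also have "\<dots> \<longleftrightarrow> (\<exists>a b c. p - a * x - b * y = c * z)" by blast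
    also have "\<dots> \<longleftrightarrow> (\<exists>a b c. p = a * x + (b * y + c * z))"
      by (simp only: diff_eq_eq add.commute add.left_commute)
    finally show ?thesis .
  qed
  moreover have "dot (x, y, z) (a, b, c) = a * x + (b * y + c * z)" for a b c
    by (simp only: dot.simps mult.commute add.assoc)
  ultimately have "p \<in> ideal_gen {x, y, z} \<longleftrightarrow> (\<exists>k. p = dot (x, y, z) k)" for p
    by (simp only: split_paired_Ex)
  then show ?thesis by blast
qed

lemma indep3_if_independent:
  assumes "bipoly.independent {x, y, z}" "x \<noteq> y" "y \<noteq> z" "x \<noteq> z"
  shows "indep3 (x, y, z)"
  unfolding indep3_def
proof (intro allI impI)
  fix k :: "'a tri"
  obtain a b c where k: "k = (a, b, c)" by (cases k)
  assume "dot (x, y, z) (tmap cst k) = 0"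
  then have 0: "scale a x + (scale b y + scale c z) = 0" by (simp only: k cst_dot_eq)
  define u where "u = (\<lambda>v. if v = x then a else if v = y then b else c)"
  have "(\<Sum>v\<in>{x, y, z}. scale (u v) v) = 0"
    using assms 0 by (simp add: u_def)
  then have "u v = 0" if "v \<in> {x, y, z}" for v
    using bipoly.independentD[OF assms(1), of "{x, y, z}" u v] that by simp
  from this[of x] this[of y] this[of z] show "k = 0"
    using assms by (simp add: u_def k tri_zero)
qed

lemma independent_if_indep3:
  assumes "indep3 (x, y, z)"
  shows "bipoly.independent {x, y, z}" "x \<noteq> y" "y \<noteq> z" "x \<noteq> z"
proof -
  have i: "a = 0 \<and> b = 0 \<and> c = 0" if "scale a x + (scale b y + scale c z) = 0" for a b c
    using assms that unfolding indep3_def cst_dot_eq[symmetric] by (fastforce simp: tri_zero)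
  show d: "x \<noteq> y" "y \<noteq> z" "x \<noteq> z"
    using i[of 1 "-1" 0] i[of 0 1 "-1"] i[of 1 0 "-1"] by auto
  show "bipoly.independent {x, y, z}"
  proof (rule bipoly.independent_if_scalars_zero)
    fix u v assume "(\<Sum>v\<in>{x, y, z}. scale (u v) v) = 0" "v \<in> {x, y, z}"
    then show "u v = 0" using d i[of "u x" "u y" "u z"] by auto
  qed simp
qed

lemma indep3_swap: "indep3 (x, y, z) \<Longrightarrow> indep3 (y, z, x)" "indep3 (x, y, z) \<Longrightarrow> indep3 (y, x, z)"
proof -
  assume a: "indep3 (x, y, z)"
  show "indep3 (y, z, x)"
    unfolding indep3_def
  proof (intro allI impI)
    fix k :: "'a tri" assume 0: "dot (y, z, x) (tmap cst k) = 0"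
    obtain k0 k1 k2 where k: "k = (k0, k1, k2)" by (cases k)
    have "dot (x, y, z) (tmap cst (k2, k0, k1)) = 0"
      using 0 unfolding k dot.simps tmap.simps by (simp only: add_ac)
    then have "(k2, k0, k1) = 0" by (rule indep3D[OF a])
    then show "k = 0" by (simp add: k tri_zero)
  qed
  show "indep3 (y, x, z)"
    unfolding indep3_def
  proof (intro allI impI)
    fix k :: "'a tri" assume 0: "dot (y, x, z) (tmap cst k) = 0"
    obtain k0 k1 k2 where k: "k = (k0, k1, k2)" by (cases k)
    have "dot (x, y, z) (tmap cst (k1, k0, k2)) = 0"
      using 0 unfolding k dot.simps tmap.simps by (simp only: add_ac)
    then have "(k1, k0, k2) = 0" by (rule indep3D[OF a])
    then show "k = 0" by (simp add: k tri_zero)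
  qed
qed

lemma bc_scale: "bc (scale c p) = scale (to_ac c) (bc p)"
  by (simp add: scale_eq bc_simps)

lemma bc_span: "x \<in> bipoly.span S \<Longrightarrow> bc x \<in> bipoly.span (bc ` S)"
proof (induction rule: bipoly.span_induct_alt)
  case base
  show ?case by (simp add: bc_simps bipoly.span_zero)
next
  case (step c x y)
  then show ?case unfolding bc_add bc_scale
    by (intro bipoly.span_add bipoly.span_scale) (auto intro: bipoly.span_base)
qed

lemma inj_bc: "inj bc"
  by (rule injI) simp

text \<open>Given a relation over the closure with a nonzero coefficient at \<open>b\<^sub>0\<close>, scale that coefficient to
  \<open>1\<close> and apply the coefficient retraction: the result is a relation over the ground field with
  coefficient \<open>1\<close> at \<open>b\<^sub>0\<close>.\<close>

lemma bc_independent: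
  fixes B :: "'k::field bipoly set"
  assumes "finite B" "bipoly.independent B"
  shows "bipoly.independent (bc ` B)"
proof (rule bipoly.independent_if_scalars_zero)
  show "finite (bc ` B)" using assms by simp
  fix f y assume 0: "(\<Sum>x\<in>bc ` B. scale (f x) x) = 0" and "y \<in> bc ` B"
  then obtain b0 where b0: "b0 \<in> B" "y = bc b0" by blast
  have s0: "(\<Sum>b\<in>B. scale (f (bc b)) (bc b)) = 0"
    using 0 by (subst (asm) sum.reindex) (auto intro: inj_on_subset[OF inj_bc])
  show "f y = 0"
  proof (rule ccontr)
    assume nz: "f y \<noteq> 0"
    obtain \<pi> :: "'k alg_closure \<Rightarrow> 'k" where
      \<pi>: "\<pi> 1 = 1" "\<And>x y. \<pi> (x + y) = \<pi> x + \<pi> y" "\<And>c x. \<pi> (to_ac c * x) = c * \<pi> x"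
      using coefficient_retraction by metis
    have \<pi>0: "\<pi> 0 = 0" using \<pi>(3)[of 0 0] by simp
    have \<pi>s: "\<pi> (sum g A) = (\<Sum>a\<in>A. \<pi> (g a))" if "finite A" for g :: "'k bipoly \<Rightarrow> 'k alg_closure" and A
      using that by (induction A rule: finite_induct) (simp_all add: \<pi>0 \<pi>(2))
    have lk: "lookup (scale c p) m = c * lookup p m" for c :: "'b::field" and p m
    proof -
      have "scale c p = Poly_Mapping.map ((*) c) p" unfolding scale_def by (rule mult_map_scale_conv_mult[symmetric])
      then show ?thesis by (simp add: Poly_Mapping.map.rep_eq when_def)
    qed
    define u where "u b = \<pi> (f (bc b) / f y)" for b
    have "(\<Sum>b\<in>B. scale (u b) b) = 0"
    proof (rule poly_mapping_eqI)
      fix m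
      have "(\<Sum>b\<in>B. f (bc b) * to_ac (lookup b m)) = 0"
        using arg_cong[OF s0, of "\<lambda>p. lookup p m"] by (simp add: lookup_sum lk lookup_bc)
      then have "(\<Sum>b\<in>B. to_ac (lookup b m) * (f (bc b) / f y)) = 0"
        by (simp add: mult.commute flip: sum_divide_distrib)
      then have "(\<Sum>b\<in>B. \<pi> (to_ac (lookup b m) * (f (bc b) / f y))) = 0"
        using \<pi>s[OF assms(1)] \<pi>0 by metis
      then have "(\<Sum>b\<in>B. lookup b m * u b) = 0" by (simp only: \<pi>(3) u_def)
      then show "lookup (\<Sum>b\<in>B. scale (u b) b) m = lookup 0 m"
        by (simp add: lookup_sum lk mult.commute)
    qed
    then have "u b0 = 0" using bipoly.independentD[OF assms(2,1), of u b0] b0 by simp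
    then show False using \<pi>(1) nz b0 by (simp add: u_def)
  qed
qed

text \<open>Otherwise \<open>1\<close> plus the product of all linear factors would have no root.\<close>

lemma infinite_alg_closed: "infinite (UNIV :: 'a::alg_closed_field set)"
proof
  assume f: "finite (UNIV :: 'a set)"
  define p where "p = (\<Prod>a\<in>(UNIV :: 'a set). [:- a, 1:]) + 1"
  have "degree (\<Prod>a\<in>(UNIV :: 'a set). [:- a, 1:]) = card (UNIV :: 'a set)"
    by (subst degree_prod_eq_sum_degree) auto
  moreover have "card (UNIV :: 'a set) > 0" using f by (simp add: card_gt_0_iff)
  ultimately have "degree p > 0" unfolding p_def by (simp add: degree_add_eq_left)
  then obtain x where "poly p x = 0" using alg_closed_imp_poly_has_root by blast
  moreover have "poly p x = 1" using f by (simp add: p_def poly_prod)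
  ultimately show False by simp
qed

section \<open>Points of the Segre section\<close>

lemma subspace_extend: "bipoly.subspace (extend_scalars W)"
  by (simp add: extend_scalars_def)

lemma segre_section_point:
  assumes "P \<in> segre_section n W"
  shows "\<exists>l g. l \<in> bihom (1, 0) \<and> g \<in> bihom (0, int n) \<and> l \<noteq> 0 \<and> g \<noteq> 0
    \<and> l * g \<in> extend_scalars W \<and> P = bipoly.span {l * g}"
proof -
  obtain p where p: "P = bipoly.span {p}" "p \<in> extend_scalars W"
    using assms unfolding segre_section_def proj_points_def by blast
  obtain l g where lg: "P = bipoly.span {l * g}" "l \<in> bihom (1, 0)" "l \<noteq> 0" "g \<in> bihom (0, int n)" "g \<noteq> 0"
    using assms unfolding segre_section_def segre_def by blast
  have "l * g \<in> bipoly.span {p}" using p lg bipoly.span_base[of "l * g" "{l * g}"] by simp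
  then have "l * g \<in> extend_scalars W"
    using bipoly.span_minimal[OF _ subspace_extend, of "{p}"] p by blast
  then show ?thesis using lg by blast
qed

lemma segre_section_memI:
  assumes "l \<in> bihom (1, 0)" "g \<in> bihom (0, int n)" "l * g \<noteq> 0" "l * g \<in> extend_scalars W"
  shows "bipoly.span {l * g} \<in> segre_section n W"
proof -
  have "l \<noteq> 0" "g \<noteq> 0" using assms(3) by auto
  then show ?thesis using assms unfolding segre_section_def segre_def proj_points_def by blast
qed

lemma indep3_coeff:
  assumes "indep3 w" "dot w (tmap cst k) = dot w (tmap cst k')"
  shows "k = k'"
proof -
  have "dot w (tmap cst (k - k')) = 0"
    using assms(2) by (simp add: tmap_hom[OF ring_map_cst] dot_linear)
  then have "k - k' = 0" by (rule indep3D[OF assms(1)])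
  then show ?thesis by simp
qed

text \<open>The coefficient \<open>1\<close> at \<open>w\<^sub>2\<close> normalizes the representatives, so different \<open>c\<close> give different
  points.\<close>

lemma infinite_family:
  fixes \<phi> :: "'k::field alg_closure \<Rightarrow> 'k alg_closure"
  assumes ind: "indep3 (w0, w1, w2)" and S: "infinite S"
    and w: "w0 \<in> extend_scalars W" "w1 \<in> extend_scalars W" "w2 \<in> extend_scalars W"
    and fam: "\<And>c. c \<in> S \<Longrightarrow> \<exists>l g. l \<in> bihom (1, 0) \<and> g \<in> bihom (0, int n)
      \<and> l * g = dot (w0, w1, w2) (tmap cst (c, \<phi> c, 1))"
  shows "infinite (segre_section n W)"
proof
  assume fin: "finite (segre_section n W)"
  define e where "e c = dot (w0, w1, w2) (tmap cst (c, \<phi> c, 1))" for c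
  have nz: "e c \<noteq> 0" for c
  proof
    assume "e c = 0"
    then have "(c, \<phi> c, 1 :: 'k alg_closure) = 0" unfolding e_def by (rule indep3D[OF ind])
    then show False by (simp add: tri_zero)
  qed
  have mem: "e c \<in> extend_scalars W" for c
    unfolding e_def cst_dot_eq
    by (intro bipoly.subspace_add[OF subspace_extend] bipoly.subspace_scale[OF subspace_extend] w)
  have "(\<lambda>c. bipoly.span {e c}) ` S \<subseteq> segre_section n W"
  proof (intro image_subsetI)
    fix c assume "c \<in> S"
    from fam[OF this] obtain l g where lg: "l \<in> bihom (1, 0)" "g \<in> bihom (0, int n)" "l * g = e c"
      unfolding e_def by (elim exE conjE)
    show "bipoly.span {e c} \<in> segre_section n W"
      by (rule segre_section_memI[OF lg(1,2), unfolded lg(3), OF nz mem])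
  qed
  moreover have "inj_on (\<lambda>c. bipoly.span {e c}) S"
  proof (rule inj_onI)
    fix c d assume "bipoly.span {e c} = bipoly.span {e d}"
    then have "e c \<in> bipoly.span {e d}" using bipoly.span_base[of "e c" "{e c}"] by simp
    then obtain r where "e c = scale r (e d)" unfolding bipoly.span_singleton by blast
    then have "dot (w0, w1, w2) (tmap cst (c, \<phi> c, 1)) = dot (w0, w1, w2) (tmap cst (smul r (d, \<phi> d, 1)))"
      unfolding e_def scale_eq tmap_hom[OF ring_map_cst] dot_linear .
    then have "(c, \<phi> c, 1) = smul r (d, \<phi> d, 1)" by (rule indep3_coeff[OF ind])
    then show "c = d" by simp
  qed
  ultimately have "finite S" using fin by (meson finite_imageD finite_subset)
  then show False using S by simp
qed

text \<open>If one of the three vectors is a combination of the other two, then all three lie in a plane,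
  and its points form a line.  When the other two are parallel themselves, a second spanning
  vector is needed; the constant \<open>1\<close> works, because its bidegree is different.\<close>

lemma noncollinear_indep3:
  fixes w0 w1 w2 :: "'k::field bipoly"
  assumes hom: "w0 \<in> bihom (1, d)" "w1 \<in> bihom (1, d)" "w2 \<in> bihom (1, d)"
    and nz: "w0 \<noteq> 0" "w1 \<noteq> 0" "w2 \<noteq> 0"
    and nc: "\<not> proj_collinear {bipoly.span {w0}, bipoly.span {w1}, bipoly.span {w2}}"
  shows "indep3 (w0, w1, w2)"
proof -
  have dep2: "\<exists>x. bipoly.independent {w, x} \<and> w \<noteq> x \<and> w' \<in> bipoly.span {w, x}"
    if "w \<in> bihom (1, d)" "w \<noteq> 0" for w w' :: "'k bipoly"
  proof (cases "w' \<in> bipoly.span {w}")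
    case True
    have "(1::'k bipoly) \<notin> bipoly.span {w}"
    proof
      assume "(1::'k bipoly) \<in> bipoly.span {w}"
      then obtain c where "1 = cst c * w" by (auto simp: bipoly.span_singleton scale_eq)
      then have "(1::'k bipoly) \<in> bihom (1, d)"
        using bihom_cst_mult[OF that(1), of c] by (simp only:)
      then have "bideg 0 = (1, d)" by (simp add: bihom_def)
      then show False by (simp add: bideg_def)
    qed
    then have "bipoly.independent {1, w}"
      by (rule bipoly.independent_insertI) (use that in simp)
    moreover have "w \<noteq> 1" using \<open>1 \<notin> bipoly.span {w}\<close> bipoly.span_base[of w "{w}"] by auto
    moreover have "w' \<in> bipoly.span {w, 1}" using True bipoly.span_mono[of "{w}" "{w, 1}"] by blast
    ultimately show ?thesis by (intro exI[of _ 1]) (simp add: insert_commute)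
  next
    case False
    then have "bipoly.independent {w', w}"
      by (rule bipoly.independent_insertI) (use that in simp)
    moreover have "w \<noteq> w'" using False bipoly.span_base[of w "{w}"] by auto
    ultimately show ?thesis by (intro exI[of _ w']) (auto simp: insert_commute intro: bipoly.span_base)
  qed
  have coll: "proj_collinear {bipoly.span {w}, bipoly.span {w'}, bipoly.span {w''}}"
    if w: "w \<in> bihom (1, d)" "w \<noteq> 0" "w' \<noteq> 0" "w'' \<noteq> 0" and w'': "w'' = scale a w + scale b w'"
    for w w' w'' :: "'k bipoly" and a b
  proof -
    obtain x where x: "bipoly.independent {w, x}" "w \<noteq> x" "w' \<in> bipoly.span {w, x}"
      using dep2[OF w(1,2)] by blast
    let ?V = "bipoly.span {w, x}"
    have ww: "w \<in> ?V" by (rule bipoly.span_base) simp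
    have "w'' \<in> ?V" unfolding w'' by (intro bipoly.span_add bipoly.span_scale ww x)
    moreover have "bipoly.dim ?V = 2" using x by (simp add: bipoly.dim_eq_card_independent)
    ultimately show ?thesis
      unfolding proj_collinear_def proj_points_def using ww x(3) w
      by (intro exI[of _ ?V] conjI bipoly.subspace_span) auto
  qed
  show ?thesis
    unfolding indep3_def
  proof (intro allI impI)
    fix k :: "'k tri" assume k0: "dot (w0, w1, w2) (tmap cst k) = 0"
    obtain a b c where k: "k = (a, b, c)" by (cases k)
    have r: "scale a w0 + (scale b w1 + scale c w2) = 0" using k0 unfolding k cst_dot_eq .
    have solve: "y = scale (- p / q) x + scale (- r / q) z"
      if "q \<noteq> 0" "scale q y = - (scale p x + scale r z)" for p q r and x y z :: "'k bipoly"
    proof -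
      have "y = scale (1 / q) (scale q y)" using that(1) by simp
      also have "\<dots> = scale (1 / q) (- (scale p x + scale r z))" by (simp only: that(2))
      also have "\<dots> = scale (- p / q) x + scale (- r / q) z"
        by (simp add: bipoly.scale_right_diff_distrib)
      finally show ?thesis .
    qed
    have "c = 0"
    proof (rule ccontr)
      assume "c \<noteq> 0"
      moreover have "scale c w2 = - (scale a w0 + scale b w1)"
        using r by (simp only: eq_neg_iff_add_eq_0 add_ac)
      ultimately have "w2 = scale (- a / c) w0 + scale (- b / c) w1" by (rule solve)
      from coll[OF hom(1) nz this] nc show False by simp
    qed
    moreover have "b = 0"
    proof (rule ccontr)
      assume "b \<noteq> 0"
      moreover have "scale b w1 = - (scale a w0 + scale c w2)"
        using r by (simp only: eq_neg_iff_add_eq_0 add_ac)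
      ultimately have "w1 = scale (- a / b) w0 + scale (- c / b) w2" by (rule solve)
      from coll[OF hom(1) nz(1,3,2) this] nc show False by (simp add: insert_commute)
    qed
    moreover have "a = 0"
    proof (rule ccontr)
      assume "a \<noteq> 0"
      moreover have "scale a w0 = - (scale b w1 + scale c w2)"
        using r by (simp only: eq_neg_iff_add_eq_0 add_ac)
      ultimately have "w0 = scale (- b / a) w1 + scale (- c / a) w2" by (rule solve)
      from coll[OF hom(2) nz(2,3,1) this] nc show False by (simp add: insert_commute)
    qed
    ultimately show "k = 0" by (simp add: k tri_zero)
  qed
qed

text \<open>For proportional \<open>l\<^sub>0, l\<^sub>1\<close> every combination of \<open>l\<^sub>0 g\<^sub>0\<close> and \<open>l\<^sub>1 g\<^sub>1\<close> factors: the section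
  contains a line.\<close>

lemma proportional_lines_infinite:
  fixes W :: "'k::field bipoly set"
  assumes ind: "indep3 (lin_form a b * g0, lin_form a' b' * g1, w2)"
    and nz: "a \<noteq> 0 \<or> b \<noteq> 0" and det: "a * b' = a' * b"
    and w: "lin_form a b * g0 \<in> extend_scalars W" "lin_form a' b' * g1 \<in> extend_scalars W" "w2 \<in> extend_scalars W"
    and g: "g0 \<in> bihom (0, int n)" "g1 \<in> bihom (0, int n)"
  shows "infinite (segre_section n W)"
proof -
  obtain \<kappa> where \<kappa>: "a' = \<kappa> * a" "b' = \<kappa> * b"
  proof (cases "a = 0")
    case True
    then show thesis using nz det by (intro that[of "b' / b"]) auto
  next
    case False
    then show thesis using det by (intro that[of "a' / a"]) (auto simp: field_simps)
  qed
  have l: "lin_form a' b' = cst \<kappa> * lin_form a b"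
    unfolding lin_form_def \<kappa> cst_mult by (simp only: ring_distribs mult.assoc)
  have "indep3 (lin_form a b * g0, w2, lin_form a' b' * g1)"
    using ind indep3_swap by blast
  then show ?thesis
  proof (rule infinite_family[OF _ infinite_alg_closed, where \<phi> = "\<lambda>_. 0"])
    fix c :: "'k alg_closure"
    have "lin_form a b * (cst c * g0 + cst \<kappa> * g1)
        = dot (lin_form a b * g0, w2, lin_form a' b' * g1) (tmap cst (c, 0, 1))"
      unfolding l cst_dot_eq scale_eq
      by (simp only: ring_distribs mult.assoc mult.left_commute single_zero single_one mult_zero_left mult_1_left add_0_left)
    moreover have "lin_form a b \<in> bihom (1, 0)"
      unfolding lin_form_def by (intro bihom_add bihom_cst_mult bihom_var)
    moreover have "cst c * g0 + cst \<kappa> * g1 \<in> bihom (0, int n)"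
      by (intro bihom_add bihom_cst_mult g)
    ultimately show "\<exists>l g. l \<in> bihom (1, 0) \<and> g \<in> bihom (0, int n)
      \<and> l * g = dot (lin_form a b * g0, w2, lin_form a' b' * g1) (tmap cst (c, 0, 1))"
      by (intro exI conjI)
  qed (rule w)+
qed

lemma add3_solve:
  fixes x :: "'a::ab_group_add"
  assumes "x + (y + z) = 0"
  shows "z = - x - y"
  using assms by (simp add: eq_diff_eq eq_neg_iff_add_eq_0 add_ac)

text \<open>The product on the left runs through a conic of factorizable elements in the span of \<open>l\<^sub>0 g\<^sub>0\<close>,
  \<open>l\<^sub>1 g\<^sub>1\<close> and \<open>l\<^sub>2 g\<^sub>2\<close> when \<open>l\<^sub>2 = - l\<^sub>0 - l\<^sub>1\<close> and \<open>g\<^sub>2 = m\<^sub>0 g\<^sub>0 + m\<^sub>1 g\<^sub>1\<close>.  It is found by writing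
  elements of the span as \<open>2 \<times> 2\<close> matrices in \<open>l\<^sub>i g\<^sub>j\<close> and asking for determinant \<open>0\<close>.\<close>

lemma conic_identity:
  fixes t ti :: "'a::comm_ring_1"
  assumes "t * ti = 1"
  shows "(t * l0 - m0 * l1) * (g0 - (m1 * ti) * g1)
    = (t + m0) * (l0 * g0) + ((m0 * m1 * ti + m1) * (l1 * g1) + (- l0 - l1) * (m0 * g0 + m1 * g1))"
proof -
  have "(t * l0 - m0 * l1) * (g0 - (m1 * ti) * g1)
    = (t + m0) * (l0 * g0) + ((m0 * m1 * ti + m1) * (l1 * g1) + (- l0 - l1) * (m0 * g0 + m1 * g1))
      + (1 - t * ti) * (m1 * l0 * g1)"
    by (simp add: algebra_simps)
  then show ?thesis by (simp add: assms)
qed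

lemma dependent_forms_infinite:
  fixes W :: "'k::field bipoly set"
  assumes ind: "indep3 (l0 * g0, l1 * g1, l2 * g2)" and l2: "l2 = - l0 - l1"
    and g2: "g2 = cst m0 * g0 + cst m1 * g1"
    and w: "l0 * g0 \<in> extend_scalars W" "l1 * g1 \<in> extend_scalars W" "l2 * g2 \<in> extend_scalars W"
    and g: "g0 \<in> bihom (0, int n)" "g1 \<in> bihom (0, int n)"
    and l: "l0 \<in> bihom (1, 0)" "l1 \<in> bihom (1, 0)"
  shows "infinite (segre_section n W)"
proof (rule infinite_family[OF ind, where \<phi> = "\<lambda>c. m0 * m1 * (1 / (c - m0)) + m1"])
  show "infinite (UNIV - {m0})" using infinite_alg_closed by simp
  fix c assume c: "c \<in> UNIV - {m0}"
  \<comment> \<open>The point with parameter \<open>\<tau>\<close> on the conic of \<open>conic_identity\<close> has first coordinate \<open>\<tau> + m\<^sub>0\<close>.\<close>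
  define \<tau> where "\<tau> = c - m0"
  have c': "c = \<tau> + m0" "\<tau> \<noteq> 0" using c by (auto simp: \<tau>_def)
  have t: "cst \<tau> * cst (1 / \<tau>) = 1" using c' by (simp flip: cst_mult)
  have "(cst \<tau> * l0 - cst m0 * l1) * (g0 - (cst m1 * cst (1 / \<tau>)) * g1)
     = dot (l0 * g0, l1 * g1, l2 * g2) (tmap cst (c, m0 * m1 * (1 / (c - m0)) + m1, 1))"
    unfolding cst_dot_eq scale_eq c'(1) single_add cst_mult add_diff_cancel_right' single_one mult_1_left l2 g2
    by (rule conic_identity[OF t])
  moreover have "cst \<tau> * l0 - cst m0 * l1 \<in> bihom (1, 0)"
    by (intro bihom_diff bihom_cst_mult l)
  moreover have "g0 - (cst m1 * cst (1 / \<tau>)) * g1 \<in> bihom (0, int n)"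
    unfolding cst_mult[symmetric] by (intro bihom_diff bihom_cst_mult g)
  ultimately show "\<exists>l g. l \<in> bihom (1, 0) \<and> g \<in> bihom (0, int n)
      \<and> l * g = dot (l0 * g0, l1 * g1, l2 * g2) (tmap cst (c, m0 * m1 * (1 / (c - m0)) + m1, 1))"
    by (intro exI conjI)
qed (rule w)+

lemma lin_form_cst: "cst c * lin_form a b = lin_form (c * a) (c * b)"
  unfolding lin_form_def cst_mult by (simp only: ring_distribs mult.assoc)

lemma lin_form_bihom: "lin_form a b \<in> bihom (1, 0)"
  unfolding lin_form_def by (intro bihom_add bihom_cst_mult bihom_var)

lemma lin_form_0_iff: "lin_form a b = 0 \<longleftrightarrow> a = 0 \<and> b = 0"
proof
  assume "lin_form a b = 0"
  then have "peval (\<lambda>c. c) \<theta> (lin_form a b) = 0" for \<theta>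
    by (simp add: ring_map_simps[OF ring_map_peval[OF ring_map_id]])
  then have "a * \<theta> Xs + b * \<theta> Xt = 0" for \<theta> :: "indet \<Rightarrow> 'a"
    by (simp add: lin_form_def ring_map_simps[OF ring_map_peval[OF ring_map_id]]
        peval_cst[OF ring_map_id] peval_var[OF ring_map_id])
  from this[of "\<lambda>x. if x = Xs then 1 else 0"] this[of "\<lambda>x. if x = Xt then 1 else 0"]
  show "a = 0 \<and> b = 0" by simp
qed (simp add: lin_form_def)

text \<open>Three split points of the section, given by \<open>l\<^sub>i = a\<^sub>i s + b\<^sub>i t\<close> and \<open>g\<^sub>i\<close>, with the linear forms scaled
  to have sum \<open>0\<close>; then the determinants of all pairs of them agree.\<close>

definition normal_points ::
  "nat \<Rightarrow> 'k::field bipoly set \<Rightarrow> 'k alg_closure tri \<Rightarrow> 'k alg_closure tri \<Rightarrow> 'k alg_closure bipoly tri \<Rightarrow> bool" where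
  "normal_points n W = (\<lambda>(a0, a1, a2) (b0, b1, b2) (g0, g1, g2).
     a0 + a1 + a2 = 0 \<and> b0 + b1 + b2 = 0 \<and> a0 * b1 - a1 * b0 \<noteq> 0 \<and>
     g0 \<in> bihom (0, int n) \<and> g1 \<in> bihom (0, int n) \<and> g2 \<in> bihom (0, int n) \<and>
     lin_form a0 b0 * g0 \<in> extend_scalars W \<and> lin_form a1 b1 * g1 \<in> extend_scalars W \<and>
     lin_form a2 b2 * g2 \<in> extend_scalars W \<and>
     indep3 (lin_form a0 b0 * g0, lin_form a1 b1 * g1, lin_form a2 b2 * g2) \<and>
     indep3 (g0, g1, g2))"

text \<open>Both kinds of degeneracy, proportional linear forms and dependent \<open>g\<^sub>i\<close>, would make the section
  infinite.\<close>

lemma three_points_normal_form: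
  fixes W :: "'k::field bipoly set"
  assumes fin: "finite (segre_section n W)"
    and pts: "{P0, P1, P2} \<subseteq> segre_section n W" "\<not> proj_collinear {P0, P1, P2}"
  shows "\<exists>a b g. normal_points n W a b g"
proof -
  obtain l0 g0 where 0: "l0 \<in> bihom (1, 0)" "g0 \<in> bihom (0, int n)" "l0 \<noteq> 0" "g0 \<noteq> 0"
    "l0 * g0 \<in> extend_scalars W" "P0 = bipoly.span {l0 * g0}"
    using segre_section_point[of P0 n W] pts by blast
  obtain l1 g1 where 1: "l1 \<in> bihom (1, 0)" "g1 \<in> bihom (0, int n)" "l1 \<noteq> 0" "g1 \<noteq> 0"
    "l1 * g1 \<in> extend_scalars W" "P1 = bipoly.span {l1 * g1}"
    using segre_section_point[of P1 n W] pts by blast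
  obtain l2 g2 where 2: "l2 \<in> bihom (1, 0)" "g2 \<in> bihom (0, int n)" "l2 \<noteq> 0" "g2 \<noteq> 0"
    "l2 * g2 \<in> extend_scalars W" "P2 = bipoly.span {l2 * g2}"
    using segre_section_point[of P2 n W] pts by blast
  have hom: "l * g \<in> bihom (1, int n)" if "l \<in> bihom (1, 0)" "g \<in> bihom (0, int n)" for l g :: "'k alg_closure bipoly"
    using bihom_mult[OF that] by simp
  have ind: "indep3 (l0 * g0, l1 * g1, l2 * g2)"
    by (rule noncollinear_indep3[of _ "int n"])
      (use hom 0 1 2 pts(2) in simp_all)
  obtain a0 b0 where l0: "l0 = lin_form a0 b0" using bihom_10[OF 0(1)] by blast
  obtain a1 b1 where l1: "l1 = lin_form a1 b1" using bihom_10[OF 1(1)] by blast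
  obtain a2 b2 where l2: "l2 = lin_form a2 b2" using bihom_10[OF 2(1)] by blast
  have nz: "a0 \<noteq> 0 \<or> b0 \<noteq> 0" "a1 \<noteq> 0 \<or> b1 \<noteq> 0" "a2 \<noteq> 0 \<or> b2 \<noteq> 0"
    using 0(3) 1(3) 2(3) unfolding l0 l1 l2 lin_form_0_iff by auto
  \<comment> \<open>By Cramer's rule these minors are the coefficients of the linear relation between the \<open>l\<^sub>i\<close>.\<close>
  define d0 where "d0 = a1 * b2 - a2 * b1"
  define d1 where "d1 = a2 * b0 - a0 * b2"
  define d2 where "d2 = a0 * b1 - a1 * b0"
  note ind' = ind[unfolded l0 l1 l2] and mem = 0(5)[unfolded l0] 1(5)[unfolded l1] 2(5)[unfolded l2]
  have d2: "d2 \<noteq> 0"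
    using proportional_lines_infinite[OF ind' nz(1) _ mem 0(2) 1(2)] fin by (auto simp: d2_def)
  have d0: "d0 \<noteq> 0"
    using proportional_lines_infinite[OF indep3_swap(1)[OF ind'] nz(2) _ mem(2,3,1) 1(2) 2(2)] fin
    by (auto simp: d0_def)
  have d1: "d1 \<noteq> 0"
    using proportional_lines_infinite[OF indep3_swap(1)[OF indep3_swap(1)[OF ind']] nz(3) _ mem(3,1,2) 2(2) 0(2)] fin
    by (auto simp: d1_def)
  have resc: "lin_form (d * a) (d * b) * (cst (1 / d) * g) = lin_form a b * g" if "d \<noteq> 0"
    for d a b and g :: "'k alg_closure bipoly"
  proof -
    have "lin_form (d * a) (d * b) * (cst (1 / d) * g) = (cst d * cst (1 / d)) * (lin_form a b * g)"
      unfolding lin_form_cst[symmetric] by (simp only: mult_ac)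
    also have "cst d * cst (1 / d) = 1" using that by (simp flip: cst_mult)
    finally show ?thesis by simp
  qed
  let ?g0 = "cst (1 / d0) * g0" and ?g1 = "cst (1 / d1) * g1" and ?g2 = "cst (1 / d2) * g2"
  let ?l0 = "lin_form (d0 * a0) (d0 * b0)" and ?l1 = "lin_form (d1 * a1) (d1 * b1)"
    and ?l2 = "lin_form (d2 * a2) (d2 * b2)"
  have sum: "d0 * a0 + d1 * a1 + d2 * a2 = 0" "d0 * b0 + d1 * b1 + d2 * b2 = 0"
    by (simp_all add: d0_def d1_def d2_def algebra_simps)
  have "lin_form x y + lin_form x' y' + lin_form x'' y'' = lin_form (x + x' + x'') (y + y' + y'')"
    for x x' x'' y y' y'' :: "'k alg_closure"
    unfolding lin_form_def single_add by (simp only: ring_distribs add_ac)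
  then have lsum: "?l0 + ?l1 + ?l2 = 0" by (simp only: sum) (simp add: lin_form_def)
  have det: "(d0 * a0) * (d1 * b1) - (d1 * a1) * (d0 * b0) = d0 * d1 * d2"
    by (simp add: d2_def algebra_simps)
  have ghom: "?g0 \<in> bihom (0, int n)" "?g1 \<in> bihom (0, int n)" "?g2 \<in> bihom (0, int n)"
    by (intro bihom_cst_mult 0 1 2)+
  have lind: "indep3 (?l0 * ?g0, ?l1 * ?g1, ?l2 * ?g2)"
    unfolding resc[OF d0] resc[OF d1] resc[OF d2] by (rule ind')
  have lmem: "?l0 * ?g0 \<in> extend_scalars W" "?l1 * ?g1 \<in> extend_scalars W" "?l2 * ?g2 \<in> extend_scalars W"
    unfolding resc[OF d0] resc[OF d1] resc[OF d2] by (rule mem)+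
  have solve: "z = cst (- p / r) * x + cst (- q / r) * y"
    if "r \<noteq> 0" "cst p * x + (cst q * y + cst r * z) = 0" for p q r and x y z :: "'k alg_closure bipoly"
  proof -
    have "cst r * z = cst (- p) * x + cst (- q) * y"
      using add3_solve[OF that(2)] by (simp add: single_uminus)
    then have "cst (1 / r) * (cst r * z) = cst (1 / r) * (cst (- p) * x + cst (- q) * y)" by simp
    then show ?thesis using that(1)
      by (simp add: ring_distribs flip: mult.assoc cst_mult)
  qed
  have gind: "indep3 (?g0, ?g1, ?g2)"
    unfolding indep3_def
  proof (intro allI impI)
    fix k :: "'k alg_closure tri" assume k0: "dot (?g0, ?g1, ?g2) (tmap cst k) = 0"
    obtain a b c where k: "k = (a, b, c)" by (cases k)
    have r: "cst a * ?g0 + (cst b * ?g1 + cst c * ?g2) = 0"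
      using k0 unfolding k cst_dot_eq scale_eq .
    have "c = 0"
    proof (rule ccontr)
      assume "c \<noteq> 0"
      have s: "?l2 = - ?l0 - ?l1" using lsum by (simp only: eq_diff_eq eq_neg_iff_add_eq_0 add_ac)
      show False
        using dependent_forms_infinite[OF lind s solve[OF \<open>c \<noteq> 0\<close> r] lmem ghom(1,2) lin_form_bihom lin_form_bihom] fin by simp
    qed
    moreover have "a = 0"
    proof (rule ccontr)
      assume "a \<noteq> 0"
      have s: "?l0 = - ?l1 - ?l2" using lsum by (simp only: eq_diff_eq eq_neg_iff_add_eq_0 add_ac)
      have r': "cst b * ?g1 + (cst c * ?g2 + cst a * ?g0) = 0" using r by (simp only: add_ac)
      show False
        using dependent_forms_infinite[OF indep3_swap(1)[OF lind] s solve[OF \<open>a \<noteq> 0\<close> r'] lmem(2,3,1) ghom(2,3) lin_form_bihom lin_form_bihom] fin by simp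
    qed
    moreover have "b = 0"
    proof (rule ccontr)
      assume "b \<noteq> 0"
      have s: "?l1 = - ?l2 - ?l0" using lsum by (simp only: eq_diff_eq eq_neg_iff_add_eq_0 add_ac)
      have r': "cst c * ?g2 + (cst a * ?g0 + cst b * ?g1) = 0" using r by (simp only: add_ac)
      show False
        using dependent_forms_infinite[OF indep3_swap(1)[OF indep3_swap(1)[OF lind]] s solve[OF \<open>b \<noteq> 0\<close> r'] lmem(3,1,2) ghom(3,1) lin_form_bihom lin_form_bihom] fin by simp
    qed
    ultimately show "k = 0" by (simp add: k tri_zero)
  qed
  have "normal_points n W (d0 * a0, d1 * a1, d2 * a2) (d0 * b0, d1 * b1, d2 * b2) (?g0, ?g1, ?g2)"
    unfolding normal_points_def prod.case det using sum ghom lmem lind gind d0 d1 d2 by simp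
  then show ?thesis by blast
qed

section \<open>Coordinates over the ground field\<close>

fun transp :: "'a tri tri \<Rightarrow> 'a tri tri" where
  "transp ((a, b, c), (d, e, f), (g, h, i)) = ((a, d, g), (b, e, h), (c, f, i))"

lemma transp_transp [simp]: "transp (transp M) = M"
  by (cases M rule: prod_cases3, rename_tac x y z, case_tac x, case_tac y, case_tac z) simp

lemma vm_transp: "vm q (transp (c0, c1, c2)) = (dot q c0, dot q c1, dot q c2)"
  by (cases q, cases c0, cases c1, cases c2) simp

lemma tmap_transp: "tmap (tmap h) (transp M) = transp (tmap (tmap h) M)"
  by (cases M rule: prod_cases3, rename_tac x y z, case_tac x, case_tac y, case_tac z) simp

lemma tmap_mm:
  assumes "ring_map h"
  shows "tmap (tmap h) (mm A B) = mm (tmap (tmap h) A) (tmap (tmap h) B)"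
  by (cases A rule: prod_cases3) (simp add: tmap_vm[OF assms])

lemma tmap_mdet:
  assumes "ring_map h"
  shows "mdet (tmap (tmap h) A) = h (mdet A)"
  by (cases A rule: prod_cases3) (simp add: tmap_hom[OF assms])

lemma mdet_diag: "mdet (diag (a, b, c)) = a * b * c"
  by simp

lemma vm_one: "vm x (diag (1, 1, 1)) = x"
  by (cases x) simp

definition lin_pencil :: "'a::comm_ring_1 \<Rightarrow> 'a tri tri \<Rightarrow> 'a \<Rightarrow> 'a tri tri \<Rightarrow> 'a tri tri" where
  "lin_pencil s Xm t Ym = tmap (smul s) Xm + tmap (smul t) Ym"

lemma vm_lin_pencil: "vm q (lin_pencil s Xm t Ym) = smul s (vm q Xm) + smul t (vm q Ym)"
  unfolding lin_pencil_def
  by (cases q, cases Xm rule: prod_cases3, cases Ym rule: prod_cases3)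
    (simp add: smul_simps mult.commute[of s] mult.commute[of t] add_ac)

lemma mm_lin_pencil_right: "mm P (lin_pencil s Xm t Ym) = lin_pencil s (mm P Xm) t (mm P Ym)"
  by (cases P rule: prod_cases3) (simp add: vm_lin_pencil lin_pencil_def[of s "(_, _)"])

lemma mm_lin_pencil_left: "mm (lin_pencil s Xm t Ym) P = lin_pencil s (mm Xm P) t (mm Ym P)"
  unfolding lin_pencil_def
  by (cases Xm rule: prod_cases3, cases Ym rule: prod_cases3) (simp add: vm_linear)

lemma diag_lin_pencil:
  "diag (s * a0 + t * b0, s * a1 + t * b1, s * a2 + t * b2) = lin_pencil s (diag (a0, a1, a2)) t (diag (b0, b1, b2))"
  by (simp add: lin_pencil_def)

lemma tmap_lin_pencil:
  assumes "ring_map h"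
  shows "tmap (tmap h) (lin_pencil s Xm t Ym) = lin_pencil (h s) (tmap (tmap h) Xm) (h t) (tmap (tmap h) Ym)"
  unfolding lin_pencil_def
  by (cases Xm rule: prod_cases3, cases Ym rule: prod_cases3) (simp add: tmap_hom[OF assms])

text \<open>A nonzero row of the cofactor matrix is in the kernel.  If there is none, all rows are parallel, and
  a vector orthogonal to a nonzero row will do, or any vector if there is no such row.\<close>

lemma singular_kernel:
  fixes A :: "'a::field tri tri"
  assumes "mdet A = 0"
  shows "\<exists>k. k \<noteq> 0 \<and> mv A k = 0"
proof -
  obtain r0 r1 r2 where A: "A = (r0, r1, r2)" by (cases A rule: prod_cases3)
  have cyc: "dot r1 (cross r2 r0) = dot r0 (cross r1 r2)" "dot r2 (cross r0 r1) = dot r0 (cross r1 r2)"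
    by (cases r0, cases r1, cases r2, simp add: algebra_simps)+
  have d: "dot r0 (cross r1 r2) = 0" using assms by (simp add: A)
  have perp: "\<exists>k. k \<noteq> 0 \<and> dot r k = 0" for r :: "'a tri"
  proof -
    obtain a b c where r: "r = (a, b, c)" by (cases r)
    show ?thesis
    proof (cases "a = 0")
      case True
      then show ?thesis by (intro exI[of _ "(1, 0, 0)"]) (simp add: r tri_zero)
    next
      case False
      then show ?thesis by (intro exI[of _ "(b, - a, 0)"]) (simp add: r tri_zero)
    qed
  qed
  have parallel: "\<exists>k. k \<noteq> 0 \<and> dot r k = 0 \<and> dot r' k = 0 \<and> dot r'' k = 0"
    if rr: "r \<noteq> 0" "cross r r' = 0" "cross r r'' = 0" for r r' r'' :: "'a tri"
  proof -
    obtain i where i: "r' = smul i r" using field_primitive[OF rr(1,2)] by blast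
    obtain j where j: "r'' = smul j r" using field_primitive[OF rr(1,3)] by blast
    obtain k where "k \<noteq> 0" "dot r k = 0" using perp by blast
    then show ?thesis unfolding i j by (intro exI[of _ k]) (simp add: dot_linear)
  qed
  have "\<exists>k. k \<noteq> 0 \<and> dot r0 k = 0 \<and> dot r1 k = 0 \<and> dot r2 k = 0"
  proof (cases "cross r1 r2 = 0 \<and> cross r2 r0 = 0 \<and> cross r0 r1 = 0")
    case False
    then consider "cross r1 r2 \<noteq> 0" | "cross r2 r0 \<noteq> 0" | "cross r0 r1 \<noteq> 0" by blast
    then show ?thesis
    proof cases
      case 1
      then show ?thesis using d by (intro exI[of _ "cross r1 r2"]) simp
    next
      case 2
      then show ?thesis using d cyc by (intro exI[of _ "cross r2 r0"]) simp
    next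
      case 3
      then show ?thesis using d cyc by (intro exI[of _ "cross r0 r1"]) simp
    qed
  next
    case True
    then have "cross r0 r2 = 0" "cross r1 r0 = 0" "cross r2 r1 = 0"
      using cross_anti[of r0 r2] cross_anti[of r1 r0] cross_anti[of r2 r1] by simp_all
    note z = True this
    consider "r0 \<noteq> 0" | "r1 \<noteq> 0" | "r2 \<noteq> 0" | "r0 = 0" "r1 = 0" "r2 = 0" by blast
    then show ?thesis
    proof cases
      case 1
      then show ?thesis using parallel[of r0 r1 r2] z by blast
    next
      case 2
      then show ?thesis using parallel[of r1 r0 r2] z by blast
    next
      case 3
      then show ?thesis using parallel[of r2 r0 r1] z by blast
    next
      case 4
      then show ?thesis by (intro exI[of _ "(1, 0, 0)"]) (simp, simp add: tri_zero)
    qed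
  qed
  then show ?thesis unfolding A mv.simps tri_zero by blast
qed

abbreviation cmat :: "'k::field tri tri \<Rightarrow> 'k bipoly tri tri" where
  "cmat \<equiv> tmap (tmap cst)"

lemma mm_adjugate: "mm A (transp (cof A)) = diag (mdet A, mdet A, mdet A)"
  by (cases A rule: prod_cases3, rename_tac x y z, case_tac x, case_tac y, case_tac z)
    (simp add: algebra_simps)

text \<open>A singular \<open>A\<close> would have a kernel vector, which is a linear relation on \<open>w\<close>.\<close>

lemma change_of_basis:
  assumes "indep3 w" "w = vm x (cmat A)"
  shows "\<exists>B. x = vm w (cmat B) \<and> mdet A * mdet B = 1"
proof -
  have nz: "mdet A \<noteq> 0"
  proof
    assume "mdet A = 0"
    then obtain k where k: "k \<noteq> 0" "mv A k = 0" using singular_kernel by blast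
    have mv_cst: "mv (cmat A) (tmap cst k) = tmap cst (mv A k)"
      by (cases A rule: prod_cases3) (simp add: tmap_hom[OF ring_map_cst])
    have "dot w (tmap cst k) = 0"
      unfolding assms(2) dot_vm mv_cst k(2) by (simp add: tmap_hom[OF ring_map_cst])
    then have "k = 0" by (rule indep3D[OF assms(1)])
    then show False using k by simp
  qed
  define B where "B = mm (transp (cof A)) (diag (1 / mdet A, 1 / mdet A, 1 / mdet A))"
  have AB: "mm A B = diag (1, 1, 1)"
    unfolding B_def mm_assoc[symmetric] mm_adjugate using nz by simp
  have "vm w (cmat B) = vm x (cmat (mm A B))"
    unfolding assms(2) vm_vm tmap_mm[OF ring_map_cst] ..
  also have "\<dots> = vm x (diag (1, 1, 1))" unfolding AB by simp
  finally have "x = vm w (cmat B)" by (simp only: vm_one)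
  moreover have "mdet A * mdet B = 1" using mdet_mm[of A B] unfolding AB mdet_diag by simp
  ultimately show ?thesis by blast
qed

lemma vm_unique:
  assumes "indep3 q" "vm q (cmat A) = vm q (cmat B)"
  shows "A = B"
proof -
  obtain a0 a1 a2 where a: "transp A = (a0, a1, a2)" by (cases "transp A" rule: prod_cases3)
  obtain b0 b1 b2 where b: "transp B = (b0, b1, b2)" by (cases "transp B" rule: prod_cases3)
  have A: "A = transp (a0, a1, a2)" and B: "B = transp (b0, b1, b2)" using a b by (metis transp_transp)+
  have "dot q (tmap cst a0) = dot q (tmap cst b0)" "dot q (tmap cst a1) = dot q (tmap cst b1)"
    "dot q (tmap cst a2) = dot q (tmap cst b2)"
    using assms(2) unfolding A B tmap_transp tmap.simps vm_transp by simp_all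
  then show ?thesis unfolding A B using indep3_coeff[OF assms(1)] by metis
qed

lemma span_columns:
  assumes "{x, y, z} \<subseteq> bipoly.span {q0, q1, q2}"
  shows "\<exists>Xm. (x, y, z) = vm (q0, q1, q2) (cmat Xm)"
proof -
  have *: "\<exists>c. p = dot (q0, q1, q2) (tmap cst c)" if "p \<in> {x, y, z}" for p
    using subsetD[OF assms that] unfolding span3 by simp
  obtain c0 where "x = dot (q0, q1, q2) (tmap cst c0)" using *[of x] by auto
  moreover obtain c1 where "y = dot (q0, q1, q2) (tmap cst c1)" using *[of y] by auto
  moreover obtain c2 where "z = dot (q0, q1, q2) (tmap cst c2)" using *[of z] by auto
  ultimately have "(x, y, z) = vm (q0, q1, q2) (cmat (transp (c0, c1, c2)))"
    unfolding tmap_transp tmap.simps(1)[of "tmap cst"] vm_transp by (simp only:)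
  then show ?thesis ..
qed

lemma span3_memI: "dot (x, y, z) (tmap cst k) \<in> bipoly.span {x, y, z}"
  unfolding span3 by (rule CollectI, rule exI[of _ k]) simp

lemma columns_span:
  assumes "(x, y, z) = vm (q0, q1, q2) (cmat Xm)"
  shows "{x, y, z} \<subseteq> bipoly.span {q0, q1, q2}"
proof -
  obtain c0 c1 c2 where "transp Xm = (c0, c1, c2)" by (cases "transp Xm" rule: prod_cases3)
  then have Xm: "Xm = transp (c0, c1, c2)" by (metis transp_transp)
  have "(x, y, z) = (dot (q0, q1, q2) (tmap cst c0), dot (q0, q1, q2) (tmap cst c1), dot (q0, q1, q2) (tmap cst c2))"
    using assms unfolding Xm tmap_transp tmap.simps(1)[of "tmap cst"] vm_transp .
  then show ?thesis
    by (simp only: prod.inject insert_subset empty_subsetI simp_thms span3_memI)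
qed

lemma thom_vm_const: "thom (0, d) q \<Longrightarrow> thom (0, d) (vm q (cmat Xm))"
proof -
  assume q: "thom (0, d) q"
  obtain c0 c1 c2 where "transp Xm = (c0, c1, c2)" by (cases "transp Xm" rule: prod_cases3)
  then have Xm: "Xm = transp (c0, c1, c2)" by (metis transp_transp)
  have "dot q (tmap cst c) \<in> bihom (0, d)" for c
    using dot_bihom[OF q thom_cst[of c]] by simp
  then show ?thesis unfolding Xm tmap_transp tmap.simps(1)[of "tmap cst"] vm_transp by simp
qed

lemma st_unique:
  assumes "smul (var Xs) x + smul (var Xt) y = smul (var Xs) x' + smul (var Xt) y'"
    and "thom (0, d) x" "thom (0, d) y" "thom (0, d) x'" "thom (0, d) y'"
  shows "x = x'" "y = y'"
proof -
  have fx: "tmap (subst \<theta>) z = z" if "thom (0, d) z" "\<theta> Xu = var Xu" "\<theta> Xv = var Xv" for \<theta> and z :: "'a bipoly tri"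
    using that by (cases z) (auto intro: subst_fixes)
  have e: "smul (\<theta> Xs) x + smul (\<theta> Xt) y = smul (\<theta> Xs) x' + smul (\<theta> Xt) y'"
    if "\<theta> Xu = var Xu" "\<theta> Xv = var Xv" for \<theta>
    using arg_cong[OF assms(1), of "tmap (subst \<theta>)"] assms(2-5) that
    by (simp add: tmap_hom[OF ring_map_subst] peval_var[OF ring_map_cst] fx)
  show "x = x'" using e[of "var(Xs := 1, Xt := 0)"] by simp
  show "y = y'" using e[of "var(Xs := 0, Xt := 1)"] by simp
qed

lemma bc_thom: "thom a x \<Longrightarrow> thom a (tmap bc x)"
  by (cases x) (simp add: bc_bihom)

lemma tmap_bc_cst: "tmap bc (tmap cst c) = tmap cst (tmap to_ac c)"
  by (cases c) (simp add: bc_single)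

lemma tmap_bc_cmat: "tmap (tmap bc) (cmat Xm) = cmat (tmap (tmap to_ac) Xm)"
  by (cases Xm rule: prod_cases3) (simp add: tmap_bc_cst)

lemma tmap_diag:
  assumes "ring_map h"
  shows "tmap (tmap h) (diag (a, b, c)) = diag (h a, h b, h c)"
  by (simp add: ring_map_simps[OF assms])

lemma pencil_of_points:
  fixes s :: "'a::comm_ring_1"
  shows "((a0 * s + b0 * t) * g0, (a1 * s + b1 * t) * g1, (a2 * s + b2 * t) * g2)
    = smul s (vm (g0, g1, g2) (diag (a0, a1, a2))) + smul t (vm (g0, g1, g2) (diag (b0, b1, b2)))"
  by (simp add: algebra_simps)

lemma vm_diag:
  fixes a0 :: "'a::comm_ring_1"
  shows "vm (g0, g1, g2) (diag (a0, a1, a2)) = (a0 * g0, a1 * g1, a2 * g2)"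
  by (simp add: mult.commute)

lemma normal_pointsD:
  assumes "normal_points n W (a0, a1, a2) (b0, b1, b2) (g0, g1, g2)"
  shows "a0 + a1 + a2 = 0" "b0 + b1 + b2 = 0" "a0 * b1 - a1 * b0 \<noteq> 0" "thom (0, int n) (g0, g1, g2)"
    "lin_form a0 b0 * g0 \<in> extend_scalars W" "lin_form a1 b1 * g1 \<in> extend_scalars W"
    "lin_form a2 b2 * g2 \<in> extend_scalars W"
    "indep3 (lin_form a0 b0 * g0, lin_form a1 b1 * g1, lin_form a2 b2 * g2)"
    "indep3 (g0, g1, g2)"
  using assms unfolding normal_points_def prod.case thom.simps by - ((elim conjE)?, (intro conjI)?; assumption)+

text \<open>Over the closure \<open>f\<close> and the split basis \<open>l\<^sub>i g\<^sub>i\<close> are related by an invertible \<open>Q\<close>.  Comparing the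
  coefficients of \<open>s\<close> and \<open>t\<close> shows that the coefficient vectors \<open>x, y\<close> of \<open>f = s x + t y\<close> and the
  \<open>g\<^sub>i\<close> have the same span over the closure.  So the span of the entries of \<open>x\<close> and \<open>y\<close> over the
  ground field has dimension three, and \<open>q\<close> is a basis of it.\<close>

theorem section_coordinates:
  fixes W :: "'k::field bipoly set"
  assumes W: "W = bipoly.span {f0, f1, f2}"
    and fhom: "f0 \<in> bihom (1, int n)" "f1 \<in> bihom (1, int n)" "f2 \<in> bihom (1, int n)"
    and np: "normal_points n W (a0, a1, a2) (b0, b1, b2) g"
  obtains q Xm Ym P Q where
    "thom (0, int n) q" "indep3 q"
    "(f0, f1, f2) = smul (var Xs) (vm q (cmat Xm)) + smul (var Xt) (vm q (cmat Ym))"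
    "g = vm (tmap bc q) (cmat P)" "mdet P \<noteq> 0" "mdet Q \<noteq> 0"
    "tmap (tmap to_ac) Xm = mm P (mm (diag (a0, a1, a2)) Q)"
    "tmap (tmap to_ac) Ym = mm P (mm (diag (b0, b1, b2)) Q)"
proof -
  obtain g0 g1 g2 where g: "g = (g0, g1, g2)" by (cases g)
  note np' = normal_pointsD[OF np[unfolded g]]
  note ghom = np'(4)[folded g] and wmem = np'(5-7) and wind = np'(8) and gind = np'(9)[folded g]
  let ?w = "(lin_form a0 b0 * g0, lin_form a1 b1 * g1, lin_form a2 b2 * g2)"
  let ?Da = "diag (a0, a1, a2)" and ?Db = "diag (b0, b1, b2)"
  have w: "?w = smul (var Xs) (vm g (cmat ?Da)) + smul (var Xt) (vm g (cmat ?Db))"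
    unfolding g lin_form_def tmap_diag[OF ring_map_cst] by (rule pencil_of_points)
  have ext: "extend_scalars W = bipoly.span {bc f0, bc f1, bc f2}"
  proof
    have "bc ` W \<subseteq> bipoly.span (bc ` {f0, f1, f2})" unfolding W using bc_span by blast
    then show "extend_scalars W \<subseteq> bipoly.span {bc f0, bc f1, bc f2}"
      unfolding extend_scalars_def by (intro bipoly.span_minimal) simp_all
    show "bipoly.span {bc f0, bc f1, bc f2} \<subseteq> extend_scalars W"
      unfolding extend_scalars_def W by (intro bipoly.span_mono) (auto intro: bipoly.span_base)
  qed
  obtain Q' where Q': "?w = vm (bc f0, bc f1, bc f2) (cmat Q')"
    using span_columns wmem unfolding ext by blast
  obtain Q where Q: "(bc f0, bc f1, bc f2) = vm ?w (cmat Q)" "mdet Q' * mdet Q = 1"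
    using change_of_basis[OF wind Q'] by blast
  obtain x0 y0 where f0: "x0 \<in> bihom (0, int n)" "y0 \<in> bihom (0, int n)" "f0 = var Xs * x0 + var Xt * y0"
    using bihom_1[OF fhom(1)] by blast
  obtain x1 y1 where f1: "x1 \<in> bihom (0, int n)" "y1 \<in> bihom (0, int n)" "f1 = var Xs * x1 + var Xt * y1"
    using bihom_1[OF fhom(2)] by blast
  obtain x2 y2 where f2: "x2 \<in> bihom (0, int n)" "y2 \<in> bihom (0, int n)" "f2 = var Xs * x2 + var Xt * y2"
    using bihom_1[OF fhom(3)] by blast
  let ?x = "(x0, x1, x2)" and ?y = "(y0, y1, y2)"
  have xh: "thom (0, int n) ?x" "thom (0, int n) ?y" using f0 f1 f2 by simp_all
  have f: "(f0, f1, f2) = smul (var Xs) ?x + smul (var Xt) ?y"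
    using f0(3) f1(3) f2(3) by simp
  have bf: "(bc f0, bc f1, bc f2) = smul (var Xs) (tmap bc ?x) + smul (var Xt) (tmap bc ?y)"
    using arg_cong[OF f, of "tmap bc"] unfolding tmap_hom[OF ring_map_bc] bc_var tmap.simps(1)[of bc f0] .
  have "smul (var Xs) (tmap bc ?x) + smul (var Xt) (tmap bc ?y)
     = smul (var Xs) (vm g (cmat (mm ?Da Q))) + smul (var Xt) (vm g (cmat (mm ?Db Q)))"
    unfolding bf[symmetric] Q(1) w vm_linear vm_vm tmap_mm[OF ring_map_cst] ..
  from st_unique[OF this] have xy:
    "tmap bc ?x = vm g (cmat (mm ?Da Q))" "tmap bc ?y = vm g (cmat (mm ?Db Q))"
    using xh ghom thom_vm_const bc_thom by metis+
  have "smul (var Xs) (vm g (cmat ?Da)) + smul (var Xt) (vm g (cmat ?Db))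
      = smul (var Xs) (vm (tmap bc ?x) (cmat Q')) + smul (var Xt) (vm (tmap bc ?y) (cmat Q'))"
    unfolding w[symmetric] Q' bf vm_linear ..
  from st_unique[OF this] have gxy:
    "vm g (cmat ?Da) = vm (tmap bc ?x) (cmat Q')" "vm g (cmat ?Db) = vm (tmap bc ?y) (cmat Q')"
    using xh ghom thom_vm_const bc_thom by metis+
  obtain B where B: "B \<subseteq> {x0, x1, x2, y0, y1, y2}" "bipoly.independent B" "{x0, x1, x2, y0, y1, y2} \<subseteq> bipoly.span B"
    using bipoly.maximal_independent_subset by blast
  have finB: "finite B" using B(1) by (rule finite_subset) simp
  have Bind: "bipoly.independent (bc ` B)" by (rule bc_independent[OF finB B(2)])
  \<comment> \<open>Each \<open>g\<^sub>i\<close> is recovered from \<open>a\<^sub>i g\<^sub>i\<close> and \<open>b\<^sub>i g\<^sub>i\<close>, since \<open>a\<^sub>i\<close> and \<open>b\<^sub>i\<close> do not both vanish.\<close>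
  have "bipoly.span (bc ` B) = bipoly.span {g0, g1, g2}"
  proof
    have "{bc x0, bc x1, bc x2} \<subseteq> bipoly.span {g0, g1, g2}" "{bc y0, bc y1, bc y2} \<subseteq> bipoly.span {g0, g1, g2}"
      using columns_span xy unfolding g tmap.simps by blast+
    then show "bipoly.span (bc ` B) \<subseteq> bipoly.span {g0, g1, g2}"
      using B(1) by (intro bipoly.span_minimal) auto
    have xyB: "{bc x0, bc x1, bc x2} \<subseteq> bipoly.span (bc ` B)" "{bc y0, bc y1, bc y2} \<subseteq> bipoly.span (bc ` B)"
      using B(3) bc_span by blast+
    have sx: "bipoly.span {bc x0, bc x1, bc x2} \<subseteq> bipoly.span (bc ` B)"
      "bipoly.span {bc y0, bc y1, bc y2} \<subseteq> bipoly.span (bc ` B)"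
      using xyB by (intro bipoly.span_minimal bipoly.subspace_span; simp)+
    have vda: "vm g (cmat ?Da) = (cst a0 * g0, cst a1 * g1, cst a2 * g2)"
      and vdb: "vm g (cmat ?Db) = (cst b0 * g0, cst b1 * g1, cst b2 * g2)"
      unfolding g tmap_diag[OF ring_map_cst] by (rule vm_diag)+
    have ag: "{cst a0 * g0, cst a1 * g1, cst a2 * g2} \<subseteq> bipoly.span (bc ` B)"
      using columns_span[OF gxy(1)[unfolded vda tmap.simps(1)[of bc]]] sx by blast
    have bg: "{cst b0 * g0, cst b1 * g1, cst b2 * g2} \<subseteq> bipoly.span (bc ` B)"
      using columns_span[OF gxy(2)[unfolded vdb tmap.simps(1)[of bc]]] sx by blast
    have div: "h \<in> bipoly.span (bc ` B)"
      if "cst a * h \<in> bipoly.span (bc ` B)" "cst b * h \<in> bipoly.span (bc ` B)" "lin_form a b * h \<noteq> 0" for a b h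
    proof -
      have sc: "h \<in> bipoly.span (bc ` B)" if "cst c * h \<in> bipoly.span (bc ` B)" "c \<noteq> 0" for c
      proof -
        have "scale (1 / c) (cst c * h) \<in> bipoly.span (bc ` B)" using that by (intro bipoly.span_scale)
        moreover have "scale (1 / c) (cst c * h) = h"
          using that(2) unfolding scale_eq[symmetric] by simp
        ultimately show ?thesis by simp
      qed
      have "a \<noteq> 0 \<or> b \<noteq> 0" using that(3) by (auto simp: lin_form_def)
      then show ?thesis using sc that by blast
    qed
    have nz: "lin_form a0 b0 * g0 \<noteq> 0" "lin_form a1 b1 * g1 \<noteq> 0" "lin_form a2 b2 * g2 \<noteq> 0"
      using independent_if_indep3(1)[OF wind] bipoly.dependent_zero by (metis insertCI)+
    show "bipoly.span {g0, g1, g2} \<subseteq> bipoly.span (bc ` B)"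
      using ag bg nz by (intro bipoly.span_minimal) (auto intro: div)
  qed
  moreover have "bipoly.dim (bipoly.span (bc ` B)) = card (bc ` B)"
    using Bind by (rule bipoly.dim_span_eq_card_independent)
  moreover have "card (bc ` B) = card B" by (intro card_image inj_on_subset[OF inj_bc]) simp
  moreover have "bipoly.dim (bipoly.span {g0, g1, g2}) = card {g0, g1, g2}"
    using independent_if_indep3 gind unfolding g by (intro bipoly.dim_span_eq_card_independent) blast
  moreover have "card {g0, g1, g2} = 3" using independent_if_indep3(2-4)[OF gind[unfolded g]] by simp
  ultimately have span_eq: "bipoly.span (bc ` B) = bipoly.span {g0, g1, g2}" and "card B = 3" by simp_all
  then obtain q0 q1 q2 where q: "B = {q0, q1, q2}" "q0 \<noteq> q1" "q1 \<noteq> q2" "q0 \<noteq> q2"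
    unfolding card_3_iff by blast
  let ?q = "(q0, q1, q2)"
  have qh: "thom (0, int n) ?q" using B(1) xh unfolding q by auto
  have qind: "indep3 ?q" using indep3_if_independent B(2) q by blast
  have bqind: "indep3 (tmap bc ?q)"
    using indep3_if_independent[of "bc q0" "bc q1" "bc q2"] Bind q by simp
  obtain Xm where Xm: "?x = vm ?q (cmat Xm)" using span_columns[of x0 x1 x2] B(3) unfolding q by blast
  obtain Ym where Ym: "?y = vm ?q (cmat Ym)" using span_columns[of y0 y1 y2] B(3) unfolding q by blast
  have "{g0, g1, g2} \<subseteq> bipoly.span {bc q0, bc q1, bc q2}"
    using span_eq bipoly.span_superset[of "{g0, g1, g2}"] unfolding q by simp
  then obtain P where P: "g = vm (tmap bc ?q) (cmat P)"
    using span_columns unfolding g tmap.simps by blast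
  have "mdet P \<noteq> 0" using change_of_basis[OF gind P] by auto
  moreover have "mdet Q \<noteq> 0" using Q(2) by auto
  moreover have "tmap (tmap to_ac) Xm = mm P (mm ?Da Q)"
  proof (rule vm_unique[OF bqind])
    have "vm (tmap bc ?q) (cmat (tmap (tmap to_ac) Xm)) = tmap bc ?x"
      unfolding Xm tmap_vm[OF ring_map_bc] tmap_bc_cmat ..
    also have "\<dots> = vm (tmap bc ?q) (cmat (mm P (mm ?Da Q)))"
      unfolding xy P tmap_mm[OF ring_map_cst] vm_vm ..
    finally show "vm (tmap bc ?q) (cmat (tmap (tmap to_ac) Xm)) = vm (tmap bc ?q) (cmat (mm P (mm ?Da Q)))" .
  qed
  moreover have "tmap (tmap to_ac) Ym = mm P (mm ?Db Q)"
  proof (rule vm_unique[OF bqind])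
    have "vm (tmap bc ?q) (cmat (tmap (tmap to_ac) Ym)) = tmap bc ?y"
      unfolding Ym tmap_vm[OF ring_map_bc] tmap_bc_cmat ..
    also have "\<dots> = vm (tmap bc ?q) (cmat (mm P (mm ?Db Q)))"
      unfolding xy P tmap_mm[OF ring_map_cst] vm_vm ..
    finally show "vm (tmap bc ?q) (cmat (tmap (tmap to_ac) Ym)) = vm (tmap bc ?q) (cmat (mm P (mm ?Db Q)))" .
  qed
  moreover have "(f0, f1, f2) = smul (var Xs) (vm ?q (cmat Xm)) + smul (var Xt) (vm ?q (cmat Ym))"
    using f unfolding Xm Ym .
  ultimately show thesis using that qh qind P by blast
qed

section \<open>Exactness over the ground field\<close>

lemma lin_form_sum_zero:
  assumes "a0 + a1 + a2 = (0::'k::field)" "b0 + b1 + b2 = 0"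
  shows "lin_form a2 b2 = - lin_form a0 b0 - lin_form a1 b1"
proof -
  have "a2 = - a0 - a1" "b2 = - b0 - b1"
    using assms by (simp_all add: eq_diff_eq eq_neg_iff_add_eq_0 add_ac)
  then show ?thesis
    unfolding lin_form_def by (simp only: single_diff single_uminus) (simp only: ring_distribs minus_mult_left diff_conv_add_uminus minus_add_distrib add_ac)
qed

lemma not_dvd_lin_form:
  assumes "a0 * b1 - a1 * b0 \<noteq> (0::'k::field)"
  shows "\<not> lin_form a0 b0 dvd lin_form a1 b1"
proof
  assume "lin_form a0 b0 dvd lin_form a1 b1"
  then obtain p where p: "lin_form a1 b1 = lin_form a0 b0 * p" by blast
  define z where "z = peval (\<lambda>c::'k. c) (\<lambda>x. if x = Xs then b0 else - a0)"
  have z: "ring_map z" unfolding z_def by (rule ring_map_peval[OF ring_map_id])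
  have zl: "z (lin_form a b) = a * b0 - b * a0" for a b
    unfolding lin_form_def ring_map_simps[OF z]
    by (simp add: z_def peval_cst[OF ring_map_id] peval_var[OF ring_map_id])
  have "z (lin_form a1 b1) = z (lin_form a0 b0) * z p" unfolding p by (rule ring_map_simps(4)[OF z])
  then show False using assms unfolding zl by (simp add: mult.commute)
qed

text \<open>The retractions are substitutions that solve \<open>l\<^sub>i = 0\<close> for one variable; \<open>\<chi>\<close> is the substitution
  \<open>s = t = 0\<close>, and \<open>s\<close> and \<open>t\<close> are combinations of \<open>l\<^sub>0\<close> and \<open>l\<^sub>1\<close> because these are not
  proportional.\<close>

lemma exists_pencil:
  fixes a0 :: "'k::field"
  assumes sum: "a0 + a1 + a2 = 0" "b0 + b1 + b2 = 0" and det: "a0 * b1 - a1 * b0 \<noteq> 0"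
    and ghom: "g0 \<in> bihom (0, d)" "g1 \<in> bihom (0, d)" "g2 \<in> bihom (0, d)"
    and gnz: "g0 \<noteq> 0" "g1 \<noteq> 0" "g2 \<noteq> 0"
    and cop: "coprime_pair g1 g2" "coprime_pair g2 g0" "coprime_pair g0 g1"
  shows "\<exists>\<psi>0 \<psi>1 \<psi>2 \<chi>. pencil (lin_form a0 b0) (lin_form a1 b1) (lin_form a2 b2) g0 g1 g2 \<psi>0 \<psi>1 \<psi>2 \<chi>"
proof -
  have a2: "a2 = - a0 - a1" and b2: "b2 = - b0 - b1"
    using sum by (simp_all add: eq_diff_eq eq_neg_iff_add_eq_0 add_ac)
  have det': "a1 * b0 - a0 * b1 \<noteq> 0" using det by simp
  have det2: "a2 * b0 - a0 * b2 \<noteq> 0" using det by (simp add: a2 b2 algebra_simps)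
  have nz: "a0 \<noteq> 0 \<or> b0 \<noteq> 0" "a1 \<noteq> 0 \<or> b1 \<noteq> 0" "a2 \<noteq> 0 \<or> b2 \<noteq> 0"
    using det det2 by auto
  obtain \<theta>0 where \<theta>0: "retracts (lin_form a0 b0) (subst \<theta>0)" "\<theta>0 Xu = var Xu" "\<theta>0 Xv = var Xv"
    using lin_form_retraction[OF nz(1)] by blast
  obtain \<theta>1 where \<theta>1: "retracts (lin_form a1 b1) (subst \<theta>1)" "\<theta>1 Xu = var Xu" "\<theta>1 Xv = var Xv"
    using lin_form_retraction[OF nz(2)] by blast
  obtain \<theta>2 where \<theta>2: "retracts (lin_form a2 b2) (subst \<theta>2)" "\<theta>2 Xu = var Xu" "\<theta>2 Xv = var Xv"
    using lin_form_retraction[OF nz(3)] by blast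
  define \<theta> :: "indet \<Rightarrow> 'k bipoly" where "\<theta> = var(Xs := 0, Xt := 0)"
  have \<theta>uv: "\<theta> Xu = var Xu" "\<theta> Xv = var Xv" by (simp_all add: \<theta>_def)
  define D where "D = a0 * b1 - a1 * b0"
  have D: "D \<noteq> 0" using det by (simp add: D_def)
  have comb: "cst x * lin_form a0 b0 + cst y * lin_form a1 b1 = lin_form (x * a0 + y * a1) (x * b0 + y * b1)" for x y
    unfolding lin_form_cst unfolding lin_form_def single_add by (simp only: ring_distribs add_ac)
  have vs: "var Xs = lin_form 1 (0::'k)" "var Xt = lin_form 0 (1::'k)"
    by (simp_all add: lin_form_def)
  have "b1 / D * a0 + - b0 / D * a1 = (a0 * b1 - a1 * b0) / D" "- a1 / D * b0 + a0 / D * b1 = (a0 * b1 - a1 * b0) / D"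
    by (simp_all add: diff_divide_distrib mult.commute)
  then have e: "b1 / D * a0 + - b0 / D * a1 = 1" "- a1 / D * b0 + a0 / D * b1 = 1"
    unfolding D_def[symmetric] using D by simp_all
  have e': "b1 / D * b0 + - b0 / D * b1 = 0" "- a1 / D * a0 + a0 / D * a1 = 0"
    by (simp_all add: mult.commute)
  have s: "var Xs = cst (b1 / D) * lin_form a0 b0 + cst (- b0 / D) * lin_form a1 b1"
    unfolding comb vs e e' ..
  have t: "var Xt = cst (- a1 / D) * lin_form a0 b0 + cst (a0 / D) * lin_form a1 b1"
    unfolding comb vs e e' ..
  have \<chi>_diff: "\<exists>A B. x - subst \<theta> x = A * lin_form a0 b0 + B * lin_form a1 b1" for x
  proof (rule subst_congruent)
    fix y
    show "\<exists>A B. var y - \<theta> y = A * lin_form a0 b0 + B * lin_form a1 b1"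
    proof (cases y)
      case Xs
      then show ?thesis using s by (intro exI[of _ "cst (b1 / D)"] exI[of _ "cst (- b0 / D)"]) (simp add: \<theta>_def)
    next
      case Xt
      then show ?thesis using t by (intro exI[of _ "cst (- a1 / D)"] exI[of _ "cst (a0 / D)"]) (simp add: \<theta>_def)
    qed (rule exI[of _ 0], rule exI[of _ 0], simp add: \<theta>_def)+
  qed
  have \<chi>_l: "subst \<theta> (lin_form a b) = 0" for a b
    unfolding lin_form_def subst_simps by (simp add: \<theta>_def)
  have fx: "subst \<theta>' g = g" if "\<theta>' Xu = var Xu" "\<theta>' Xv = var Xv" "g \<in> bihom (0, d)"
    for \<theta>' and g :: "'k bipoly"
    using subst_fixes[OF that(3,1,2)] .
  have lnz: "lin_form a0 b0 \<noteq> 0" "lin_form a1 b1 \<noteq> 0" "lin_form a2 b2 \<noteq> 0"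
    using nz unfolding lin_form_0_iff by auto
  have "pencil (lin_form a0 b0) (lin_form a1 b1) (lin_form a2 b2) g0 g1 g2 (subst \<theta>0) (subst \<theta>1) (subst \<theta>2) (subst \<theta>)"
    by (unfold_locales; (rule lin_form_sum_zero[OF sum] \<theta>0 \<theta>1 \<theta>2 ring_map_subst \<chi>_l \<chi>_diff lnz cop gnz
          not_dvd_lin_form[OF det] not_dvd_lin_form[OF det'] not_dvd_lin_form[OF det2]
          fx[OF \<theta>0(2,3) ghom(2)] fx[OF \<theta>0(2,3) ghom(3)] fx[OF \<theta>1(2,3) ghom(3)] fx[OF \<theta>1(2,3) ghom(1)]
          fx[OF \<theta>2(2,3) ghom(1)] fx[OF \<theta>2(2,3) ghom(2)] fx[OF \<theta>uv ghom(1)] fx[OF \<theta>uv ghom(2)] fx[OF \<theta>uv ghom(3)]))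
  then show ?thesis by blast
qed

text \<open>Substituting the zero \<open>(b, - a)\<close> of the linear form for \<open>(s, t)\<close> removes the first term and leaves
  powers of \<open>u\<close> and \<open>v\<close>, up to nonzero constants, in the ideal of \<open>g\<close> and \<open>h\<close>: the two forms have no
  common zero.\<close>

lemma coprime_from_powers:
  fixes a :: "'k::field"
  assumes pw: "\<And>x y. x \<in> {Xs, Xt} \<Longrightarrow> y \<in> {Xu, Xv} \<Longrightarrow>
      \<exists>k z0 z1 z2. (var x * var y) ^ k = lin_form a b * z0 + (z1 * g + z2 * h)"
    and nz: "a \<noteq> 0 \<or> b \<noteq> 0" and hom: "g \<in> bihom (0, d)" "h \<in> bihom (0, d)" and h: "h \<noteq> 0"
  shows "coprime_pair g h"
proof -
  define \<theta> where "\<theta> = var(Xs := cst b, Xt := cst (- a))"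
  obtain x e where x: "x \<in> {Xs, Xt}" "\<theta> x = cst e" "e \<noteq> 0"
  proof (cases "b = 0")
    case True
    then show thesis using nz that[of Xt "- a"] by (simp add: \<theta>_def)
  next
    case False
    then show thesis using that[of Xs b] by (simp add: \<theta>_def)
  qed
  have l: "subst \<theta> (lin_form a b) = 0"
    unfolding lin_form_def subst_simps by (simp add: \<theta>_def single_uminus mult.commute)
  have fx: "subst \<theta> g = g" "subst \<theta> h = h" by (rule subst_fixes[OF hom(1)], simp_all add: \<theta>_def)
    (rule subst_fixes[OF hom(2)], simp_all add: \<theta>_def)
  have "\<exists>k c d. var y ^ k = c * g + d * h" if y: "y \<in> {Xu, Xv}" for y
  proof -
    obtain k z0 z1 z2 where "(var x * var y) ^ k = lin_form a b * z0 + (z1 * g + z2 * h)"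
      using pw[OF x(1) y] by blast
    then have "subst \<theta> ((var x * var y) ^ k) = subst \<theta> (lin_form a b * z0 + (z1 * g + z2 * h))" by (rule arg_cong)
    moreover have "\<theta> y = var y" using y by (auto simp: \<theta>_def)
    ultimately have e: "(cst e * var y) ^ k = subst \<theta> z1 * g + subst \<theta> z2 * h"
      unfolding subst_simps x(2) l fx by simp
    have pc: "cst (1 / e) ^ k * cst e ^ k = 1" using x(3) by (simp flip: power_mult_distrib cst_mult)
    have "var y ^ k = cst (1 / e) ^ k * (cst e * var y) ^ k"
      unfolding power_mult_distrib mult.assoc[symmetric] pc by simp
    also have "\<dots> = (cst (1 / e) ^ k * subst \<theta> z1) * g + (cst (1 / e) ^ k * subst \<theta> z2) * h"
      unfolding e by (simp only: ring_distribs mult.assoc)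
    finally show ?thesis by (intro exI)
  qed
  note pows = this
  obtain k c1 c2 where u: "var Xu ^ k = c1 * g + c2 * h" using pows[of Xu] by auto
  obtain m d1 d2 where v: "var Xv ^ m = d1 * g + d2 * h" using pows[of Xv] by auto
  show ?thesis by (rule coprime_pairI[OF regular_pair_uv u v h])
qed

lemma ideal_gen_span:
  fixes W :: "'k::field bipoly set"
  assumes "W = bipoly.span S"
  shows "ideal_gen W = ideal_gen S"
proof
  have sub: "bipoly.subspace (ideal_gen S)"
    by (rule bipoly.subspaceI)
      (auto simp: scale_eq intro: bipoly_ideal.span_zero bipoly_ideal.span_add bipoly_ideal.span_scale)
  have "W \<subseteq> ideal_gen S"
    unfolding assms by (rule bipoly.span_minimal[OF _ sub]) (auto intro: bipoly_ideal.span_base)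
  then show "ideal_gen W \<subseteq> ideal_gen S" by (intro bipoly_ideal.span_minimal) auto
  show "ideal_gen S \<subseteq> ideal_gen W"
    unfolding assms by (intro bipoly_ideal.span_mono) (auto intro: bipoly.span_base)
qed

lemma power_in_ideal:
  assumes bpf: "basepoint_free W" and W: "W = bipoly.span {f0, f1, f2}"
    and xy: "x \<in> {Xs, Xt}" "y \<in> {Xu, Xv}"
  shows "\<exists>k z. (var x * var y) ^ k = dot (f0, f1, f2) z"
proof -
  have "var x * var y \<in> ideal_gen {var Xs, var Xt}"
  proof -
    have "var y * var x \<in> ideal_gen {var Xs, var Xt}"
      using xy(1) by (intro bipoly_ideal.span_scale bipoly_ideal.span_base) auto
    then show ?thesis by (simp only: mult.commute)
  qed
  moreover have "var x * var y \<in> ideal_gen {var Xu, var Xv}"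
    using xy(2) by (intro bipoly_ideal.span_scale bipoly_ideal.span_base) auto
  ultimately have "var x * var y \<in> radical (ideal_gen W)" using bpf unfolding basepoint_free_def by blast
  then obtain k where "(var x * var y) ^ k \<in> ideal_gen W" unfolding radical_def by blast
  then show ?thesis unfolding ideal_gen_span[OF W] ideal_gen3 by blast
qed

lemma diag_lin_form:
  "diag (lin_form a0 b0, lin_form a1 b1, lin_form a2 b2)
    = lin_pencil (var Xs) (cmat (diag (a0, a1, a2))) (var Xt) (cmat (diag (b0, b1, b2)))"
  unfolding tmap_diag[OF ring_map_cst] lin_form_def mult.commute[of "cst _"] by (rule diag_lin_pencil)

text \<open>The three minors of the coefficients of linear forms with sum \<open>0\<close> agree, which makes the cross
  product a multiple of \<open>(g\<^sub>1 g\<^sub>2, g\<^sub>0 g\<^sub>2, g\<^sub>0 g\<^sub>1)\<close>.\<close>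

lemma cross_diag:
  fixes a0 :: "'a::comm_ring_1"
  assumes "a2 = - a0 - a1" "b2 = - b0 - b1"
  shows "cross (vm (g0, g1, g2) (diag (a0, a1, a2))) (vm (g0, g1, g2) (diag (b0, b1, b2)))
    = smul (a0 * b1 - a1 * b0) (g1 * g2, g0 * g2, g0 * g1)"
  unfolding assms by (simp add: algebra_simps)

lemma cross_pencil_left:
  "cross (smul s a + smul t b) a = - smul t (cross a b)"
  "cross (smul s a + smul t b) b = smul s (cross a b)"
  using cross_anti[of b a] by (simp_all add: cross_linear smul_simps)

lemma tmap_retraction:
  assumes r: "\<And>p q. \<rho> (p + q) = \<rho> p + \<rho> q" "\<And>p r. \<rho> (p * bc r) = \<rho> p * r"
  shows "tmap \<rho> (smul p (tmap bc x)) = smul (\<rho> p) x"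
    "tmap \<rho> (cross (tmap bc x) y) = cross x (tmap \<rho> y)"
    "\<rho> (dot (tmap bc x) y) = dot x (tmap \<rho> y)"
    "tmap \<rho> (y + z) = tmap \<rho> y + tmap \<rho> z" "tmap \<rho> (y - z) = tmap \<rho> y - tmap \<rho> z"
    "\<rho> (bc r * p) = r * \<rho> p" "\<rho> (- p) = - \<rho> p"
proof -
  have z: "\<rho> 0 = 0" using r(2)[of 0 0] by simp
  show n: "\<rho> (- p) = - \<rho> p" for p using r(1)[of p "- p"] z by (simp add: eq_neg_iff_add_eq_0 add.commute)
  have d: "\<rho> (p - q) = \<rho> p - \<rho> q" for p q using r(1)[of p "- q"] n by simp
  show l: "\<rho> (bc r * p) = r * \<rho> p" for r p using r(2)[of p r] by (simp only: mult.commute)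
  show "tmap \<rho> (smul p (tmap bc x)) = smul (\<rho> p) x" by (cases x) (simp add: r(2))
  show "tmap \<rho> (cross (tmap bc x) y) = cross x (tmap \<rho> y)" by (cases x, cases y) (simp add: d l)
  show "\<rho> (dot (tmap bc x) y) = dot x (tmap \<rho> y)" by (cases x, cases y) (simp add: r(1) l)
  show "tmap \<rho> (y + z) = tmap \<rho> y + tmap \<rho> z" by (cases y, cases z) (simp add: r(1))
  show "tmap \<rho> (y - z) = tmap \<rho> y - tmap \<rho> z" by (cases y, cases z) (simp add: d)
qed

lemma tmap_retraction_vm:
  assumes r: "\<And>p q. \<rho> (p + q) = \<rho> p + \<rho> q" "\<And>p r. \<rho> (p * bc r) = \<rho> p * r"
  shows "tmap \<rho> (vm y (tmap (tmap bc) M)) = vm (tmap \<rho> y) M"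
  by (cases y, cases M rule: prod_cases3) (simp add: tmap_retraction[OF r])

lemma generator_combination:
  fixes l0 :: "'a::comm_ring_1"
  shows "l0 * (g0 * z0) + (l1 * (g1 * z1) + l2 * (g2 * z2)) = l0 * (g0 * z0) + ((l1 * z1) * g1 + (l2 * z2) * g2)"
    "l0 * (g0 * z0) + (l1 * (g1 * z1) + l2 * (g2 * z2)) = l1 * (g1 * z1) + ((l2 * z2) * g2 + (l0 * z0) * g0)"
    "l0 * (g0 * z0) + (l1 * (g1 * z1) + l2 * (g2 * z2)) = l2 * (g2 * z2) + ((l0 * z0) * g0 + (l1 * z1) * g1)"
  by (simp_all add: ac_simps)

text \<open>Base change puts the data in the diagonal form of \<open>split_pencil\<close>, where exactness is known, and the
  retraction of \<open>polynomial_retraction\<close> carries the solutions back.\<close>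

theorem section_exactness:
  fixes W :: "'k::field bipoly set"
  assumes bpf: "basepoint_free W" and W: "W = bipoly.span {f0, f1, f2}"
    and np: "normal_points n W (a0, a1, a2) (b0, b1, b2) g"
    and f: "(f0, f1, f2) = smul (var Xs) (vm q (cmat Xm)) + smul (var Xt) (vm q (cmat Ym))"
    and gP: "g = vm (tmap bc q) (cmat P)" and detP: "mdet P \<noteq> 0" and detQ: "mdet Q \<noteq> 0"
    and Xm: "tmap (tmap to_ac) Xm = mm P (mm (diag (a0, a1, a2)) Q)"
    and Ym: "tmap (tmap to_ac) Ym = mm P (mm (diag (b0, b1, b2)) Q)"
    and q: "q = cross N1 N2"
    and uA: "var Xu ^ k = dot A q" and vB: "var Xv ^ m = dot B q"
    and M: "M = lin_pencil (var Xs) (cmat Xm) (var Xt) (cmat Ym)"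
    and a: "a = vm q (cmat Xm)" and b: "b = vm q (cmat Ym)"
  shows "dot (f0, f1, f2) x = 0 \<Longrightarrow> \<exists>\<xi> y z0 z1. x = smul \<xi> (cross a b) + cross (f0, f1, f2) y
      + smul z0 (vm N1 (cof M)) + smul z1 (vm N2 (cof M))" (is "_ \<Longrightarrow> ?E0")
    and "smul \<xi> (cross a b) + cross (f0, f1, f2) y + smul z0 (vm N1 (cof M)) + smul z1 (vm N2 (cof M)) = 0
      \<Longrightarrow> \<exists>\<alpha> \<beta> \<gamma>. \<xi> = var Xs * \<alpha> + var Xt * \<beta> \<and> y = smul \<beta> a - smul \<alpha> b + vm \<gamma> M
        \<and> z0 = dot N2 \<gamma> \<and> z1 = - dot N1 \<gamma>" (is "_ \<Longrightarrow> ?E1")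
proof -
  obtain g0 g1 g2 where g: "g = (g0, g1, g2)" by (cases g)
  note np' = normal_pointsD[OF np[unfolded g]]
  let ?l0 = "lin_form a0 b0" and ?l1 = "lin_form a1 b1" and ?l2 = "lin_form a2 b2"
  let ?f = "(f0, f1, f2)" and ?bM = "tmap (tmap bc) M"
  have ghom: "g0 \<in> bihom (0, int n)" "g1 \<in> bihom (0, int n)" "g2 \<in> bihom (0, int n)"
    using np'(4) by simp_all
  have gnz: "g0 \<noteq> 0" "g1 \<noteq> 0" "g2 \<noteq> 0"
    using independent_if_indep3(1)[OF np'(9)] bipoly.dependent_zero by (metis insertCI)+
  have a2: "a2 = - a0 - a1" and b2: "b2 = - b0 - b1"
    using np'(1,2) by (simp_all add: eq_diff_eq eq_neg_iff_add_eq_0 add_ac)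
  have nz: "a0 \<noteq> 0 \<or> b0 \<noteq> 0" "a1 \<noteq> 0 \<or> b1 \<noteq> 0" "a2 \<noteq> 0 \<or> b2 \<noteq> 0"
  proof -
    show "a0 \<noteq> 0 \<or> b0 \<noteq> 0" "a1 \<noteq> 0 \<or> b1 \<noteq> 0" using np'(3) by auto
    have "a0 * b1 - a1 * b0 = a2 * b0 - a0 * b2" by (simp add: a2 b2 algebra_simps)
    then show "a2 \<noteq> 0 \<or> b2 \<noteq> 0" using np'(3) by auto
  qed
  have bM: "?bM = mm (cmat P) (mm (diag (?l0, ?l1, ?l2)) (cmat Q))"
    unfolding M tmap_lin_pencil[OF ring_map_bc] bc_var tmap_bc_cmat Xm Ym diag_lin_form tmap_mm[OF ring_map_cst]
      mm_lin_pencil_left mm_lin_pencil_right ..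
  have fM: "?f = vm q M" unfolding M vm_lin_pencil by (rule f)
  have bf: "tmap bc ?f = vm (tmap bc q) ?bM" unfolding fM by (rule tmap_vm[OF ring_map_bc])
  have bf': "tmap bc ?f = vm (?l0 * g0, ?l1 * g1, ?l2 * g2) (cmat Q)"
    unfolding bf bM vm_vm[symmetric] gP[symmetric] g vm_diag ..
  have pw: "\<exists>k z0 z1 z2. (var x * var y) ^ k = ?l0 * (g0 * z0) + (?l1 * (g1 * z1) + ?l2 * (g2 * z2))"
    if xy: "x \<in> {Xs, Xt}" "y \<in> {Xu, Xv}" for x y
  proof -
    obtain k z where "(var x * var y) ^ k = dot ?f z" using power_in_ideal[OF bpf W xy] by blast
    then have "bc ((var x * var y) ^ k) = bc (dot ?f z)" by (rule arg_cong)
    then have e: "(var x * var y) ^ k = dot (vm (?l0 * g0, ?l1 * g1, ?l2 * g2) (cmat Q)) (tmap bc z)"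
      unfolding tmap_hom(2)[OF ring_map_bc] bf' bc_simps .
    obtain z0 z1 z2 where z: "mv (cmat Q) (tmap bc z) = (z0, z1, z2)" by (cases "mv (cmat Q) (tmap bc z)")
    have "(var x * var y) ^ k = ?l0 * (g0 * z0) + (?l1 * (g1 * z1) + ?l2 * (g2 * z2))"
      unfolding e dot_vm z dot.simps by (simp only: mult.assoc add.assoc)
    then show ?thesis by (intro exI)
  qed
  have cop: "coprime_pair g1 g2"
  proof (rule coprime_from_powers[OF _ nz(1) ghom(2,3) gnz(3)])
    show "\<exists>k z0 z1 z2. (var x * var y) ^ k = ?l0 * z0 + (z1 * g1 + z2 * g2)"
      if "x \<in> {Xs, Xt}" "y \<in> {Xu, Xv}" for x y
      using pw[OF that] by (elim exE) (intro exI, erule trans, rule generator_combination(1))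
  qed
  have cop': "coprime_pair g2 g0"
  proof (rule coprime_from_powers[OF _ nz(2) ghom(3,1) gnz(1)])
    show "\<exists>k z0 z1 z2. (var x * var y) ^ k = ?l1 * z0 + (z1 * g2 + z2 * g0)"
      if "x \<in> {Xs, Xt}" "y \<in> {Xu, Xv}" for x y
      using pw[OF that] by (elim exE) (intro exI, erule trans, rule generator_combination(2))
  qed
  have cop'': "coprime_pair g0 g1"
  proof (rule coprime_from_powers[OF _ nz(3) ghom(1,2) gnz(2)])
    show "\<exists>k z0 z1 z2. (var x * var y) ^ k = ?l2 * z0 + (z1 * g0 + z2 * g1)"
      if "x \<in> {Xs, Xt}" "y \<in> {Xu, Xv}" for x y
      using pw[OF that] by (elim exE) (intro exI, erule trans, rule generator_combination(3))
  qed
  obtain \<psi>0 \<psi>1 \<psi>2 \<chi> where pen: "pencil ?l0 ?l1 ?l2 g0 g1 g2 \<psi>0 \<psi>1 \<psi>2 \<chi>"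
    using exists_pencil[OF np'(1-3) ghom gnz cop cop' cop''] by blast
  define D where "D = a0 * b1 - a1 * b0"
  have D: "D \<noteq> 0" using np'(3) by (simp add: D_def)
  have inv: "cst (1 / e) * cst e = 1" if "e \<noteq> 0" for e :: "'k alg_closure"
    using that by (simp flip: cst_mult)
  have ba: "tmap bc a = vm (vm g (cmat (diag (a0, a1, a2)))) (cmat Q)"
    unfolding a tmap_vm[OF ring_map_bc] tmap_bc_cmat Xm tmap_mm[OF ring_map_cst] vm_vm[symmetric] gP[symmetric] ..
  have bb: "tmap bc b = vm (vm g (cmat (diag (b0, b1, b2)))) (cmat Q)"
    unfolding b tmap_vm[OF ring_map_bc] tmap_bc_cmat Ym tmap_mm[OF ring_map_cst] vm_vm[symmetric] gP[symmetric] ..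
  have bfab: "tmap bc ?f = smul (var Xs) (tmap bc a) + smul (var Xt) (tmap bc b)"
    using arg_cong[OF f, of "tmap bc"] unfolding tmap_hom[OF ring_map_bc] bc_var a b .
  interpret pencil ?l0 ?l1 ?l2 g0 g1 g2 \<psi>0 \<psi>1 \<psi>2 \<chi> by (rule pen)
  interpret split_pencil ?l0 ?l1 ?l2 g0 g1 g2 \<psi>0 \<psi>1 \<psi>2 \<chi> "cmat P" "cmat Q" "tmap bc q" "tmap bc N1" "tmap bc N2"
    "tmap bc A" "tmap bc B" "tmap bc (cross a b)" "tmap bc a" "tmap bc b" "var Xu ^ k" "var Xv ^ m"
    "cst (1 / mdet P)" "cst (1 / mdet Q)" "cst D" "cst (1 / D)" "var Xs" "var Xt" "cst a0" "cst b0" "cst a1" "cst b1"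
  proof
    show "regular_pair (var Xu ^ k) (var Xv ^ m :: 'k alg_closure bipoly)" by (rule regular_pair_uv)
    show "var Xu ^ k = dot (tmap bc A) (tmap bc q)"
      using arg_cong[OF uA, of bc] unfolding tmap_hom(2)[OF ring_map_bc] bc_simps .
    show "var Xv ^ m = dot (tmap bc B) (tmap bc q)"
      using arg_cong[OF vB, of bc] unfolding tmap_hom(2)[OF ring_map_bc] bc_simps .
    show "tmap bc q = cross (tmap bc N1) (tmap bc N2)" unfolding q by (rule tmap_hom(1)[OF ring_map_bc])
    show "(g0, g1, g2) = vm (tmap bc q) (cmat P)" using gP g by simp
    show "cst (1 / mdet P) * mdet (cmat P) = 1" unfolding tmap_mdet[OF ring_map_cst] by (rule inv[OF detP])
    show "cst (1 / mdet Q) * mdet (cmat Q) = 1" unfolding tmap_mdet[OF ring_map_cst] by (rule inv[OF detQ])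
    show "cst (1 / D) * cst D = 1" by (rule inv[OF D])
    have c2: "cst a2 = - cst a0 - cst a1" "cst b2 = - cst b0 - cst b1"
      unfolding a2 b2 by (simp_all only: single_diff single_uminus)
    have cD: "cst D = cst a0 * cst b1 - cst a1 * cst b0" unfolding D_def by (simp only: single_diff cst_mult)
    show "tmap bc (cross a b) = vm (smul (cst D) (g1 * g2, g0 * g2, g0 * g1)) (cof (cmat Q))"
      unfolding tmap_hom(1)[OF ring_map_bc] ba bb cross_vm g tmap_diag[OF ring_map_cst] cross_diag[OF c2] cD ..
    show "cross (vm (tmap bc q) (mm (cmat P) (mm (diag (?l0, ?l1, ?l2)) (cmat Q)))) (tmap bc a)
        = - smul (var Xt) (tmap bc (cross a b))"
      unfolding bM[symmetric] bf[symmetric] bfab tmap_hom(1)[OF ring_map_bc] by (rule cross_pencil_left(1))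
    show "cross (vm (tmap bc q) (mm (cmat P) (mm (diag (?l0, ?l1, ?l2)) (cmat Q)))) (tmap bc b)
        = smul (var Xs) (tmap bc (cross a b))"
      unfolding bM[symmetric] bf[symmetric] bfab tmap_hom(1)[OF ring_map_bc] by (rule cross_pencil_left(2))
    show "?l0 = cst a0 * var Xs + cst b0 * var Xt" "?l1 = cst a1 * var Xs + cst b1 * var Xt"
      by (simp_all only: lin_form_def)
  qed
  note E0 = exact_at_generators[unfolded bM[symmetric] bf[symmetric]]
  note E1 = exact_at_syzygies[unfolded bM[symmetric] bf[symmetric]]
  have cN: "vm (tmap bc N) (cof ?bM) = tmap bc (vm N (cof M))" for N
    unfolding tmap_vm[OF ring_map_bc] tmap_cof[OF ring_map_bc] ..
  obtain \<rho> :: "'k alg_closure bipoly \<Rightarrow> 'k bipoly" where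
    \<rho>: "\<And>p. \<rho> (bc p) = p" "\<And>p q. \<rho> (p + q) = \<rho> p + \<rho> q" "\<And>p r. \<rho> (p * bc r) = \<rho> p * r"
    using polynomial_retraction by metis
  note \<rho>_simps = tmap_retraction[OF \<rho>(2,3)] tmap_retraction_vm[OF \<rho>(2,3)]
  have \<rho>t: "tmap \<rho> (tmap bc y) = y" for y by (cases y) (simp add: \<rho>(1))
  show ?E0 if x0: "dot ?f x = 0"
  proof -
    have "dot (tmap bc ?f) (tmap bc x) = 0"
      using arg_cong[OF x0, of bc] unfolding tmap_hom(2)[OF ring_map_bc] bc_simps(1) .
    from E0[OF this] obtain \<xi> y z0 z1 where
      "tmap bc x = smul \<xi> (tmap bc (cross a b)) + cross (tmap bc ?f) y
        + smul z0 (tmap bc (vm N1 (cof M))) + smul z1 (tmap bc (vm N2 (cof M)))"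
      unfolding cN by (elim exE)
    from arg_cong[OF this, of "tmap \<rho>"]
    have "x = smul (\<rho> \<xi>) (cross a b) + cross ?f (tmap \<rho> y)
        + smul (\<rho> z0) (vm N1 (cof M)) + smul (\<rho> z1) (vm N2 (cof M))"
      unfolding \<rho>_simps \<rho>t .
    then show ?thesis by (intro exI)
  qed
  show ?E1 if s0: "smul \<xi> (cross a b) + cross ?f y + smul z0 (vm N1 (cof M)) + smul z1 (vm N2 (cof M)) = 0"
  proof -
    have "smul (bc \<xi>) (tmap bc (cross a b)) + cross (tmap bc ?f) (tmap bc y)
      + smul (bc z0) (tmap bc (vm N1 (cof M))) + smul (bc z1) (tmap bc (vm N2 (cof M))) = 0"
      using arg_cong[OF s0, of "tmap bc"] unfolding tmap_hom(2-6)[OF ring_map_bc] tmap_hom(1)[OF ring_map_bc, of ?f] .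
    from E1[unfolded cN, OF this] obtain \<alpha> \<beta> \<gamma> where
      e: "bc \<xi> = var Xs * \<alpha> + var Xt * \<beta>" "tmap bc y = smul \<beta> (tmap bc a) - smul \<alpha> (tmap bc b) + vm \<gamma> ?bM"
      "bc z0 = dot (tmap bc N2) \<gamma>" "bc z1 = - dot (tmap bc N1) \<gamma>" by (elim exE conjE)
    have "\<xi> = var Xs * \<rho> \<alpha> + var Xt * \<rho> \<beta>"
      using arg_cong[OF e(1), of \<rho>] unfolding \<rho>(1,2) bc_var[symmetric] \<rho>_simps(6) .
    moreover have "y = smul (\<rho> \<beta>) a - smul (\<rho> \<alpha>) b + vm (tmap \<rho> \<gamma>) M"
      using arg_cong[OF e(2), of "tmap \<rho>"] unfolding \<rho>_simps \<rho>t .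
    moreover have "z0 = dot N2 (tmap \<rho> \<gamma>)" "z1 = - dot N1 (tmap \<rho> \<gamma>)"
      using arg_cong[OF e(3), of \<rho>] arg_cong[OF e(4), of \<rho>] unfolding \<rho>_simps \<rho>(1) .
    ultimately show ?thesis by (intro exI conjI)
  qed
qed

section \<open>Free resolutions in terms of rows\<close>

text \<open>A matrix given by its list of rows, applied to a list of coordinates.\<close>

definition lmul :: "'a::semiring_0 list list \<Rightarrow> 'a list \<Rightarrow> 'a list" where
  "lmul rs xs = map (\<lambda>r. sum_list (map2 (*) r xs)) rs"

lemma mat_mult_lmul:
  assumes "length xs = nc" "\<forall>r\<in>set rs. length r = nc"
  shows "mat_of_rows_list nc rs *\<^sub>v vec_of_list xs = vec_of_list (lmul rs xs)"
proof (rule eq_vecI)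
  show "dim_vec (mat_of_rows_list nc rs *\<^sub>v vec_of_list xs) = dim_vec (vec_of_list (lmul rs xs))"
    by (simp add: lmul_def mat_of_rows_list_def)
  fix i assume "i < dim_vec (vec_of_list (lmul rs xs))"
  then have i: "i < length rs" by (simp add: lmul_def)
  then have l: "length (rs ! i) = nc" using assms(2) by simp
  have "(mat_of_rows_list nc rs *\<^sub>v vec_of_list xs) $ i = (\<Sum>j = 0..<nc. rs ! i ! j * xs ! j)"
    using i assms(1) by (auto simp: mat_of_rows_list_def scalar_prod_def vec_of_list_index intro!: sum.cong)
  also have "\<dots> = vec_of_list (lmul rs xs) $ i"
    using i l assms(1) by (simp add: lmul_def vec_of_list_index sum_list_sum_nth)
  finally show "(mat_of_rows_list nc rs *\<^sub>v vec_of_list xs) $ i = vec_of_list (lmul rs xs) $ i" .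
qed

lemma carrier_vec_list: "v \<in> carrier_vec n \<longleftrightarrow> (\<exists>xs. length xs = n \<and> v = vec_of_list xs)"
proof
  assume v: "v \<in> carrier_vec n"
  have "length (list_of_vec v) = n" using carrier_vecD[OF v] by simp
  moreover have "v = vec_of_list (list_of_vec v)" by (simp only: vec_list)
  ultimately show "\<exists>xs. length xs = n \<and> v = vec_of_list xs" by (intro exI conjI)
next
  assume "\<exists>xs. length xs = n \<and> v = vec_of_list xs"
  then obtain xs where "length xs = n" "v = vec_of_list xs" by (elim exE conjE)
  then show "v \<in> carrier_vec n" by (intro carrier_vecI) simp
qed

lemma vec_of_list_zero: "vec_of_list xs = 0\<^sub>v (length xs) \<longleftrightarrow> (\<forall>x\<in>set xs. x = 0)"
proof -
  have "vec_of_list xs = 0\<^sub>v (length xs) \<longleftrightarrow> (\<forall>i < length xs. xs ! i = 0)"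
    by (auto simp: vec_eq_iff vec_of_list_index)
  also have "\<dots> \<longleftrightarrow> (\<forall>x\<in>set xs. x = 0)" by (simp only: all_set_conv_all_nth)
  finally show ?thesis .
qed

lemma mat_image_lmul:
  assumes "\<forall>r\<in>set rs. length r = nc"
  shows "mat_image (mat_of_rows_list nc rs) = {vec_of_list (lmul rs xs) | xs. length xs = nc}"
proof -
  have "dim_col (mat_of_rows_list nc rs) = nc" by (simp add: mat_of_rows_list_def)
  then have "mat_image (mat_of_rows_list nc rs) = {mat_of_rows_list nc rs *\<^sub>v v | v. v \<in> carrier_vec nc}"
    by (auto simp: mat_image_def)
  also have "\<dots> = {mat_of_rows_list nc rs *\<^sub>v vec_of_list xs | xs. length xs = nc}"
    unfolding carrier_vec_list by blast
  also have "\<dots> = {vec_of_list (lmul rs xs) | xs. length xs = nc}"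
    using mat_mult_lmul[OF _ assms] by metis
  finally show ?thesis .
qed

lemma mat_kernel_lmul:
  assumes "\<forall>r\<in>set rs. length r = nc"
  shows "mat_kernel (mat_of_rows_list nc rs) = {vec_of_list xs | xs. length xs = nc \<and> (\<forall>y\<in>set (lmul rs xs). y = 0)}"
proof -
  have d: "dim_col (mat_of_rows_list nc rs) = nc" "dim_row (mat_of_rows_list nc rs) = length rs"
    by (simp_all add: mat_of_rows_list_def)
  have "mat_of_rows_list nc rs *\<^sub>v vec_of_list xs = 0\<^sub>v (length rs) \<longleftrightarrow> (\<forall>y\<in>set (lmul rs xs). y = 0)"
    if "length xs = nc" for xs
    using vec_of_list_zero[of "lmul rs xs"] unfolding mat_mult_lmul[OF that assms]
    by (simp add: lmul_def)
  then show ?thesis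
    unfolding mat_kernel_def d carrier_vec_list by blast
qed

lemma exact_lmul:
  assumes "\<forall>r\<in>set rs. length r = nc" "\<forall>r\<in>set rs'. length r = nc'"
    and "\<And>xs. length xs = nc \<Longrightarrow> (\<forall>y\<in>set (lmul rs xs). y = 0) \<longleftrightarrow> (\<exists>ys. length ys = nc' \<and> xs = lmul rs' ys)"
    and "length rs' = nc"
  shows "mat_image (mat_of_rows_list nc' rs') = mat_kernel (mat_of_rows_list nc rs)"
proof -
  have "length (lmul rs' ys) = nc" for ys using assms(4) by (simp add: lmul_def)
  then show ?thesis
    unfolding mat_image_lmul[OF assms(2)] mat_kernel_lmul[OF assms(1)] using assms(3) by auto
qed

definition graded_rows :: "(int \<times> int) list \<Rightarrow> 'k::field bipoly list list \<Rightarrow> (int \<times> int) list \<Rightarrow> bool" where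
  "graded_rows as rs bs \<longleftrightarrow> list_all2 (\<lambda>r b. list_all2 (\<lambda>x a. x \<in> bihom (a - b)) r as) rs bs"

lemma graded_map_rows:
  assumes "graded_rows as rs bs"
  shows "graded_map as bs (mat_of_rows_list (length as) rs)"
    "\<forall>r\<in>set rs. length r = length as" "length rs = length bs"
proof -
  show l: "length rs = length bs" using assms unfolding graded_rows_def by (rule list_all2_lengthD)
  have r: "list_all2 (\<lambda>x a. x \<in> bihom (a - bs ! i)) (rs ! i) as" if "i < length rs" for i
    using assms that by (simp add: graded_rows_def list_all2_conv_all_nth)
  then show "\<forall>r\<in>set rs. length r = length as"
    by (metis in_set_conv_nth list_all2_lengthD)
  show "graded_map as bs (mat_of_rows_list (length as) rs)"
    unfolding graded_map_def using l r
    by (auto simp: mat_of_rows_list_def list_all2_conv_all_nth)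
qed

lemma bihom_in_irrelevant:
  assumes "p \<in> bihom a" "a \<noteq> (0, 0)"
  shows "p \<in> ideal_gen {var Xs, var Xt, var Xu, var Xv}"
  using assms(1)
proof (induction rule: bihom_induct)
  case zero
  show ?case by (rule bipoly_ideal.span_zero)
next
  case (add p q)
  then show ?case by (intro bipoly_ideal.span_add)
next
  case (single m c)
  have "\<exists>x. lookup m x > 0"
  proof (rule ccontr)
    assume "\<not> ?thesis"
    then have "bideg m = (0, 0)" by (simp add: bideg_def)
    then show False using single assms(2) by simp
  qed
  then obtain x where x: "lookup m x > 0" ..
  have "var x \<in> {var Xs, var Xt, var Xu, var Xv :: 'a bipoly}" by (cases x) simp_all
  then have "single (m - single x 1) c * var x \<in> ideal_gen {var Xs, var Xt, var Xu, var Xv}"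
    by (intro bipoly_ideal.span_scale bipoly_ideal.span_base)
  then show ?case by (subst single_split_var(1)[OF x]) (simp only: mult.commute)
qed

text \<open>An entry between two different shifts has a nonzero bidegree, so it has no constant term.\<close>

lemma graded_map_minimal:
  assumes "graded_map as bs M" "set as \<inter> set bs = {}"
  shows "elements_mat M \<subseteq> ideal_gen {var Xs, var Xt, var Xu, var Xv}"
proof
  fix p assume "p \<in> elements_mat M"
  then obtain i j where ij: "i < dim_row M" "j < dim_col M" "p = M $$ (i, j)" using elements_matD by blast
  have M: "i < length bs" "j < length as" using assms(1) ij unfolding graded_map_def by auto
  then have "p \<in> bihom (as ! j - bs ! i)" using assms(1) ij(3) unfolding graded_map_def by blast
  moreover have "as ! j - bs ! i \<noteq> (0, 0)"
  proof
    assume "as ! j - bs ! i = (0, 0)"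
    then have "as ! j - bs ! i = 0" by (simp add: zero_prod_def)
    then have "as ! j = bs ! i" by simp
    then show False using assms(2) M by (metis disjoint_iff nth_mem)
  qed
  ultimately show "p \<in> ideal_gen {var Xs, var Xt, var Xu, var Xv}" by (rule bihom_in_irrelevant)
qed

fun list3 :: "'a tri \<Rightarrow> 'a list" where
  "list3 (a, b, c) = [a, b, c]"

text \<open>The matrices of the maps \<open>d\<^sub>0, d\<^sub>1, d\<^sub>2, d\<^sub>3\<close> described at the beginning.\<close>

fun rows0 :: "'a tri \<Rightarrow> 'a list list" where
  "rows0 (f0, f1, f2) = [[f0, f1, f2]]"

fun rows1 :: "'a::comm_ring_1 tri \<Rightarrow> 'a tri \<Rightarrow> 'a tri \<Rightarrow> 'a tri \<Rightarrow> 'a list list" where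
  "rows1 (f0, f1, f2) (c0, c1, c2) (p0, p1, p2) (r0, r1, r2) =
     [[c0, 0, - f2, f1, p0, r0], [c1, f2, 0, - f0, p1, r1], [c2, - f1, f0, 0, p2, r2]]"

fun rows2 :: "'a::comm_ring_1 \<Rightarrow> 'a \<Rightarrow> 'a tri \<Rightarrow> 'a tri \<Rightarrow> 'a tri tri \<Rightarrow> 'a tri \<Rightarrow> 'a tri \<Rightarrow> 'a list list" where
  "rows2 s t (a0, a1, a2) (b0, b1, b2) ((m00, m01, m02), (m10, m11, m12), (m20, m21, m22)) (x0, x1, x2) (y0, y1, y2) =
     [[s, t, 0, 0, 0],
      [- b0, a0, m00, m10, m20],
      [- b1, a1, m01, m11, m21],
      [- b2, a2, m02, m12, m22],
      [0, 0, y0, y1, y2],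
      [0, 0, - x0, - x1, - x2]]"

fun rows3 :: "'a::comm_ring_1 \<Rightarrow> 'a \<Rightarrow> 'a tri \<Rightarrow> 'a list list" where
  "rows3 s t (q0, q1, q2) = [[t], [- s], [q0], [q1], [q2]]"

lemma rows0_mult: "lmul (rows0 f) (list3 x) = [dot f x]"
  by (cases f, cases x) (simp add: lmul_def)

lemma rows1_mult:
  "lmul (rows1 f c p r) (\<xi> # list3 y @ [z0, z1]) = list3 (smul \<xi> c + cross f y + smul z0 p + smul z1 r)"
  by (cases f, cases c, cases p, cases r, cases y) (simp add: lmul_def algebra_simps)

lemma rows2_mult:
  "lmul (rows2 s t a b M N1 N2) (\<alpha> # \<beta> # list3 \<gamma>)
    = (s * \<alpha> + t * \<beta>) # list3 (smul \<beta> a - smul \<alpha> b + vm \<gamma> M) @ [dot N2 \<gamma>, - dot N1 \<gamma>]"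
  by (cases a, cases b, cases M rule: prod_cases3, rename_tac m0 m1 m2, case_tac m0, case_tac m1, case_tac m2,
      cases N1, cases N2, cases \<gamma>) (simp add: lmul_def algebra_simps)

lemma rows3_mult: "lmul (rows3 s t q) [w] = t * w # - (s * w) # list3 (smul w q)"
  by (cases q) (simp add: lmul_def mult.commute)

lemma list3_eq_iff [simp]: "list3 x = list3 y \<longleftrightarrow> x = y"
  by (cases x, cases y) simp

lemma list3_zero: "(\<forall>y\<in>set (list3 x). y = 0) \<longleftrightarrow> x = 0" for x :: "'a::comm_ring_1 tri"
  by (cases x) (simp add: tri_zero)

lemma length_list3 [simp]: "length (list3 x) = 3"
  by (cases x) simp

lemma length_3_list3: "length xs = 3 \<longleftrightarrow> (\<exists>x. xs = list3 x)"
proof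
  assume "length xs = 3"
  then obtain a b c where "xs = [a, b, c]" by (auto simp: eval_nat_numeral length_Suc_conv)
  then have "xs = list3 (a, b, c)" by simp
  then show "\<exists>x. xs = list3 x" ..
qed auto

lemma length_6: "length xs = 6 \<longleftrightarrow> (\<exists>\<xi> y z0 z1. xs = \<xi> # list3 y @ [z0, z1])"
proof
  assume "length xs = 6"
  then obtain a b c d e f where "xs = [a, b, c, d, e, f]" by (auto simp: eval_nat_numeral length_Suc_conv)
  then have "xs = a # list3 (b, c, d) @ [e, f]" by simp
  then show "\<exists>\<xi> y z0 z1. xs = \<xi> # list3 y @ [z0, z1]" by (intro exI)
qed auto

lemma length_5: "length xs = 5 \<longleftrightarrow> (\<exists>\<alpha> \<beta> \<gamma>. xs = \<alpha> # \<beta> # list3 \<gamma>)"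
proof
  assume "length xs = 5"
  then obtain a b c d e where "xs = [a, b, c, d, e]" by (auto simp: eval_nat_numeral length_Suc_conv)
  then have "xs = a # b # list3 (c, d, e)" by simp
  then show "\<exists>\<alpha> \<beta> \<gamma>. xs = \<alpha> # \<beta> # list3 \<gamma>" by (intro exI)
qed auto

lemma length_1: "length xs = 1 \<longleftrightarrow> (\<exists>w. xs = [w])"
  by (auto simp: length_Suc_conv)

fun mthom :: "int \<times> int \<Rightarrow> 'k::field bipoly tri tri \<Rightarrow> bool" where
  "mthom a (r0, r1, r2) \<longleftrightarrow> thom a r0 \<and> thom a r1 \<and> thom a r2"

lemma thom_vm: "thom a x \<Longrightarrow> mthom b M \<Longrightarrow> thom (a + b) (vm x M)"
  by (cases x, cases M rule: prod_cases3) (simp add: thom_add thom_smul)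

lemma mthom_cof: "mthom a M \<Longrightarrow> mthom (a + a) (cof M)"
  by (cases M rule: prod_cases3) (simp add: thom_cross)

lemma mthom_lin_pencil: "mthom (1, 0) (lin_pencil (var Xs) (cmat Xm) (var Xt) (cmat Ym))"
proof -
  have "thom (1, 0) (smul (var Xs) (tmap cst x) + smul (var Xt) (tmap cst y))" for x y :: "'a tri"
    using thom_smul[OF bihom_var(1) thom_cst[of x]] thom_smul[OF bihom_var(2) thom_cst[of y]]
    by (intro thom_add) simp_all
  then show ?thesis unfolding lin_pencil_def
    by (cases Xm rule: prod_cases3, cases Ym rule: prod_cases3) simp
qed

lemma graded_rows_Nil: "graded_rows [] [] []" "graded_rows [] [[]] [d]"
  by (simp_all add: graded_rows_def)

lemma graded_rows1:
  assumes "thom (p - d) c" "thom (k - d) f" "thom (x - d) A1" "thom (y - d) A2"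
  shows "graded_rows [p, k, k, k, x, y] (rows1 f c A1 A2) [d, d, d]"
  using assms by (cases f, cases c, cases A1, cases A2) (simp add: graded_rows_def bihom_uminus)

lemma graded_rows2:
  assumes "s \<in> bihom (e - p)" "t \<in> bihom (e - p)" "thom (e - k) a" "thom (e - k) b" "mthom (h - k) M"
    "thom (h - x) N2" "thom (h - y) N1"
  shows "graded_rows [e, e, h, h, h] (rows2 s t a b M N1 N2) [p, k, k, k, x, y]"
  using assms
  by (cases a, cases b, cases M rule: prod_cases3, rename_tac m0 m1 m2, case_tac m0, case_tac m1, case_tac m2,
      cases N1, cases N2) (simp add: graded_rows_def bihom_uminus)

lemma graded_rows3:
  assumes "s \<in> bihom (h - e)" "t \<in> bihom (h - e)" "thom (h - k) q"
  shows "graded_rows [h] (rows3 s t q) [e, e, k, k, k]"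
  using assms by (cases q) (simp add: graded_rows_def bihom_uminus)

section \<open>The minimal resolution\<close>

text \<open>The data over the ground field together with the two exactness statements obtained by descent.\<close>

locale section_resolution =
  fixes n \<mu> :: nat and q N1 N2 f a b :: "'k::field bipoly tri" and Xm Ym :: "'k tri tri" and M :: "'k bipoly tri tri"
  assumes M: "M = lin_pencil (var Xs) (cmat Xm) (var Xt) (cmat Ym)"
    and a: "a = vm q (cmat Xm)" and b: "b = vm q (cmat Ym)"
    and f: "f = smul (var Xs) a + smul (var Xt) b" and f_nz: "f \<noteq> 0"
    and q: "q = cross N1 N2" and prim: "primitive q"
    and q_hom: "thom (0, int n) q" and N1: "thom (0, int \<mu>) N1" and N2: "thom (0, int (n - \<mu>)) N2"
    and \<mu>: "0 < \<mu>" "2 * \<mu> \<le> n"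
    and E0: "\<And>x. dot f x = 0 \<Longrightarrow> \<exists>\<xi> y z0 z1. x = smul \<xi> (cross a b) + cross f y
      + smul z0 (vm N1 (cof M)) + smul z1 (vm N2 (cof M))"
    and E1: "\<And>\<xi> y z0 z1. smul \<xi> (cross a b) + cross f y + smul z0 (vm N1 (cof M)) + smul z1 (vm N2 (cof M)) = 0
      \<Longrightarrow> \<exists>\<alpha> \<beta> \<gamma>. \<xi> = var Xs * \<alpha> + var Xt * \<beta> \<and> y = smul \<beta> a - smul \<alpha> b + vm \<gamma> M
        \<and> z0 = dot N2 \<gamma> \<and> z1 = - dot N1 \<gamma>"
begin

abbreviation "R0 \<equiv> rows0 f"
abbreviation "R1 \<equiv> rows1 f (cross a b) (vm N1 (cof M)) (vm N2 (cof M))"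
abbreviation "R2 \<equiv> rows2 (var Xs) (var Xt) a b M N1 N2"
abbreviation "R3 \<equiv> rows3 (var Xs) (var Xt) q"

lemma fM: "f = vm q M"
  unfolding M vm_lin_pencil f a b ..

lemma exact0:
  assumes "length xs = 3"
  shows "(\<forall>y\<in>set (lmul R0 xs). y = 0) \<longleftrightarrow> (\<exists>ys. length ys = 6 \<and> xs = lmul R1 ys)"
proof -
  obtain x where x: "xs = list3 x" using assms unfolding length_3_list3 by blast
  have "dot f x = 0 \<longleftrightarrow> (\<exists>\<xi> y z0 z1. x = smul \<xi> (cross a b) + cross f y
      + smul z0 (vm N1 (cof M)) + smul z1 (vm N2 (cof M)))"
  proof
    assume "\<exists>\<xi> y z0 z1. x = smul \<xi> (cross a b) + cross f y
      + smul z0 (vm N1 (cof M)) + smul z1 (vm N2 (cof M))"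
    then obtain \<xi> y z0 z1 where x: "x = smul \<xi> (cross a b) + cross f y
      + smul z0 (vm N1 (cof M)) + smul z1 (vm N2 (cof M))" by (elim exE)
    have "dot f (vm N (cof M)) = mdet M * dot q N" for N
      unfolding fM dot_vm mv_vm_cof dot_linear ..
    moreover have "dot q N1 = 0" "dot q N2 = 0" unfolding q by (simp_all add: dot_commute[of "cross N1 N2"])
    moreover have "dot f (cross a b) = 0" unfolding f dot_linear by simp
    ultimately show "dot f x = 0" unfolding x dot_linear by simp
  qed (rule E0)
  moreover have "(\<exists>ys. length ys = 6 \<and> xs = lmul R1 ys) \<longleftrightarrow> (\<exists>\<xi> y z0 z1. x = smul \<xi> (cross a b) + cross f y
      + smul z0 (vm N1 (cof M)) + smul z1 (vm N2 (cof M)))"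
  proof -
    have "(\<exists>ys. length ys = 6 \<and> xs = lmul R1 ys) \<longleftrightarrow> (\<exists>\<xi> y z0 z1. list3 x = lmul R1 (\<xi> # list3 y @ [z0, z1]))"
      unfolding length_6 x by blast
    then show ?thesis unfolding rows1_mult list3_eq_iff .
  qed
  ultimately show ?thesis unfolding x rows0_mult by simp
qed

lemma exact1:
  assumes "length xs = 6"
  shows "(\<forall>y\<in>set (lmul R1 xs). y = 0) \<longleftrightarrow> (\<exists>ys. length ys = 5 \<and> xs = lmul R2 ys)"
proof -
  obtain \<xi> y z0 z1 where x: "xs = \<xi> # list3 y @ [z0, z1]" using assms unfolding length_6 by blast
  let ?d = "smul \<xi> (cross a b) + cross f y + smul z0 (vm N1 (cof M)) + smul z1 (vm N2 (cof M))"
  let ?P = "\<exists>\<alpha> \<beta> \<gamma>. \<xi> = var Xs * \<alpha> + var Xt * \<beta> \<and> y = smul \<beta> a - smul \<alpha> b + vm \<gamma> M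
        \<and> z0 = dot N2 \<gamma> \<and> z1 = - dot N1 \<gamma>"
  have "?d = 0 \<longleftrightarrow> ?P"
  proof
    assume ?P
    then obtain \<alpha> \<beta> \<gamma> where e: "\<xi> = var Xs * \<alpha> + var Xt * \<beta>" "y = smul \<beta> a - smul \<alpha> b + vm \<gamma> M"
      "z0 = dot N2 \<gamma>" "z1 = - dot N1 \<gamma>" by (elim exE conjE)
    have fa: "cross f a = - smul (var Xt) (cross a b)" and fb: "cross f b = smul (var Xs) (cross a b)"
      unfolding f by (rule cross_pencil_left)+
    have fg: "cross f (vm \<gamma> M) = smul (dot N1 \<gamma>) (vm N2 (cof M)) - smul (dot N2 \<gamma>) (vm N1 (cof M))"
      unfolding fM cross_vm unfolding q cross_cross_left vm_linear ..
    show "?d = 0"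
      unfolding e cross_linear fa fb fg smul_simps
      by (simp add: mult.commute[of "var _"])
  qed (rule E1)
  moreover have "(\<exists>ys. length ys = 5 \<and> xs = lmul R2 ys) \<longleftrightarrow> ?P"
  proof -
    have "(\<exists>ys. length ys = 5 \<and> xs = lmul R2 ys) \<longleftrightarrow> (\<exists>\<alpha> \<beta> \<gamma>. xs = lmul R2 (\<alpha> # \<beta> # list3 \<gamma>))"
      unfolding length_5 by blast
    then show ?thesis unfolding rows2_mult x by (simp add: append_eq_append_conv)
  qed
  ultimately show ?thesis unfolding x rows1_mult list3_zero by simp
qed

text \<open>From \<open>s \<alpha> + t \<beta> = 0\<close> one gets \<open>(\<alpha>, \<beta>) = w (t, - s)\<close>.  A vector orthogonal to \<open>N\<^sub>1\<close> and \<open>N\<^sub>2\<close> is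
  parallel to \<open>q = N\<^sub>1 \<times> N\<^sub>2\<close>, hence \<open>\<gamma> = e q\<close>, and the middle equation \<open>e f = w f\<close> gives
  \<open>e = w\<close>.\<close>

lemma exact2:
  assumes "length xs = 5"
  shows "(\<forall>y\<in>set (lmul R2 xs). y = 0) \<longleftrightarrow> (\<exists>ys. length ys = 1 \<and> xs = lmul R3 ys)"
proof -
  obtain \<alpha> \<beta> \<gamma> where x: "xs = \<alpha> # \<beta> # list3 \<gamma>" using assms unfolding length_5 by blast
  have "var Xs * \<alpha> + var Xt * \<beta> = 0 \<and> smul \<beta> a - smul \<alpha> b + vm \<gamma> M = 0 \<and> dot N2 \<gamma> = 0 \<and> dot N1 \<gamma> = 0
    \<longleftrightarrow> (\<exists>w. \<alpha> = var Xt * w \<and> \<beta> = - (var Xs * w) \<and> \<gamma> = smul w q)" (is "?L \<longleftrightarrow> ?R")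
  proof
    assume L: ?L
    then obtain w where w: "\<alpha> = var Xt * w" "\<beta> = - (var Xs * w)" using st_kernel by blast
    have "cross \<gamma> q = smul (dot \<gamma> N2) N1 - smul (dot \<gamma> N1) N2" unfolding q by (rule cross_cross_right)
    then have "cross \<gamma> q = 0" using L by (simp add: dot_commute[of \<gamma>])
    then obtain e where e: "\<gamma> = smul e q" using prim unfolding primitive_def by blast
    have "smul \<beta> a - smul \<alpha> b = - smul w f"
      unfolding w f by (simp add: smul_simps mult.commute[of w])
    moreover have "vm \<gamma> M = smul e f" unfolding e fM vm_linear ..
    ultimately have "smul e f = smul w f" using L by simp
    then have "e = w" by (rule smul_cancel_right[OF f_nz])
    then show ?R using w e by (intro exI[of _ w]) simp
  next
    assume ?R
    then obtain w where w: "\<alpha> = var Xt * w" "\<beta> = - (var Xs * w)" "\<gamma> = smul w q" by (elim exE conjE)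
    have "smul \<beta> a - smul \<alpha> b = - smul w f"
      unfolding w f by (simp add: smul_simps mult.commute[of w])
    moreover have "vm \<gamma> M = smul w f" unfolding w fM vm_linear ..
    moreover have "dot N2 q = 0" "dot N1 q = 0" unfolding q by simp_all
    moreover have "var Xs * \<alpha> + var Xt * \<beta> = 0" unfolding w by (simp add: mult.left_commute)
    ultimately show ?L unfolding w dot_linear by simp
  qed
  moreover have "(\<exists>ys. length ys = 1 \<and> xs = lmul R3 ys) \<longleftrightarrow> ?R"
  proof -
    have "(\<exists>ys. length ys = 1 \<and> xs = lmul R3 ys) \<longleftrightarrow> (\<exists>w. xs = lmul R3 [w])"
      unfolding length_1 by blast
    then show ?thesis unfolding rows3_mult x by simp
  qed
  moreover have "(\<forall>y\<in>set (lmul R2 xs). y = 0) \<longleftrightarrow> ?L"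
    unfolding x rows2_mult set_append list.set ball_Un ball_simps list3_zero by auto
  ultimately show ?thesis by simp
qed

lemma exact3:
  assumes "length xs = 1"
  shows "(\<forall>y\<in>set (lmul R3 xs). y = 0) \<longleftrightarrow> (\<exists>ys. length ys = 0 \<and> xs = lmul [[]] ys)"
proof -
  obtain w where x: "xs = [w]" using assms unfolding length_1 by blast
  show ?thesis unfolding x rows3_mult by (auto simp: lmul_def list3_zero tri_zero[symmetric] ball_Un)
qed

abbreviation "F0 \<equiv> [(1, int n), (1, int n), (1, int n)]"
abbreviation "F1 \<equiv> [(1, 3 * int n), (2, 2 * int n), (2, 2 * int n), (2, 2 * int n), (3, int n + int \<mu>), (3, 2 * int n - int \<mu>)]"
abbreviation "F2 \<equiv> [(2, 3 * int n), (2, 3 * int n), (3, 2 * int n), (3, 2 * int n), (3, 2 * int n)]"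
abbreviation "F3 \<equiv> [(3, 3 * int n)]"

lemma resolution_rows_graded:
  "graded_rows F0 R0 [(0, 0)]"
  "graded_rows F1 R1 F0"
  "graded_rows F2 R2 F1"
  "graded_rows F3 R3 F2"
proof -
  have ah: "thom (0, int n) a" and bh: "thom (0, int n) b"
    unfolding a b by (rule thom_vm_const[OF q_hom])+
  have fh: "thom (1, int n) f"
    unfolding f using thom_smul[OF bihom_var(1) ah] thom_smul[OF bihom_var(2) bh] by (intro thom_add) simp_all
  have ch: "thom (0, 2 * int n) (cross a b)" using thom_cross[OF ah bh] by simp
  have Mh: "mthom (1, 0) M" unfolding M by (rule mthom_lin_pencil)
  have N: "thom (2, d) (vm N (cof M))" if "thom (0, d) N" for N d
    using thom_vm[OF that mthom_cof[OF Mh]] by simp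
  have nm: "int (n - \<mu>) = int n - int \<mu>" using \<mu> by simp
  show "graded_rows F0 R0 [(0, 0)]"
    using fh by (cases f) (simp add: graded_rows_def)
  show "graded_rows F1 R1 F0"
    by (rule graded_rows1) (use ch fh N[OF N1] N[OF N2] nm in simp_all)
  show "graded_rows F2 R2 F1"
    by (rule graded_rows2) (use ah bh Mh N1 N2 nm bihom_var in simp_all)
  show "graded_rows F3 R3 F2"
    by (rule graded_rows3) (use q_hom bihom_var in simp_all)
qed

definition shifts :: "nat \<Rightarrow> (int \<times> int) list" where
  "shifts i = (if i < 4 then [F0, F1, F2, F3] ! i else [])"

text \<open>The zero map into \<open>R(-3,-3n)\<close> has one empty row; all later maps have no rows.\<close>

definition res_rows :: "nat \<Rightarrow> 'k bipoly list list" where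
  "res_rows i = (if i < 5 then [R0, R1, R2, R3, [[]]] ! i else [])"

definition res_diff :: "nat \<Rightarrow> 'k bipoly mat" where
  "res_diff i = mat_of_rows_list (length (shifts i)) (res_rows i)"

lemma nat_cases4: obtains "i = 0" | "i = 1" | "i = 2" | "i = 3" | "i \<ge> (4::nat)"
  by linarith

lemma step_graded:
  "graded_rows (shifts (Suc i)) (res_rows (Suc i)) (shifts i)"
  by (cases i rule: nat_cases4) (use resolution_rows_graded in \<open>simp_all add: graded_rows_Nil shifts_def res_rows_def eval_nat_numeral\<close>)

text \<open>The bounds \<open>0 < \<mu> < n\<close> keep \<open>(3, 2n)\<close> apart from the shifts \<open>(3, n + \<mu>)\<close> and \<open>(3, 2n - \<mu>)\<close>.\<close>

lemma step_disjoint: "set (shifts (Suc i)) \<inter> set (shifts i) = {}"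
  by (cases i rule: nat_cases4) (use \<mu> in \<open>auto simp: shifts_def eval_nat_numeral\<close>)

lemma shifts_lengths:
  "length (shifts 0) = 3" "length (shifts 1) = 6" "length (shifts 2) = 5" "length (shifts 3) = 1"
  "length (shifts (Suc 0)) = 6" "length (shifts (Suc 1)) = 5" "length (shifts (Suc 2)) = 1" "length (shifts (Suc 3)) = 0"
  by (simp_all add: shifts_def eval_nat_numeral)

lemma res_rows_values:
  "res_rows 0 = R0" "res_rows 1 = R1" "res_rows 2 = R2" "res_rows 3 = R3"
  "res_rows (Suc 0) = R1" "res_rows (Suc 1) = R2" "res_rows (Suc 2) = R3" "res_rows (Suc 3) = [[]]"
  by (simp_all add: res_rows_def eval_nat_numeral)

lemma step_exact:
  assumes "length xs = length (shifts i)"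
  shows "(\<forall>y\<in>set (lmul (res_rows i) xs). y = 0) \<longleftrightarrow> (\<exists>ys. length ys = length (shifts (Suc i)) \<and> xs = lmul (res_rows (Suc i)) ys)"
proof (cases i rule: nat_cases4)
  case 1
  show ?thesis using exact0 assms unfolding 1 shifts_lengths res_rows_values by blast
next
  case 2
  show ?thesis using exact1 assms unfolding 2 shifts_lengths res_rows_values by blast
next
  case 3
  show ?thesis using exact2 assms unfolding 3 shifts_lengths res_rows_values by blast
next
  case 4
  show ?thesis using exact3 assms unfolding 4 shifts_lengths res_rows_values by blast
next
  case 5
  then show ?thesis using assms by (auto simp: shifts_def res_rows_def lmul_def nth_Cons')
qed

lemma row_lengths: "\<forall>r\<in>set (res_rows i). length r = length (shifts i)"
proof (cases i)
  case 0
  show ?thesis using graded_map_rows(2)[OF resolution_rows_graded(1)] unfolding 0 by (simp add: shifts_def res_rows_def)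
next
  case (Suc j)
  show ?thesis using graded_map_rows(2)[OF step_graded[of j]] unfolding Suc .
qed

theorem minimal_resolution:
  assumes "I = {dot f k | k. True}"
  shows "minimal_bigraded_free_resolution I shifts res_diff"
proof -
  have gm: "graded_map (shifts (Suc i)) (shifts i) (res_diff (Suc i))" for i
    unfolding res_diff_def by (rule graded_map_rows(1)[OF step_graded])
  have "graded_map (shifts 0) [(0, 0)] (res_diff 0)"
    using graded_map_rows(1)[OF resolution_rows_graded(1)] unfolding res_diff_def by (simp add: shifts_def res_rows_def)
  moreover have "mat_image (res_diff 0) = {v \<in> carrier_vec 1. v $ 0 \<in> I}"
  proof -
    have "mat_image (res_diff 0) = {vec_of_list (lmul (res_rows 0) xs) | xs. length xs = length (shifts 0)}"
      unfolding res_diff_def by (rule mat_image_lmul[OF row_lengths])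
    also have "\<dots> = {vec_of_list (lmul R0 xs) | xs. length xs = 3}"
      unfolding shifts_lengths res_rows_values ..
    also have "\<dots> = {vec_of_list [dot f k] | k. True}"
    proof -
      have "{vec_of_list (lmul R0 xs) | xs. length xs = 3} = {vec_of_list (lmul R0 (list3 k)) | k. True}"
        unfolding length_3_list3 by blast
      then show ?thesis unfolding rows0_mult .
    qed
    also have "\<dots> = {v \<in> carrier_vec 1. v $ 0 \<in> I}"
    proof -
      have "{v \<in> carrier_vec 1. v $ 0 \<in> I} = {vec_of_list [w] | w. w \<in> I}"
        unfolding carrier_vec_list length_1 by (auto simp: vec_of_list_index)
      then show ?thesis unfolding assms by blast
    qed
    finally show ?thesis .
  qed
  moreover have "mat_image (res_diff (Suc i)) = mat_kernel (res_diff i)" for i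
    unfolding res_diff_def
    by (rule exact_lmul[OF row_lengths row_lengths step_exact graded_map_rows(3)[OF step_graded]])
  moreover have "elements_mat (res_diff (Suc i)) \<subseteq> ideal_gen {var Xs, var Xt, var Xu, var Xv}" for i
    by (rule graded_map_minimal[OF gm step_disjoint])
  ultimately show ?thesis
    unfolding minimal_bigraded_free_resolution_def bigraded_free_resolution_def using gm by simp
qed

theorem betti_numbers:
  assumes "I = {dot f k | k. True}"
  shows "has_bigraded_betti_numbers I
      (betti_of_shifts
        [replicate 3 (1, int n),
         [(1, 3 * int n)] @ replicate 3 (2, 2 * int n)
           @ [(3, int n + int \<mu>), (3, 2 * int n - int \<mu>)],
         replicate 2 (2, 3 * int n) @ replicate 3 (3, 2 * int n),
         [(3, 3 * int n)]])"
proof -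
  have r: "replicate 3 x = [x, x, x]" "replicate 2 x = [x, x]" for x :: "int \<times> int"
    by (simp_all add: eval_nat_numeral)
  have "betti_of_shifts [F0, F1, F2, F3] i d = count_list (shifts i) d" for i d
    by (simp add: betti_of_shifts_def shifts_def)
  then show ?thesis
    unfolding has_bigraded_betti_numbers_def r append.simps using minimal_resolution[OF assms] by blast
qed

end

theorem theorem4p8:
  fixes W :: "'k::field bipoly set" and n :: nat
  assumes "n > 0"
    and "bipoly.subspace W"
    and "W \<subseteq> bihom (1, int n)"
    and "bipoly.dim W = 3"
    and "basepoint_free W"
    and "finite (segre_section n W)"
    and "\<exists>P Q S. {P, Q, S} \<subseteq> segre_section n W \<and> \<not> proj_collinear {P, Q, S}"
  shows "\<exists>\<mu>::int. 0 < \<mu> \<and> \<mu> \<le> int n div 2 \<and>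
    has_bigraded_betti_numbers (ideal_gen W)
      (betti_of_shifts
        [replicate 3 (1, int n),
         [(1, 3 * int n)] @ replicate 3 (2, 2 * int n)
           @ [(3, int n + \<mu>), (3, 2 * int n - \<mu>)],
         replicate 2 (2, 3 * int n) @ replicate 3 (3, 2 * int n),
         [(3, 3 * int n)]])"
proof -
  obtain F where F: "F \<subseteq> W" "bipoly.independent F" "W \<subseteq> bipoly.span F" "card F = bipoly.dim W"
    using bipoly.basis_exists by blast
  have "card F = 3" using F(4) assms(4) by simp
  then obtain f0 f1 f2 where f: "F = {f0, f1, f2}" "f0 \<noteq> f1" "f1 \<noteq> f2" "f0 \<noteq> f2"
    unfolding card_3_iff by blast
  have W: "W = bipoly.span {f0, f1, f2}"
    using bipoly.span_subspace[OF F(1,3) assms(2)] unfolding f by simp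
  have fhom: "f0 \<in> bihom (1, int n)" "f1 \<in> bihom (1, int n)" "f2 \<in> bihom (1, int n)"
    using F(1) assms(3) unfolding f by auto
  have "f0 \<noteq> 0" using F(2) bipoly.dependent_zero unfolding f by blast
  then have f_nz: "(f0, f1, f2) \<noteq> 0" by (simp add: tri_zero)
  obtain P0 P1 P2 where P: "{P0, P1, P2} \<subseteq> segre_section n W" "\<not> proj_collinear {P0, P1, P2}"
    using assms(7) by (elim exE conjE)
  obtain \<alpha> \<beta> g where np: "normal_points n W \<alpha> \<beta> g"
    using three_points_normal_form[OF assms(6) P] by blast
  obtain a0 a1 a2 where \<alpha>: "\<alpha> = (a0, a1, a2)" by (cases \<alpha>)
  obtain b0 b1 b2 where \<beta>: "\<beta> = (b0, b1, b2)" by (cases \<beta>)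
  note np = np[unfolded \<alpha> \<beta>]
  obtain q Xm Ym P Q where
    q: "thom (0, int n) q" "indep3 q"
      "(f0, f1, f2) = smul (var Xs) (vm q (cmat Xm)) + smul (var Xt) (vm q (cmat Ym))"
      "g = vm (tmap bc q) (cmat P)" "mdet P \<noteq> 0" "mdet Q \<noteq> 0"
      "tmap (tmap to_ac) Xm = mm P (mm (diag (a0, a1, a2)) Q)"
      "tmap (tmap to_ac) Ym = mm P (mm (diag (b0, b1, b2)) Q)"
    by (rule section_coordinates[OF W fhom np])
  \<comment> \<open>At \<open>(s, t) = (1, 0)\<close> the generators become combinations of \<open>q\<close>, and \<open>s u\<close> and \<open>s v\<close> become \<open>u\<close> and \<open>v\<close>.\<close>
  have eval: "\<exists>k A. var y ^ k = dot A q" if y: "y \<in> {Xu, Xv}" for y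
  proof -
    obtain k z where kz: "(var Xs * var y) ^ k = dot (f0, f1, f2) z"
      using power_in_ideal[OF assms(5) W insertI1 y] by blast
    define \<theta> :: "indet \<Rightarrow> 'k bipoly" where "\<theta> = var(Xs := 1, Xt := 0)"
    have \<theta>: "\<theta> Xs = 1" "\<theta> Xt = 0" "\<theta> Xu = var Xu" "\<theta> Xv = var Xv" "\<theta> y = var y"
      using y by (auto simp: \<theta>_def)
    let ?h = "tmap (subst \<theta>)"
    have fx: "?h (vm q (cmat Z)) = vm q (cmat Z)" for Z
      using thom_vm_const[OF q(1), of Z] \<theta>(3,4) by (cases "vm q (cmat Z)") (auto intro: subst_fixes)
    have "?h (f0, f1, f2) = vm q (cmat Xm)"
      unfolding q(3) tmap_hom[OF ring_map_subst] fx peval_var[OF ring_map_cst] \<theta> by simp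
    then have "subst \<theta> (dot (f0, f1, f2) z) = dot (vm q (cmat Xm)) (?h z)"
      unfolding tmap_hom(2)[OF ring_map_subst] by (simp only:)
    moreover have "subst \<theta> ((var Xs * var y) ^ k) = var y ^ k"
      unfolding subst_simps \<theta> by simp
    ultimately have "var y ^ k = dot (mv (cmat Xm) (?h z)) q"
      unfolding kz dot_vm by (simp only: dot_commute)
    then show ?thesis by (intro exI)
  qed
  obtain k A where uA: "var Xu ^ k = dot A q" using eval[of Xu] by auto
  obtain m B where vB: "var Xv ^ m = dot B q" using eval[of Xv] by auto
  interpret binary_triple q A B n k m
    by unfold_locales (use q(1) uA vB indep3D[OF q(2)] in blast)+
  obtain \<mu> N1 N2 where N: "0 < \<mu>" "2 * \<mu> \<le> n" "thom (0, int \<mu>) N1" "thom (0, int (n - \<mu>)) N2" "q = cross N1 N2"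
    using hilbert_burch by metis
  define M where "M = lin_pencil (var Xs) (cmat Xm) (var Xt) (cmat Ym)"
  define a where "a = vm q (cmat Xm)"
  define b where "b = vm q (cmat Ym)"
  note ex = section_exactness[OF assms(5) W np q(3-8) N(5) uA vB M_def a_def b_def]
  interpret section_resolution n \<mu> q N1 N2 "(f0, f1, f2)" a b Xm Ym M
  proof
    show "(f0, f1, f2) = smul (var Xs) a + smul (var Xt) b" unfolding a_def b_def by (rule q(3))
  qed (fact M_def a_def b_def f_nz N q_primitive q(1) ex)+
  have "ideal_gen W = ideal_gen {f0, f1, f2}" by (rule ideal_gen_span[OF W])
  then have I: "ideal_gen W = {dot (f0, f1, f2) k | k. True}" unfolding ideal_gen3 .
  show ?thesis
    using betti_numbers[OF I] N(1,2) by (intro exI[of _ "int \<mu>"] conjI) (simp_all add: zdiv_int)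
qed

end
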